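(* Let $\eta(H)$ and $X(H)$ be increasing real functions of $H>0$ with $\eta(H)\to\infty$ and $X(H)\to\infty$ as $H\to\infty$. Suppose that $\eta(H)$ grows sufficiently slowly relative to $H$ and that $X(H)^{\eta(H)}=H^{1/12+o(1)}$ as $H\to\infty$. For each $E\in\mathcal{E}$ independently, let $(\mathrm{rk}'_E,\mathrm{Sha}'_E)$ be the random variables of the random matrix model described in the context. Then the following hold with probability $1$: (a) all but finitely many $E\in\mathcal{E}$ satisfy $\mathrm{rk}'_E\le 21$; (b) for each integer $1\le r\le 20$, $\#\{E\in\mathcal{E}_{\le H}:\mathrm{rk}'_E\ge r\}=H^{(21-r)/24+o(1)}$ as $H\to\infty$; (c) $\#\{E\in\mathcal{E}_{\le H}:\mathrm{rk}'_E\ge 21\}\le H^{o(1)}$ as $H\to\infty$.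
   Context: Let $\mathcal{E}$ be the set of elliptic curves $y^2=x^3+Ax+B$ over $\mathbb{Q}$ with $A,B\in\mathbb{Z}$, $4A^3+27B^2\neq0$, and no prime $p$ with $p^4\mid A$ and $p^6\mid B$ (one curve per $\mathbb{Q}$-isomorphism class). The height is $\mathrm{ht}(E)=\max(|4A^3|,|27B^2|)$, and $\mathcal{E}_{\le H}=\{E\in\mathcal{E}:\mathrm{ht}(E)\le H\}$. For $X>0$, $\mathrm{M}_n(\mathbb{Z})_{\mathrm{alt},\le X}$ denotes the set of alternating $n\times n$ integer matrices (i.e. $A^T=-A$, zero diagonal) all of whose entries have absolute value at most $X$. Random model: for $E\in\mathcal{E}$ with $H=\mathrm{ht}(E)$, choose an integer $n$ uniformly at random from $\mathbb{Z}\cap[\eta(H),\eta(H)+2)$, then choose $A\in\mathrm{M}_n(\mathbb{Z})_{\mathrm{alt},\le X(H)}$ uniformly at random; set $\mathrm{rk}'_E=\mathrm{rk}(\ker A)$ (the rank of the kernel of $A$ as a $\mathbb{Z}$-module) and $\mathrm{Sha}'_E=(\operatorname{coker}A)_{\mathrm{tors}}$ with its canonical nondegenerate alternating pairing; the choices for different $E$ are independent. An $o(1)$ in a statement with $H\to\infty$ means there is a function tending to $0$ as $H\to\infty$ making the statement true when substituted. *)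

theory Defs
  imports
    "HOL-Probability.Probability"
    "HOL-Computational_Algebra.Primes"
    "Jordan_Normal_Form.Matrix_Kernel"
begin

text \<open>The curve \<open>y\<^sup>2 = x\<^sup>3 + A x + B\<close> is represented by the pair \<open>(A, B)\<close>.\<close>

definition elliptic_curves :: "(int \<times> int) set" where
  "elliptic_curves =
     {(A, B). 4 * A ^ 3 + 27 * B ^ 2 \<noteq> 0 \<and> \<not> (\<exists>p. prime p \<and> p ^ 4 dvd A \<and> p ^ 6 dvd B)}"

definition height :: "int \<times> int \<Rightarrow> real" where
  "height E = (case E of (A, B) \<Rightarrow> real_of_int (max \<bar>4 * A ^ 3\<bar> \<bar>27 * B ^ 2\<bar>))"

definition curves_upto :: "real \<Rightarrow> (int \<times> int) set" where
  "curves_upto H = {E \<in> elliptic_curves. height E \<le> H}"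

definition alt_matrices :: "nat \<Rightarrow> real \<Rightarrow> int mat set" where
  "alt_matrices n X =
     {A \<in> carrier_mat n n. transpose_mat A = - A \<and> (\<forall>i<n. A $$ (i, i) = 0) \<and>
        (\<forall>i<n. \<forall>j<n. \<bar>real_of_int (A $$ (i, j))\<bar> \<le> X)}"

text \<open>
  The law of the random matrix attached to a curve of height \<open>H\<close>. For \<open>\<eta> H \<ge> 0\<close> the
  admissible \<open>n\<close> are exactly the integers in \<open>[\<eta> H, \<eta> H + 2)\<close>. For \<open>X H < 0\<close> or
  \<open>\<eta> H \<le> -2\<close> there may be nothing to choose from, and \<open>pmf_of_set {}\<close> is an unspecified
  distribution; if \<open>\<eta>\<close> and \<open>X\<close> tend to infinity, such \<open>H\<close> concern only finitely many curves.
\<close>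

definition matrix_pmf :: "(real \<Rightarrow> real) \<Rightarrow> (real \<Rightarrow> real) \<Rightarrow> real \<Rightarrow> int mat pmf" where
  "matrix_pmf \<eta> X H =
     bind_pmf (pmf_of_set {n :: nat. \<eta> H \<le> real n \<and> real n < \<eta> H + 2})
       (\<lambda>n. pmf_of_set (alt_matrices n (X H)))"

text \<open>
  Sample space: families \<open>\<omega>\<close> assigning to each curve \<open>E\<close> a matrix \<open>\<omega> E\<close>, chosen
  independently according to the law above.
\<close>

definition random_model ::
    "(real \<Rightarrow> real) \<Rightarrow> (real \<Rightarrow> real) \<Rightarrow> (int \<times> int \<Rightarrow> int mat) measure" where
  "random_model \<eta> X = (\<Pi>\<^sub>M E\<in>elliptic_curves. measure_pmf (matrix_pmf \<eta> X (height E)))"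

text \<open>
  Rank of a submodule of \<open>\<int>\<^sup>n\<close>: the maximal number of \<open>\<int>\<close>-linearly independent
  elements.
\<close>

definition int_module_rank :: "nat \<Rightarrow> int vec set \<Rightarrow> nat" where
  "int_module_rank n K =
     Max {card S |S. finite S \<and> S \<subseteq> K \<and>
                     \<not> LinearCombinations.module.lin_dep class_ring (module_vec TYPE(int) n) S}"

definition rk' :: "(int \<times> int \<Rightarrow> int mat) \<Rightarrow> int \<times> int \<Rightarrow> nat" where
  "rk' \<omega> E = int_module_rank (dim_col (\<omega> E)) (mat_kernel (\<omega> E))"

text \<open>\<open>f(H) = H\<^bsup>c + o(1)\<^esup>\<close> and \<open>f(H) \<le> H\<^bsup>c + o(1)\<^esup>\<close> as \<open>H \<rightarrow> \<infinity>\<close>.\<close>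

definition eq_pow_o1 :: "(real \<Rightarrow> real) \<Rightarrow> real \<Rightarrow> bool" where
  "eq_pow_o1 f c \<longleftrightarrow>
     (\<exists>\<epsilon>. (\<epsilon> \<longlongrightarrow> 0) at_top \<and> (\<forall>\<^sub>F H in at_top. f H = H powr (c + \<epsilon> H)))"

definition le_pow_o1 :: "(real \<Rightarrow> real) \<Rightarrow> real \<Rightarrow> bool" where
  "le_pow_o1 f c \<longleftrightarrow>
     (\<exists>\<epsilon>. (\<epsilon> \<longlongrightarrow> 0) at_top \<and> (\<forall>\<^sub>F H in at_top. f H \<le> H powr (c + \<epsilon> H)))"

end

theory Submission
  imports Defs "HOL-Real_Asymp.Real_Asymp"
begin

text \<open>
  An alternating integer matrix \<open>A\<close> of size \<open>n\<close> and rank \<open>k\<close> with entries bounded by \<open>X\<close> can be written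
  as \<open>w c w\<^sup>T\<close>, where the columns of \<open>w\<close> form a reduced basis, of lengths \<open>W\<^sub>1 \<le> \<dots> \<le> W\<^sub>k\<close>, of the
  saturation of the column lattice, and \<open>c\<close> is a nonsingular alternating integer matrix whose \<open>(i, j)\<close>
  entry is \<open>O(X / (W\<^sub>i W\<^sub>j))\<close>. There are \<open>O(\<Prod>\<^sub>j W\<^sub>j\<^sup>n \<Prod>\<^sub>i\<^sub><\<^sub>j W\<^sub>i / W\<^sub>j)\<close> such lattices, because the
  unipotent changes of basis produce many bases of the same kind for each of them; nonsingularity of
  \<open>c\<close> forces \<open>W\<^sub>i W\<^sub>k\<^sub>+\<^sub>1\<^sub>-\<^sub>i = O(X)\<close>, and under this constraint the total count is largest for
  \<open>W\<^sub>i = X\<^bsup>1/2\<^esup>\<close>. So, up to logarithms, there are at most \<open>O(X\<^bsup>nk/2\<^esup>)\<close> matrices of rank \<open>k\<close>.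

  Conversely, let \<open>P\<close> be a well conditioned alternating matrix of even size \<open>k\<close>. Bordering \<open>P\<close> by \<open>r\<close>
  columns \<open>q\<^sub>l\<close> on which the form \<open>P\<^sup>-\<^sup>1\<close> is integral gives a matrix of size \<open>k + r\<close> and rank \<open>k\<close>. The
  column \<open>q\<^sub>1\<close> is arbitrary, and the others range over a maximal isotropic lattice containing it. By
  duality of finite abelian groups this lattice has index at most \<open>O(X\<^bsup>k/2\<^esup>)\<close>, hence by the pigeonhole
  principle it has at least a constant times \<open>X\<^bsup>k/2\<^esup>\<close> points in a box of side about \<open>X\<close>. This
  matches the upper bound.

  Hence corank at least \<open>r\<close> has probability \<open>X\<^bsup>-n(r-1)/2 + O(1)\<^esup> = H\<^bsup>-(r-1)/24 + o(1)\<^esup>\<close>, provided that \<open>\<eta>\<close>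
  grows so slowly that the constants depending on \<open>n\<close> are negligible. As there are about \<open>H\<^bsup>5/6\<^esup>\<close>
  curves of height at most \<open>H\<close>, the assertions follow from the Borel--Cantelli lemma along \<open>H = 2\<^sup>j\<close>,
  using Markov's inequality for the upper bounds and an exponential moment for the lower ones.
\<close>

text \<open>The number 21 comes from 5/6 - (r - 1)/24 = (21 - r)/24. Two features of the model shape
  the estimates. Alternating matrices have even rank, so a lower bound for corank \<open>r\<close>
  is available only for sizes of the parity of \<open>r\<close>; the interval of length 2 always
  offers one. And since \<eta> tends to infinity, X^\<eta> = H^(1/12 + o(1)) makes X itself H^o(1):
  any fixed power of X may be lost, hence also the logarithms and the bounded shift between
  \<open>n\<close> and \<eta>, but no power of X proportional to \<open>n\<close>. This is why the
  upper bound needs the exact optimum over all shapes of lattices. Saturating the column lattice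
  makes \<open>c\<close> integral, and integrality is what turns nonsingularity of \<open>c\<close>
  into a constraint on the lengths. In the lower bound, the rank condition determines the last block
  of the bordered matrix as minus the values of the form on the columns; that \<open>P\<close> is
  well conditioned keeps this block within the bound X. How the constants depend on \<open>n\<close>
  is never tracked: they are finite for each \<open>n\<close>, and \<eta> is slowed down until they
  are absorbed.\<close>

section \<open>Homogeneous linear systems over an integral domain\<close>

text \<open>Elimination by cross-multiplication, without division, so that integer systems have
  integer solutions. With the right-hand side appended as one more column it solves inhomogeneous
  systems up to a common denominator, which replaces determinants throughout.\<close>

lemma homogeneous_system_nontrivial_solution:
  fixes a :: "'i \<Rightarrow> 'j \<Rightarrow> 'a::idom"
  assumes "finite I" "finite J" "card I < card J"
  shows "\<exists>x. (\<exists>j\<in>J. x j \<noteq> 0) \<and> (\<forall>i\<in>I. (\<Sum>j\<in>J. a i j * x j) = 0)"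
  using assms
proof (induction I arbitrary: a J rule: finite_induct)
  case empty
  then have "J \<noteq> {}" by auto
  then show ?case by (intro exI[of _ "\<lambda>_. 1"]) auto
next
  case (insert p I)
  show ?case
  proof (cases "\<forall>j\<in>J. a p j = 0")
    case True
    obtain x where "\<exists>j\<in>J. x j \<noteq> 0" "\<forall>i\<in>I. (\<Sum>j\<in>J. a i j * x j) = 0"
      using insert.IH[of J a] insert.prems insert.hyps by auto
    then show ?thesis using True by (intro exI[of _ x]) auto
  next
    case False
    then obtain q where q: "q \<in> J" "a p q \<noteq> 0" by auto
    define J' where "J' = J - {q}"
    have fin: "finite J'" and J: "J = insert q J'" "q \<notin> J'"
      using q insert.prems by (auto simp: J'_def)
    have "card I < card J'" using insert.prems insert.hyps J fin by auto
    then obtain x where x: "\<exists>j\<in>J'. x j \<noteq> 0"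
      and sol: "\<forall>i\<in>I. (\<Sum>j\<in>J'. (a p q * a i j - a i q * a p j) * x j) = 0"
      using insert.IH[of J' "\<lambda>i j. a p q * a i j - a i q * a p j"] fin by auto
    \<comment> \<open>The other unknowns are scaled by the pivot \<open>a p q\<close>, so that
      solving equation \<open>p\<close> for the unknown \<open>q\<close> needs no division.\<close>
    define y where "y j = (if j = q then - (\<Sum>j\<in>J'. a p j * x j) else a p q * x j)" for j
    have split: "(\<Sum>j\<in>J. c j * y j) =
        a p q * (\<Sum>j\<in>J'. c j * x j) - c q * (\<Sum>j\<in>J'. a p j * x j)" for c
    proof -
      have "(\<Sum>j\<in>J. c j * y j) = c q * y q + (\<Sum>j\<in>J'. c j * y j)"
        using J fin by simp
      also have "(\<Sum>j\<in>J'. c j * y j) = (\<Sum>j\<in>J'. a p q * (c j * x j))"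
        using J by (intro sum.cong) (auto simp: y_def)
      finally show ?thesis by (simp add: y_def sum_distrib_left)
    qed
    have "\<exists>j\<in>J. y j \<noteq> 0" using x q J by (auto simp: y_def)
    moreover have "(\<Sum>j\<in>J. a p j * y j) = 0" unfolding split by simp
    moreover have "(\<Sum>j\<in>J. a i j * y j) = 0" if "i \<in> I" for i
      unfolding split using sol that
      by (simp add: algebra_simps sum_subtractf sum_distrib_left)
    ultimately show ?thesis by (intro exI[of _ y]) auto
  qed
qed

subsection \<open>Reduced lattice bases\<close>

definition nrm :: "nat \<Rightarrow> (nat \<Rightarrow> real) \<Rightarrow> real" where
  "nrm n x = L2_set x {..<n}"

definition dot :: "nat \<Rightarrow> (nat \<Rightarrow> real) \<Rightarrow> (nat \<Rightarrow> real) \<Rightarrow> real" where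
  "dot n x y = (\<Sum>i<n. x i * y i)"

lemma nrm_nonneg [simp]: "0 \<le> nrm n x"
  by (simp add: nrm_def)

lemma nrm_power2: "(nrm n x)\<^sup>2 = dot n x x"
  by (simp add: nrm_def L2_set_def dot_def sum_nonneg power2_eq_square)

lemma nrm_triangle: "nrm n (\<lambda>i. x i + y i) \<le> nrm n x + nrm n y"
  unfolding nrm_def by (rule L2_set_triangle_ineq)

lemma nrm_scale: "nrm n (\<lambda>i. c * x i) = \<bar>c\<bar> * nrm n x"
proof -
  have "(nrm n (\<lambda>i. c * x i))\<^sup>2 = (\<bar>c\<bar> * nrm n x)\<^sup>2"
    unfolding power_mult_distrib nrm_power2
    by (simp add: dot_def sum_distrib_left power2_eq_square algebra_simps)
  then show ?thesis by (smt (verit) nrm_nonneg power2_eq_imp_eq zero_le_mult_iff)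
qed

lemma nrm_diff: "nrm n (\<lambda>i. x i - y i) \<le> nrm n x + nrm n y"
  using nrm_triangle[of n x "\<lambda>i. -1 * y i"] nrm_scale[of n "-1" y] by simp

lemma nrm_zero [simp]: "nrm n (\<lambda>i. 0) = 0"
  by (simp add: nrm_def L2_set_def)

lemma nrm_eq_0: "nrm n x = 0 \<longleftrightarrow> (\<forall>i<n. x i = 0)"
  by (auto simp: nrm_def L2_set_eq_0_iff)

lemma nrm_sum: "nrm n (\<lambda>i. \<Sum>j\<in>J. f j i) \<le> (\<Sum>j\<in>J. nrm n (f j))"
proof (induction J rule: infinite_finite_induct)
  case (insert j J)
  then show ?case using nrm_triangle[of n "f j" "\<lambda>i. \<Sum>j\<in>J. f j i"] by simp
qed simp_all

lemma nrm_le_sup: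
  assumes "\<And>i. i < n \<Longrightarrow> \<bar>x i\<bar> \<le> B"
  shows "nrm n x \<le> real n * B"
proof -
  have "nrm n x \<le> (\<Sum>i<n. \<bar>x i\<bar>)" unfolding nrm_def by (rule L2_set_le_sum_abs)
  also have "\<dots> \<le> (\<Sum>i<n. B)" using assms by (intro sum_mono) auto
  finally show ?thesis by simp
qed

lemma component_le_nrm: "i < n \<Longrightarrow> \<bar>x i\<bar> \<le> nrm n x"
  using member_le_L2_set[of "{..<n}" i "\<lambda>i. \<bar>x i\<bar>"] by (simp add: nrm_def L2_set_def)

text \<open>The last clause is discreteness. Vectors are functions on all naturals that vanish from
  \<open>n\<close> on, so that equality of functions is equality of vectors.\<close>

definition lattice_in :: "nat \<Rightarrow> (nat \<Rightarrow> real) set \<Rightarrow> bool" where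
  "lattice_in n L \<longleftrightarrow> (\<forall>x\<in>L. \<forall>i\<ge>n. x i = 0) \<and> (\<lambda>i. 0) \<in> L \<and>
     (\<forall>x\<in>L. \<forall>y\<in>L. (\<lambda>i. x i - y i) \<in> L) \<and> (\<forall>R. finite {x \<in> L. nrm n x \<le> R})"

text \<open>Stated over an arbitrary ring because it serves real lattices as well as integer
  ones.\<close>

lemma group_combination:
  fixes L :: "(nat \<Rightarrow> 'a::ring_1) set"
  assumes 0: "(\<lambda>i. 0) \<in> L" and d: "\<And>x y. x \<in> L \<Longrightarrow> y \<in> L \<Longrightarrow> (\<lambda>i. x i - y i) \<in> L"
  shows group_add_closed: "x \<in> L \<Longrightarrow> y \<in> L \<Longrightarrow> (\<lambda>i. x i + y i) \<in> L"
    and group_mult_closed: "x \<in> L \<Longrightarrow> (\<lambda>i. of_int m * x i) \<in> L"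
    and group_sum_closed: "(\<And>j. j \<in> J \<Longrightarrow> b j \<in> L) \<Longrightarrow> (\<lambda>i. \<Sum>j\<in>J. of_int (c j) * b j i) \<in> L"
proof -
  have neg: "(\<lambda>i. - x i) \<in> L" if "x \<in> L" for x using d[OF 0 that] by simp
  have add: "(\<lambda>i. x i + y i) \<in> L" if "x \<in> L" "y \<in> L" for x y
    using d[OF that(1) neg[OF that(2)]] by simp
  then show "x \<in> L \<Longrightarrow> y \<in> L \<Longrightarrow> (\<lambda>i. x i + y i) \<in> L" .
  have nat: "(\<lambda>i. of_nat k * x i) \<in> L" if "x \<in> L" for k x
  proof (induction k)
    case (Suc k)
    then show ?case using add[OF that Suc] by (simp add: algebra_simps)
  qed (use 0 in simp)
  have mult: "(\<lambda>i. of_int m * x i) \<in> L" if "x \<in> L" for m x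
  proof (cases "m \<ge> 0")
    case True
    then show ?thesis using nat[OF that, of "nat m"] by simp
  next
    case False
    then show ?thesis using neg[OF nat[OF that, of "nat (- m)"]] by simp
  qed
  then show "x \<in> L \<Longrightarrow> (\<lambda>i. of_int m * x i) \<in> L" .
  show "(\<And>j. j \<in> J \<Longrightarrow> b j \<in> L) \<Longrightarrow> (\<lambda>i. \<Sum>j\<in>J. of_int (c j) * b j i) \<in> L"
  proof (induction J rule: infinite_finite_induct)
    case (insert j J)
    then show ?case using add[OF mult[of "b j" "c j"], of "\<lambda>i. \<Sum>j\<in>J. of_int (c j) * b j i"] by simp
  qed (use 0 in simp_all)
qed

text \<open>The component orthogonal to \<open>b\<close>. If \<open>b\<close> is zero on the first
  \<open>n\<close> coordinates, division by zero makes this the identity, which still does not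
  increase norms.\<close>

definition proj :: "nat \<Rightarrow> (nat \<Rightarrow> real) \<Rightarrow> (nat \<Rightarrow> real) \<Rightarrow> (nat \<Rightarrow> real)" where
  "proj n b x = (\<lambda>i. x i - dot n x b / dot n b b * b i)"

lemma dot_diff_left: "dot n (\<lambda>i. x i - y i) b = dot n x b - dot n y b"
  and dot_mult_left: "dot n (\<lambda>i. c * x i) b = c * dot n x b"
  by (simp_all add: dot_def algebra_simps sum_subtractf sum_distrib_left)

lemma dot_sum_left: "dot n (\<lambda>i. \<Sum>j\<in>J. c j * f j i) b = (\<Sum>j\<in>J. c j * dot n (f j) b)"
proof -
  have "dot n (\<lambda>i. \<Sum>j\<in>J. c j * f j i) b = (\<Sum>i<n. \<Sum>j\<in>J. c j * (f j i * b i))"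
    by (simp add: dot_def sum_distrib_right mult.assoc)
  also have "\<dots> = (\<Sum>j\<in>J. \<Sum>i<n. c j * (f j i * b i))" by (rule sum.swap)
  finally show ?thesis by (simp add: dot_def sum_distrib_left)
qed

lemma proj_diff: "proj n b (\<lambda>i. x i - y i) = (\<lambda>i. proj n b x i - proj n b y i)"
  by (simp add: proj_def dot_diff_left algebra_simps diff_divide_distrib)

lemma proj_sum: "proj n b (\<lambda>i. \<Sum>j\<in>J. c j * f j i) = (\<lambda>i. \<Sum>j\<in>J. c j * proj n b (f j) i)"
  by (simp add: proj_def dot_sum_left algebra_simps sum_subtractf sum_distrib_left
      sum_divide_distrib)

lemma proj_zero: "proj n b (\<lambda>i. 0) = (\<lambda>i. 0)"
  by (simp add: proj_def dot_def)

lemma nrm_proj_le: "nrm n (proj n b x) \<le> nrm n x"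
proof (cases "dot n b b = 0")
  case False
  define t where "t = dot n x b / dot n b b"
  have pos: "dot n b b > 0" using False nrm_power2[of n b] by (smt (verit) zero_le_power2)
  have "dot n (proj n b x) (proj n b x) = dot n x x - 2 * t * dot n x b + t * t * dot n b b"
    unfolding proj_def t_def[symmetric]
    by (simp add: dot_def algebra_simps sum.distrib sum_subtractf sum_distrib_left)
  also have "\<dots> = dot n x x - (dot n x b)\<^sup>2 / dot n b b"
    using pos by (simp add: t_def field_simps power2_eq_square)
  also have "\<dots> \<le> dot n x x" using pos by simp
  finally show ?thesis using nrm_power2 by (metis nrm_nonneg power2_le_imp_le)
qed (simp add: proj_def)

lemma proj_self_shift:
  assumes "dot n b b \<noteq> 0"
  shows "proj n b (\<lambda>i. x i - t * b i) = proj n b x"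
  using assms by (simp add: proj_def dot_diff_left dot_mult_left field_simps fun_eq_iff)

text \<open>Subtracting the nearest integer multiple of \<open>b\<close> leaves a component along
  \<open>b\<close> of at most half its length. Both the discreteness of the projected lattice and
  the lower bound for its vectors come from this size reduction.\<close>

lemma lattice_short_lift:
  assumes L: "lattice_in n L" and "b \<in> L" "dot n b b \<noteq> 0" "x \<in> L"
  shows "\<exists>y\<in>L. proj n b y = proj n b x \<and> nrm n y \<le> nrm n (proj n b x) + nrm n b / 2"
proof -
  define t where "t = dot n x b / dot n b b"
  define y where "y = (\<lambda>i. x i - of_int (round t) * b i)"
  have "(\<lambda>i. of_int (round t) * b i) \<in> L"
    using L \<open>b \<in> L\<close> by (intro group_mult_closed) (auto simp: lattice_in_def)
  then have "y \<in> L" using L \<open>x \<in> L\<close> by (auto simp: lattice_in_def y_def)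
  moreover have "proj n b y = proj n b x"
    unfolding y_def by (rule proj_self_shift) fact
  moreover have "nrm n y \<le> nrm n (proj n b x) + nrm n b / 2"
  proof -
    have "y = (\<lambda>i. proj n b x i + (t - of_int (round t)) * b i)"
      by (simp add: y_def proj_def t_def algebra_simps)
    then have "nrm n y \<le> nrm n (proj n b x) + \<bar>t - of_int (round t)\<bar> * nrm n b"
      using nrm_triangle[of n "proj n b x" "\<lambda>i. (t - of_int (round t)) * b i"] nrm_scale by simp
    moreover have "\<bar>t - of_int (round t)\<bar> \<le> 1 / 2"
      using of_int_round_abs_le[of t] by (simp add: abs_minus_commute)
    ultimately show ?thesis
      using mult_right_mono[of "\<bar>t - of_int (round t)\<bar>" "1/2" "nrm n b"] by simp
  qed
  ultimately show ?thesis by blast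
qed

text \<open>\<open>W\<close> stands for the lengths of the basis vectors. The second clause bounds
  the coordinates of a vector by its norm; in effect the dual basis vectors have length O(1 /
  \<open>W i\<close>), which expresses that the basis is nearly orthogonal.\<close>

definition reduced_family ::
    "nat \<Rightarrow> nat \<Rightarrow> real \<Rightarrow> (nat \<Rightarrow> nat \<Rightarrow> real) \<Rightarrow> (nat \<Rightarrow> real) \<Rightarrow> bool" where
  "reduced_family n k C b W \<longleftrightarrow>
     (\<forall>j<k. nrm n (b j) \<le> C * W j) \<and>
     (\<forall>c::nat \<Rightarrow> int. \<forall>i<k. \<bar>of_int (c i)\<bar> * W i \<le> C * nrm n (\<lambda>l. \<Sum>j<k. of_int (c j) * b j l)) \<and>
     (\<forall>i j. i \<le> j \<longrightarrow> j < k \<longrightarrow> W i \<le> W j)"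

lemma lattice_shortest_vector:
  assumes L: "lattice_in n L" and ne: "L \<noteq> {\<lambda>i. 0}"
  obtains b where "b \<in> L" "nrm n b > 0" "\<And>x. x \<in> L \<Longrightarrow> x \<noteq> (\<lambda>i. 0) \<Longrightarrow> nrm n b \<le> nrm n x"
proof -
  obtain z where z: "z \<in> L" "z \<noteq> (\<lambda>i. 0)" using L ne by (auto simp: lattice_in_def)
  define S where "S = {x \<in> L. nrm n x \<le> nrm n z} - {\<lambda>i. 0}"
  have "finite S" "S \<noteq> {}" using L z by (auto simp: lattice_in_def S_def)
  then obtain b where b: "b \<in> S" "\<And>x. x \<in> S \<Longrightarrow> nrm n b \<le> nrm n x"
    by (metis arg_min_if_finite(1) arg_min_least)
  have "nrm n b \<le> nrm n x" if "x \<in> L" "x \<noteq> (\<lambda>i. 0)" for x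
  proof (cases "nrm n x \<le> nrm n z")
    case True
    then show ?thesis using b that by (auto simp: S_def)
  next
    case False
    then show ?thesis using b(1) by (auto simp: S_def)
  qed
  moreover have "nrm n b \<noteq> 0"
  proof
    assume "nrm n b = 0"
    then have "\<forall>i<n. b i = 0" by (simp add: nrm_eq_0)
    moreover have "b \<in> L" using b by (auto simp: S_def)
    then have "\<forall>i\<ge>n. b i = 0" using L by (auto simp: lattice_in_def)
    ultimately have "b = (\<lambda>i. 0)" by (metis linorder_not_le)
    then show False using b by (auto simp: S_def)
  qed
  ultimately show thesis using that[of b] b(1) nrm_nonneg[of n b] by (auto simp: S_def less_le)
qed

text \<open>The projection stays discrete because the direction that is projected out contains a
  nonzero lattice vector: every projected vector has a lift that is not much longer.\<close>

lemma lattice_in_proj: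
  assumes L: "lattice_in n L" and b: "b \<in> L" "nrm n b > 0"
  shows "lattice_in n (proj n b ` L)"
  unfolding lattice_in_def
proof (intro conjI ballI allI impI)
  fix x i assume "x \<in> proj n b ` L" "n \<le> i"
  then obtain y where "y \<in> L" "x = proj n b y" by auto
  moreover have "y i = 0" "b i = 0"
    using L b \<open>y \<in> L\<close> \<open>n \<le> i\<close> by (auto simp: lattice_in_def)
  ultimately show "x i = 0" by (simp add: proj_def)
next
  show "(\<lambda>i. 0) \<in> proj n b ` L"
    using L proj_zero[of n b] by (auto simp: lattice_in_def intro!: image_eqI[where x="\<lambda>i. 0"])
next
  fix x y assume "x \<in> proj n b ` L" "y \<in> proj n b ` L"
  then obtain x' y' where "x' \<in> L" "y' \<in> L" "x = proj n b x'" "y = proj n b y'" by auto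
  then show "(\<lambda>i. x i - y i) \<in> proj n b ` L"
    using L proj_diff[of n b x' y'] by (auto simp: lattice_in_def intro!: image_eqI[where x="\<lambda>i. x' i - y' i"])
next
  fix R
  have db: "dot n b b \<noteq> 0" using b nrm_power2[of n b] by auto
  have "{x \<in> proj n b ` L. nrm n x \<le> R} \<subseteq> proj n b ` {x \<in> L. nrm n x \<le> R + nrm n b / 2}"
  proof safe
    fix x assume x: "x \<in> L" "nrm n (proj n b x) \<le> R"
    obtain y where "y \<in> L" "proj n b y = proj n b x" "nrm n y \<le> nrm n (proj n b x) + nrm n b / 2"
      using lattice_short_lift[OF L b(1) db x(1)] by blast
    then show "proj n b x \<in> proj n b ` {x \<in> L. nrm n x \<le> R + nrm n b / 2}"
      using x(2) by (intro image_eqI[of _ _ y]) auto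
  qed
  moreover have "finite {x \<in> L. nrm n x \<le> R + nrm n b / 2}"
    using L by (simp add: lattice_in_def)
  ultimately show "finite {x \<in> proj n b ` L. nrm n x \<le> R}"
    by (rule finite_surj[rotated])
qed

text \<open>A shortest vector is primitive: on the line of \<open>b\<close>, the remainder after
  rounding has at most half the length of \<open>b\<close> and therefore vanishes.\<close>

lemma lattice_kernel_proj:
  assumes L: "lattice_in n L" and b: "b \<in> L" "nrm n b > 0"
    and min: "\<And>x. x \<in> L \<Longrightarrow> x \<noteq> (\<lambda>i. 0) \<Longrightarrow> nrm n b \<le> nrm n x"
    and x: "x \<in> L" "proj n b x = (\<lambda>i. 0)"
  shows "\<exists>m::int. x = (\<lambda>i. of_int m * b i)"
proof -
  define t where "t = dot n x b / dot n b b"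
  have xt: "x = (\<lambda>i. t * b i)" using x(2) by (auto simp: proj_def t_def fun_eq_iff)
  define y where "y = (\<lambda>i. x i - of_int (round t) * b i)"
  have "(\<lambda>i. of_int (round t) * b i) \<in> L"
    using L b by (intro group_mult_closed) (auto simp: lattice_in_def)
  then have "y \<in> L" using L \<open>x \<in> L\<close> by (auto simp: lattice_in_def y_def)
  have "y = (\<lambda>i. (t - of_int (round t)) * b i)" by (subst y_def, subst xt) (simp add: algebra_simps)
  then have "nrm n y = \<bar>t - of_int (round t)\<bar> * nrm n b" using nrm_scale by simp
  also have "\<dots> \<le> 1 / 2 * nrm n b"
    using of_int_round_abs_le[of t] b by (intro mult_right_mono) (auto simp: abs_minus_commute)
  also have "\<dots> < nrm n b" using b by simp
  finally have "y = (\<lambda>i. 0)" using min[OF \<open>y \<in> L\<close>] by fastforce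
  then show ?thesis by (intro exI[of _ "round t"]) (auto simp: y_def fun_eq_iff)
qed

text \<open>An exchange step: \<open>b\<close> projects to zero, so its expansion becomes a linear
  relation among the projected generators, and this eliminates generator \<open>q\<close>. The
  number of spanning vectors replaces the dimension in the induction that follows.\<close>

lemma span_proj_drop:
  fixes u :: "nat \<Rightarrow> nat \<Rightarrow> real"
  assumes "finite U" "q \<in> U" "\<beta> q \<noteq> 0" and bu: "\<And>i. i < n \<Longrightarrow> b i = (\<Sum>j\<in>U. \<beta> j * u j i)"
    and xu: "\<And>i. i < n \<Longrightarrow> x i = (\<Sum>j\<in>U. a j * u j i)" and db: "dot n b b \<noteq> 0" and "i < n"
  shows "proj n b x i = (\<Sum>j\<in>U - {q}. (a j - a q * \<beta> j / \<beta> q) * proj n b (u j) i)"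
proof -
  have proj_cong: "proj n b x i = proj n b y i" if "\<And>i. i < n \<Longrightarrow> x i = y i" for x y
    using that \<open>i < n\<close> by (simp add: proj_def dot_def)
  have 1: "proj n b x i = (\<Sum>j\<in>U. a j * proj n b (u j) i)"
    using proj_cong[of x "\<lambda>i. \<Sum>j\<in>U. a j * u j i"] xu proj_sum[of n b a u U] by simp
  have "proj n b b i = (\<Sum>j\<in>U. \<beta> j * proj n b (u j) i)"
    using proj_cong[of b "\<lambda>i. \<Sum>j\<in>U. \<beta> j * u j i"] bu proj_sum[of n b \<beta> u U] by simp
  moreover have "proj n b b i = 0" using db by (simp add: proj_def)
  ultimately have 0: "(\<Sum>j\<in>U. \<beta> j * proj n b (u j) i) = 0" by simp
  have "proj n b x i = (\<Sum>j\<in>U. a j * proj n b (u j) i) - a q / \<beta> q * (\<Sum>j\<in>U. \<beta> j * proj n b (u j) i)"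
    using 0 1 by simp
  also have "\<dots> = (\<Sum>j\<in>U. (a j - a q * \<beta> j / \<beta> q) * proj n b (u j) i)"
    by (simp add: sum_distrib_left sum_subtractf algebra_simps)
  also have "\<dots> = (\<Sum>j\<in>U - {q}. (a j - a q * \<beta> j / \<beta> q) * proj n b (u j) i)"
    using assms(1-3) by (subst sum.remove[of U q]) auto
  finally show ?thesis .
qed

text \<open>Induction as in Korkine-Zolotarev reduction: a shortest vector, and short lifts of a
  reduced basis of the lattice projected along it. The lower bound \<open>m\<close> is carried along
  because the lengths must still increase after the shortest vector has been put in front.\<close>

lemma reduced_basis_exists:
  "\<exists>C\<ge>1. \<forall>L U (u :: nat \<Rightarrow> nat \<Rightarrow> real) m. lattice_in n L \<longrightarrow> finite U \<longrightarrow> card U = d \<longrightarrow>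
     (\<forall>x\<in>L. \<exists>a. \<forall>i<n. x i = (\<Sum>j\<in>U. a j * u j i)) \<longrightarrow>
     (\<forall>x\<in>L. x \<noteq> (\<lambda>i. 0) \<longrightarrow> m \<le> nrm n x) \<longrightarrow>
     (\<exists>k b W. k \<le> d \<and> (\<forall>j<k. b j \<in> L) \<and>
        (\<forall>x\<in>L. \<exists>c::nat \<Rightarrow> int. x = (\<lambda>i. \<Sum>j<k. of_int (c j) * b j i)) \<and>
        reduced_family n k C b W \<and> (\<forall>i<k. m \<le> W i))"
proof (induction d)
  case 0
  have "L = {\<lambda>i. 0}" if "lattice_in n L" "\<forall>x\<in>L. \<forall>i<n. x i = 0" for L
  proof -
    have "x = (\<lambda>i. 0)" if "x \<in> L" for x
    proof
      fix i show "x i = 0" using that \<open>lattice_in n L\<close> \<open>\<forall>x\<in>L. \<forall>i<n. x i = 0\<close>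
        by (cases "i < n") (auto simp: lattice_in_def)
    qed
    then show ?thesis using that by (auto simp: lattice_in_def)
  qed
  then show ?case
    by (intro exI[of _ 1]) (auto simp: reduced_family_def intro!: exI[of _ 0])
next
  case (Suc d)
  then obtain C where C: "C \<ge> 1" and IH: "\<And>L U (u :: nat \<Rightarrow> nat \<Rightarrow> real) m. lattice_in n L \<Longrightarrow> finite U \<Longrightarrow> card U = d \<Longrightarrow>
     (\<forall>x\<in>L. \<exists>a. \<forall>i<n. x i = (\<Sum>j\<in>U. a j * u j i)) \<Longrightarrow>
     (\<forall>x\<in>L. x \<noteq> (\<lambda>i. 0) \<longrightarrow> m \<le> nrm n x) \<Longrightarrow>
     (\<exists>k b W. k \<le> d \<and> (\<forall>j<k. b j \<in> L) \<and>
        (\<forall>x\<in>L. \<exists>c::nat \<Rightarrow> int. x = (\<lambda>i. \<Sum>j<k. of_int (c j) * b j i)) \<and>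
        reduced_family n k C b W \<and> (\<forall>i<k. m \<le> W i))" by blast
  \<comment> \<open>\<open>2 * C\<close> serves the coordinates at the lifted vectors,
    \<open>C + 1\<close> the lengths of the lifts, and the last summand the coordinate at the
    shortest vector, which is found by subtracting at most \<open>d\<close> lifted terms.\<close>
  define C' where "C' = 1 + 2 * C + real d * (2 * C * (C + 1))"
  have C': "C' \<ge> 1" "C' \<ge> 2 * C" "C' \<ge> C + 1" "C' \<ge> 1 + real d * (2 * C * (C + 1))"
    using C by (auto simp: C'_def)
  show ?case
  proof (intro exI[of _ C'] conjI allI impI)
    show "1 \<le> C'" by fact
    fix L :: "(nat \<Rightarrow> real) set" and U and u :: "nat \<Rightarrow> nat \<Rightarrow> real" and m
    assume L: "lattice_in n L" and U: "finite U" "card U = Suc d"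
      and sp: "\<forall>x\<in>L. \<exists>a. \<forall>i<n. x i = (\<Sum>j\<in>U. a j * u j i)"
      and m: "\<forall>x\<in>L. x \<noteq> (\<lambda>i. 0) \<longrightarrow> m \<le> nrm n x"
    show "\<exists>k b W. k \<le> Suc d \<and> (\<forall>j<k. b j \<in> L) \<and>
        (\<forall>x\<in>L. \<exists>c::nat \<Rightarrow> int. x = (\<lambda>i. \<Sum>j<k. of_int (c j) * b j i)) \<and>
        reduced_family n k C' b W \<and> (\<forall>i<k. m \<le> W i)"
    proof (cases "L = {\<lambda>i. 0}")
      case True
      then show ?thesis by (intro exI[of _ 0]) (auto simp: reduced_family_def)
    next
      case False
      obtain b0 where b0: "b0 \<in> L" "nrm n b0 > 0"
        and min: "\<And>x. x \<in> L \<Longrightarrow> x \<noteq> (\<lambda>i. 0) \<Longrightarrow> nrm n b0 \<le> nrm n x"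
        using lattice_shortest_vector[OF L False] by blast
      have db: "dot n b0 b0 \<noteq> 0" using b0 nrm_power2[of n b0] by auto
      define L' where "L' = proj n b0 ` L"
      have L': "lattice_in n L'" unfolding L'_def by (rule lattice_in_proj[OF L b0])
      obtain \<beta> where \<beta>: "\<And>i. i < n \<Longrightarrow> b0 i = (\<Sum>j\<in>U. \<beta> j * u j i)" using sp b0 by blast
      have "\<exists>q\<in>U. \<beta> q \<noteq> 0"
      proof (rule ccontr)
        assume "\<not> ?thesis"
        then have "nrm n b0 = 0" using \<beta> by (simp add: nrm_eq_0)
        then show False using b0 by simp
      qed
      then obtain q where q: "q \<in> U" "\<beta> q \<noteq> 0" by blast
      have sp': "\<forall>y\<in>L'. \<exists>a. \<forall>i<n. y i = (\<Sum>j\<in>U - {q}. a j * proj n b0 (u j) i)"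
      proof
        fix y assume "y \<in> L'"
        then obtain x where x: "x \<in> L" "y = proj n b0 x" by (auto simp: L'_def)
        obtain a where "\<And>i. i < n \<Longrightarrow> x i = (\<Sum>j\<in>U. a j * u j i)" using sp x by blast
        from span_proj_drop[OF U(1) q \<beta> this db]
        show "\<exists>a. \<forall>i<n. y i = (\<Sum>j\<in>U - {q}. a j * proj n b0 (u j) i)"
          unfolding x(2) by (intro exI[of _ "\<lambda>j. a j - a q * \<beta> j / \<beta> q"]) auto
      qed
      \<comment> \<open>A nonzero projected vector has a nonzero lift, which is at least as long as
        \<open>b0\<close> and exceeds the projection by at most half of that. This is the origin of
        the factor 2 in \<open>W1\<close>.\<close>
      have m': "\<forall>y\<in>L'. y \<noteq> (\<lambda>i. 0) \<longrightarrow> nrm n b0 / 2 \<le> nrm n y"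
      proof (intro ballI impI)
        fix y assume y: "y \<in> L'" "y \<noteq> (\<lambda>i. 0)"
        then obtain x where x: "x \<in> L" "y = proj n b0 x" by (auto simp: L'_def)
        obtain z where z: "z \<in> L" "proj n b0 z = y" "nrm n z \<le> nrm n y + nrm n b0 / 2"
          using lattice_short_lift[OF L b0(1) db x(1)] x(2) by auto
        have "z \<noteq> (\<lambda>i. 0)" using z(2) y(2) proj_zero by metis
        then show "nrm n b0 / 2 \<le> nrm n y" using min[OF z(1)] z(3) by linarith
      qed
      have "card (U - {q}) = d" using U q by simp
      then obtain k b W where k: "k \<le> d" and bL': "\<forall>j<k. b j \<in> L'"
        and gen: "\<forall>x\<in>L'. \<exists>c::nat \<Rightarrow> int. x = (\<lambda>i. \<Sum>j<k. of_int (c j) * b j i)"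
        and red: "reduced_family n k C b W" and Wm: "\<forall>i<k. nrm n b0 / 2 \<le> W i"
        using IH[OF L' finite_Diff[OF U(1)] _ sp' m'] by blast
      have "\<forall>j. \<exists>z. j < k \<longrightarrow> z \<in> L \<and> proj n b0 z = b j \<and> nrm n z \<le> nrm n (b j) + nrm n b0 / 2"
      proof
        fix j
        show "\<exists>z. j < k \<longrightarrow> z \<in> L \<and> proj n b0 z = b j \<and> nrm n z \<le> nrm n (b j) + nrm n b0 / 2"
        proof (cases "j < k")
          case True
          then obtain x where "x \<in> L" "b j = proj n b0 x" using bL' by (auto simp: L'_def)
          then show ?thesis using lattice_short_lift[OF L b0(1) db, of x] by auto
        qed auto
      qed
      then obtain z where z: "\<And>j. j < k \<Longrightarrow> z j \<in> L" "\<And>j. j < k \<Longrightarrow> proj n b0 (z j) = b j"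
        "\<And>j. j < k \<Longrightarrow> nrm n (z j) \<le> nrm n (b j) + nrm n b0 / 2" by metis
      define b1 where "b1 = case_nat b0 z"
      define W1 where "W1 = case_nat (nrm n b0) (\<lambda>j. 2 * W j)"
      have split: "(\<lambda>i. \<Sum>j<Suc k. of_int (c j) * b1 j i) =
          (\<lambda>i. of_int (c 0) * b0 i + (\<Sum>j<k. of_int (c (Suc j)) * z j i))" for c :: "nat \<Rightarrow> int"
        by (simp add: b1_def sum.lessThan_Suc_shift del: sum.lessThan_Suc)
      have W_pos: "W j \<ge> 0" if "j < k" for j using Wm that b0 by force
      have nz: "nrm n (z j) \<le> (C + 1) * (2 * W j)" if "j < k" for j
      proof -
        have "nrm n (z j) \<le> C * W j + W j"
          using z(3)[OF that] red that Wm by (fastforce simp: reduced_family_def)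
        also have "\<dots> \<le> (C + 1) * (2 * W j)"
          using W_pos[OF that] C by (simp add: algebra_simps)
        finally show ?thesis .
      qed
      have coef: "\<bar>of_int (c (Suc i))\<bar> * (2 * W i) \<le> 2 * C * nrm n (\<lambda>i. \<Sum>j<Suc k. of_int (c j) * b1 j i)"
        if "i < k" for c :: "nat \<Rightarrow> int" and i
      proof -
        let ?x = "\<lambda>i. \<Sum>j<Suc k. of_int (c j) * b1 j i"
        have "proj n b0 ?x = (\<lambda>i. \<Sum>j<Suc k. of_int (c j) * proj n b0 (b1 j) i)" by (rule proj_sum)
        also have "\<dots> = (\<lambda>i. \<Sum>j<k. of_int (c (Suc j)) * b j i)"
        proof
          fix i
          have "proj n b0 b0 i = 0" using db by (simp add: proj_def)
          then show "(\<Sum>j<Suc k. of_int (c j) * proj n b0 (b1 j) i) = (\<Sum>j<k. of_int (c (Suc j)) * b j i)"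
            using z(2) by (simp add: b1_def sum.lessThan_Suc_shift del: sum.lessThan_Suc)
        qed
        finally have "nrm n (\<lambda>i. \<Sum>j<k. of_int (c (Suc j)) * b j i) \<le> nrm n ?x"
          using nrm_proj_le[of n b0 ?x] by simp
        moreover have "\<bar>of_int (c (Suc i))\<bar> * W i \<le> C * nrm n (\<lambda>i. \<Sum>j<k. of_int (c (Suc j)) * b j i)"
          using red that unfolding reduced_family_def by (auto dest!: spec[of _ "\<lambda>j. c (Suc j)"])
        ultimately have "\<bar>of_int (c (Suc i))\<bar> * W i \<le> C * nrm n ?x"
          using C by (smt (verit) mult_left_mono)
        then show ?thesis by simp
      qed
      show ?thesis
      proof (intro exI[of _ "Suc k"] exI[of _ b1] exI[of _ W1] conjI allI impI ballI)
        show "Suc k \<le> Suc d" using k by simp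
        show "b1 j \<in> L" if "j < Suc k" for j
          using that b0 z(1) by (cases j) (auto simp: b1_def)
        show "m \<le> W1 i" if "i < Suc k" for i
        proof -
          have "b0 \<noteq> (\<lambda>i. 0)" using b0(2) by auto
          then have "m \<le> nrm n b0" using m b0(1) by auto
          then show ?thesis using that Wm by (cases i) (auto simp: W1_def intro: order_trans)
        qed
        fix x assume x: "x \<in> L"
        then obtain c :: "nat \<Rightarrow> int" where c: "proj n b0 x = (\<lambda>i. \<Sum>j<k. of_int (c j) * b j i)"
          using gen by (auto simp: L'_def)
        define y where "y = (\<lambda>i. \<Sum>j<k. of_int (c j) * z j i)"
        have "y \<in> L" unfolding y_def using L z(1)
          by (intro group_sum_closed) (auto simp: lattice_in_def)
        then have xy: "(\<lambda>i. x i - y i) \<in> L" using L x by (auto simp: lattice_in_def)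
        have "proj n b0 y = (\<lambda>i. \<Sum>j<k. of_int (c j) * proj n b0 (z j) i)"
          unfolding y_def by (rule proj_sum)
        also have "\<dots> = proj n b0 x" using z(2) c by simp
        finally have "proj n b0 (\<lambda>i. x i - y i) = (\<lambda>i. 0)" unfolding proj_diff by simp
        then obtain t :: int where t: "(\<lambda>i. x i - y i) = (\<lambda>i. of_int t * b0 i)"
          using lattice_kernel_proj[OF L b0 min xy] by blast
        have "x = (\<lambda>i. of_int t * b0 i + y i)" using t by (auto simp: fun_eq_iff algebra_simps)
        also have "\<dots> = (\<lambda>i. \<Sum>j<Suc k. of_int (case_nat t c j) * b1 j i)"
          unfolding split y_def by simp
        finally show "\<exists>c::nat \<Rightarrow> int. x = (\<lambda>i. \<Sum>j<Suc k. of_int (c j) * b1 j i)" by blast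
      next
        show "reduced_family n (Suc k) C' b1 W1"
          unfolding reduced_family_def
        proof (intro conjI allI impI)
          fix j assume j: "j < Suc k"
          show "nrm n (b1 j) \<le> C' * W1 j"
          proof (cases j)
            case 0
            then show ?thesis using C'(1) b0 by (simp add: b1_def W1_def)
          next
            case (Suc l)
            then have "nrm n (z l) \<le> (C + 1) * (2 * W l)" using nz j by simp
            also have "\<dots> \<le> C' * (2 * W l)" using C'(3) W_pos Suc j by (intro mult_right_mono) auto
            finally show ?thesis using Suc by (simp add: b1_def W1_def)
          qed
        next
          fix i j assume ij: "i \<le> j" "j < Suc k"
          have mono: "W i \<le> W j" if "i \<le> j" "j < k" for i j using red that by (auto simp: reduced_family_def)
          show "W1 i \<le> W1 j"
            using ij Wm mono by (cases i; cases j) (fastforce simp: W1_def)+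
        next
          fix c :: "nat \<Rightarrow> int" and i assume i: "i < Suc k"
          let ?x = "\<lambda>i. \<Sum>j<Suc k. of_int (c j) * b1 j i"
          show "\<bar>of_int (c i)\<bar> * W1 i \<le> C' * nrm n ?x"
          proof (cases i)
            case (Suc l)
            have "\<bar>of_int (c i)\<bar> * W1 i \<le> 2 * C * nrm n ?x"
              using coef[of l c] i Suc by (simp add: W1_def)
            also have "\<dots> \<le> C' * nrm n ?x" using C'(2) by (intro mult_right_mono) auto
            finally show ?thesis .
          next
            case 0
            \<comment> \<open>The projection forgets the coordinate at \<open>b0\<close>. It is
              recovered by subtracting the other terms, each of which is bounded by the norm of
              \<open>?x\<close>.\<close>
            have tm: "nrm n (\<lambda>i. of_int (c (Suc j)) * z j i) \<le> 2 * C * (C + 1) * nrm n ?x" if "j < k" for j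
            proof -
              have "nrm n (\<lambda>i. of_int (c (Suc j)) * z j i) = \<bar>of_int (c (Suc j))\<bar> * nrm n (z j)"
                by (rule nrm_scale)
              also have "\<dots> \<le> \<bar>of_int (c (Suc j))\<bar> * ((C + 1) * (2 * W j))"
                using nz[OF that] by (intro mult_left_mono) auto
              also have "\<dots> = (C + 1) * (\<bar>of_int (c (Suc j))\<bar> * (2 * W j))" by simp
              also have "\<dots> \<le> (C + 1) * (2 * C * nrm n ?x)"
                using coef[OF that, of c] C by (intro mult_left_mono) auto
              finally show ?thesis by (simp add: algebra_simps)
            qed
            have "nrm n (\<lambda>i. of_int (c 0) * b0 i) = nrm n (\<lambda>i. ?x i - (\<Sum>j<k. of_int (c (Suc j)) * z j i))"
              using split[of c] by (simp add: fun_eq_iff)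
            also have "\<dots> \<le> nrm n ?x + nrm n (\<lambda>i. \<Sum>j<k. of_int (c (Suc j)) * z j i)" by (rule nrm_diff)
            also have "nrm n (\<lambda>i. \<Sum>j<k. of_int (c (Suc j)) * z j i) \<le>
                (\<Sum>j<k. nrm n (\<lambda>i. of_int (c (Suc j)) * z j i))" by (rule nrm_sum)
            also have "\<dots> \<le> (\<Sum>j<k. 2 * C * (C + 1) * nrm n ?x)" using tm by (intro sum_mono) auto
            also have "\<dots> = real k * (2 * C * (C + 1)) * nrm n ?x" by simp
            also have "\<dots> \<le> real d * (2 * C * (C + 1)) * nrm n ?x"
              using k C by (intro mult_right_mono) auto
            finally have "nrm n (\<lambda>i. of_int (c 0) * b0 i) \<le> (1 + real d * (2 * C * (C + 1))) * nrm n ?x"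
              by (simp add: algebra_simps)
            also have "\<dots> \<le> C' * nrm n ?x" using C'(4) by (intro mult_right_mono) auto
            finally show ?thesis using 0 nrm_scale[of n "of_int (c 0)" b0] by (simp add: W1_def)
          qed
        qed
      qed
    qed
  qed
qed

subsection \<open>Encoding a singular alternating matrix by a reduced basis of its row lattice\<close>

text \<open>Indexed families instead of sets: a repeated vector counts as a dependence.\<close>

definition independent_family :: "nat \<Rightarrow> nat \<Rightarrow> (nat \<Rightarrow> nat \<Rightarrow> int) \<Rightarrow> bool" where
  "independent_family n k v \<longleftrightarrow>
     (\<forall>c. (\<forall>i<n. (\<Sum>l<k. c l * v l i) = 0) \<longrightarrow> (\<forall>l<k. c l = 0))"

text \<open>The integer version of \<open>reduced_family\<close>: lengths are rounded to powers of
  2, which leaves few possible types, and the norm is replaced by a common bound \<open>B\<close>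
  for all coordinates.\<close>

definition reduced_type :: "nat \<Rightarrow> nat \<Rightarrow> real \<Rightarrow> (nat \<Rightarrow> nat) \<Rightarrow> (nat \<Rightarrow> nat \<Rightarrow> int) \<Rightarrow> bool" where
  "reduced_type n k C e w \<longleftrightarrow>
     (\<forall>j<k. \<forall>i<n. real_of_int \<bar>w j i\<bar> \<le> C * 2 ^ e j) \<and>
     (\<forall>c i B. i < k \<longrightarrow> (\<forall>l<n. real_of_int \<bar>\<Sum>j<k. c j * w j l\<bar> \<le> B) \<longrightarrow>
        real_of_int \<bar>c i\<bar> * 2 ^ e i \<le> C * B) \<and>
     (\<forall>i j. i \<le> j \<longrightarrow> j < k \<longrightarrow> e i \<le> e j)"

text \<open>The coordinate bound applied to the zero vector.\<close>

lemma reduced_type_independent: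
  assumes "reduced_type n k C e w"
  shows "independent_family n k w"
  unfolding independent_family_def
proof (intro allI impI)
  fix c l assume c: "\<forall>i<n. (\<Sum>l<k. c l * w l i) = 0" and "l < k"
  have "\<And>c i B. i < k \<Longrightarrow> (\<forall>l<n. real_of_int \<bar>\<Sum>j<k. c j * w j l\<bar> \<le> B) \<Longrightarrow>
        real_of_int \<bar>c i\<bar> * 2 ^ e i \<le> C * B"
    using assms unfolding reduced_type_def by blast
  from this[OF \<open>l < k\<close>, of c 0] have "real_of_int \<bar>c l\<bar> * 2 ^ e l \<le> C * 0"
    using c by simp
  then have "real_of_int \<bar>c l\<bar> * 2 ^ e l \<le> 0" by simp
  moreover have "(0::real) < 2 ^ e l" by simp
  ultimately show "c l = 0" by (simp add: mult_le_0_iff not_le[symmetric])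
qed

lemma sum_squares_eq_0:
  fixes y :: "nat \<Rightarrow> int"
  assumes "(\<Sum>i<n. y i * y i) = 0" "i < n"
  shows "y i = 0"
  using assms sum_nonneg_eq_0_iff[of "{..<n}" "\<lambda>i. y i * y i"] by auto

text \<open>The Gram system is solved up to a denominator. The denominator is nonzero, as otherwise
  a combination of the family would be orthogonal to the whole family and hence to itself.\<close>

lemma independent_family_dual_vector:
  assumes ind: "independent_family n k w" and "p < k"
  shows "\<exists>y d. d \<noteq> 0 \<and> (\<forall>q<k. (\<Sum>i<n. y i * w q i) = (if q = p then d else 0))"
proof -
  \<comment> \<open>Column \<open>k\<close> carries minus the right-hand side, the unit vector at
    \<open>p\<close>; its unknown becomes the denominator.\<close>
  define G where "G q' q = (if q < k then (\<Sum>i<n. w q i * w q' i) else if q' = p then -1 else 0)" for q' q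
  obtain g where g: "\<exists>j\<in>{..k}. g j \<noteq> 0" "\<forall>i\<in>{..<k}. (\<Sum>j\<in>{..k}. G i j * g j) = 0"
    using homogeneous_system_nontrivial_solution[of "{..<k}" "{..k}" G] by auto
  define y where "y i = (\<Sum>q<k. g q * w q i)" for i
  have eq: "(\<Sum>i<n. y i * w q i) = (if q = p then g k else 0)" if "q < k" for q
  proof -
    have "(\<Sum>i<n. y i * w q i) = (\<Sum>i<n. \<Sum>j<k. w j i * w q i * g j)"
      by (simp add: y_def sum_distrib_right sum_distrib_left algebra_simps)
    also have "\<dots> = (\<Sum>j<k. \<Sum>i<n. w j i * w q i * g j)" by (rule sum.swap)
    also have "\<dots> = (\<Sum>j<k. G q j * g j)"
      by (intro sum.cong) (auto simp: G_def sum_distrib_right)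
    also have "\<dots> = (\<Sum>j\<in>{..k}. G q j * g j) - G q k * g k"
      by (simp add: lessThan_Suc_atMost[symmetric])
    also have "\<dots> = (if q = p then g k else 0)" using g(2) that by (simp add: G_def)
    finally show ?thesis .
  qed
  have "g k \<noteq> 0"
  proof
    assume 0: "g k = 0"
    have "(\<Sum>i<n. y i * y i) = (\<Sum>i<n. \<Sum>q<k. g q * (y i * w q i))"
      by (simp add: y_def[of i for i] sum_distrib_left algebra_simps)
    also have "\<dots> = (\<Sum>q<k. \<Sum>i<n. g q * (y i * w q i))" by (rule sum.swap)
    also have "\<dots> = (\<Sum>q<k. g q * (\<Sum>i<n. y i * w q i))" by (simp add: sum_distrib_left)
    also have "\<dots> = 0" using eq 0 by simp
    finally have "\<forall>i<n. y i = 0" using sum_squares_eq_0 by blast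
    then have "\<forall>q<k. g q = 0" using ind unfolding independent_family_def y_def by blast
    then show False using g(1) 0 by (metis atMost_iff le_neq_implies_less)
  qed
  then show ?thesis using eq by blast
qed

text \<open>The saturation of the lattice spanned by the columns of \<open>a\<close>.\<close>

definition column_lattice :: "nat \<Rightarrow> (nat \<Rightarrow> nat \<Rightarrow> int) \<Rightarrow> (nat \<Rightarrow> int) set" where
  "column_lattice n a =
     {x. (\<forall>i\<ge>n. x i = 0) \<and> (\<exists>d t. d \<noteq> 0 \<and> (\<forall>i<n. d * x i = (\<Sum>j<n. t j * a i j)))}"

lemma finite_bounded_int_vectors:
  "finite {x :: nat \<Rightarrow> int. (\<forall>i\<ge>n. x i = 0) \<and> (\<forall>i<n. real_of_int \<bar>x i\<bar> \<le> R)}" (is "finite ?S")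
proof -
  have "finite {f \<in> UNIV. f ` {..<n} \<subseteq> {-\<lfloor>R\<rfloor>..\<lfloor>R\<rfloor>} \<and> (\<forall>i. i \<notin> {..<n} \<longrightarrow> f i = (0::int))}"
    using finite_set_of_finite_funs[of "{..<n}" "{-\<lfloor>R\<rfloor>..\<lfloor>R\<rfloor>}" "0::int"]
    by (rule rev_finite_subset) auto
  moreover have "?S \<subseteq> {f \<in> UNIV. f ` {..<n} \<subseteq> {-\<lfloor>R\<rfloor>..\<lfloor>R\<rfloor>} \<and> (\<forall>i. i \<notin> {..<n} \<longrightarrow> f i = (0::int))}"
  proof clarsimp
    fix x :: "nat \<Rightarrow> int" and i assume "\<forall>i<n. \<bar>real_of_int (x i)\<bar> \<le> R" "i < n"
    then have "real_of_int \<bar>x i\<bar> \<le> R" by simp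
    then have "\<bar>x i\<bar> \<le> \<lfloor>R\<rfloor>" by (simp add: le_floor_iff)
    then show "- \<lfloor>R\<rfloor> \<le> x i \<and> x i \<le> \<lfloor>R\<rfloor>" by linarith
  qed
  ultimately show ?thesis by (rule finite_subset[rotated])
qed

lemma column_lattice_lattice_in:
  "lattice_in n ((\<lambda>x i. real_of_int (x i)) ` column_lattice n a)" (is "lattice_in n ?L")
  unfolding lattice_in_def
proof (intro conjI ballI allI impI)
  fix x i assume "x \<in> ?L" "n \<le> i"
  then show "x i = 0" by (auto simp: column_lattice_def)
next
  show "(\<lambda>i. 0) \<in> ?L"
    by (rule image_eqI[where x="\<lambda>i. 0"]) (auto simp: column_lattice_def intro!: exI[of _ 1] exI[of _ "\<lambda>j. 0"])
next
  fix x y assume "x \<in> ?L" "y \<in> ?L"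
  then obtain x' y' where x': "x' \<in> column_lattice n a" "y' \<in> column_lattice n a"
    and xy: "x = (\<lambda>i. real_of_int (x' i))" "y = (\<lambda>i. real_of_int (y' i))" by auto
  obtain d t where d: "d \<noteq> 0" "\<forall>i<n. d * x' i = (\<Sum>j<n. t j * a i j)"
    using x' unfolding column_lattice_def by blast
  obtain d' t' where d': "d' \<noteq> 0" "\<forall>i<n. d' * y' i = (\<Sum>j<n. t' j * a i j)"
    using x' unfolding column_lattice_def by blast
  have "(d * d') * (x' i - y' i) = (\<Sum>j<n. (d' * t j - d * t' j) * a i j)" if "i < n" for i
  proof -
    have "(d * d') * (x' i - y' i) = d' * (d * x' i) - d * (d' * y' i)" by (simp add: algebra_simps)
    also have "\<dots> = d' * (\<Sum>j<n. t j * a i j) - d * (\<Sum>j<n. t' j * a i j)"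
      using d(2) d'(2) that by simp
    also have "\<dots> = (\<Sum>j<n. (d' * t j - d * t' j) * a i j)"
      by (simp add: sum_distrib_left sum_subtractf algebra_simps)
    finally show ?thesis .
  qed
  then have "(\<lambda>i. x' i - y' i) \<in> column_lattice n a"
    using x' d(1) d'(1) unfolding column_lattice_def
    by (auto intro!: exI[of _ "d * d'"] exI[of _ "\<lambda>j. d' * t j - d * t' j"])
  then show "(\<lambda>i. x i - y i) \<in> ?L"
    unfolding xy by (intro image_eqI[where x="\<lambda>i. x' i - y' i"]) auto
next
  fix R
  have "{x \<in> ?L. nrm n x \<le> R} \<subseteq> (\<lambda>x i. real_of_int (x i)) `
      {x. (\<forall>i\<ge>n. x i = 0) \<and> (\<forall>i<n. real_of_int \<bar>x i\<bar> \<le> R)}"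
  proof safe
    fix x assume "x \<in> column_lattice n a" "nrm n (\<lambda>i. real_of_int (x i)) \<le> R"
    then show "(\<lambda>i. real_of_int (x i)) \<in> (\<lambda>x i. real_of_int (x i)) `
        {x. (\<forall>i\<ge>n. x i = 0) \<and> (\<forall>i<n. real_of_int \<bar>x i\<bar> \<le> R)}"
      using component_le_nrm[of _ n "\<lambda>i. real_of_int (x i)"]
      by (intro imageI) (fastforce simp: column_lattice_def)
  qed
  then show "finite {x \<in> ?L. nrm n x \<le> R}"
    using finite_bounded_int_vectors finite_surj by blast
qed

lemma nrm_int_ge_1:
  assumes "i < n" "x i \<noteq> (0::int)"
  shows "1 \<le> nrm n (\<lambda>i. real_of_int (x i))"
proof -
  have "1 \<le> \<bar>real_of_int (x i)\<bar>" using assms(2) by linarith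
  also have "\<dots> \<le> nrm n (\<lambda>i. real_of_int (x i))"
    using component_le_nrm[OF assms(1), of "\<lambda>i. real_of_int (x i)"] by simp
  finally show ?thesis .
qed

text \<open>Nonzero integer vectors have norm at least 1, so \<open>W\<close> is at least 1 and its
  binary logarithm can be rounded down to a natural number. The rounding costs a factor 2 and the
  passage from coordinates to norms a factor \<open>n\<close>, which explains
  \<open>C'\<close>.\<close>

lemma column_lattice_reduced_basis:
  "\<exists>C\<ge>1. \<forall>a. \<exists>k e w. (\<forall>j<k. w j \<in> column_lattice n a) \<and> reduced_type n k C e w \<and>
     (\<forall>x\<in>column_lattice n a. \<exists>c. \<forall>i<n. x i = (\<Sum>j<k. c j * w j i))"
proof -
  obtain C where C: "C \<ge> 1" and red: "\<And>L U (u :: nat \<Rightarrow> nat \<Rightarrow> real) m. lattice_in n L \<Longrightarrow> finite U \<Longrightarrow> card U = n \<Longrightarrow>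
     (\<forall>x\<in>L. \<exists>a. \<forall>i<n. x i = (\<Sum>j\<in>U. a j * u j i)) \<Longrightarrow>
     (\<forall>x\<in>L. x \<noteq> (\<lambda>i. 0) \<longrightarrow> m \<le> nrm n x) \<Longrightarrow>
     (\<exists>k b W. k \<le> n \<and> (\<forall>j<k. b j \<in> L) \<and>
        (\<forall>x\<in>L. \<exists>c::nat \<Rightarrow> int. x = (\<lambda>i. \<Sum>j<k. of_int (c j) * b j i)) \<and>
        reduced_family n k C b W \<and> (\<forall>i<k. m \<le> W i))"
    using reduced_basis_exists[of n n] by blast
  define C' where "C' = 2 * C * (real n + 1)"
  have C': "C' \<ge> 1" "C' \<ge> 2 * C" "C' \<ge> C * real n" using C unfolding C'_def
    by (auto simp: algebra_simps mult_le_cancel_left1 intro: order_trans add_increasing2)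
  show ?thesis
  proof (intro exI[of _ C'] conjI allI)
    show "C' \<ge> 1" by fact
    fix a
    let ?L = "(\<lambda>x i. real_of_int (x i)) ` column_lattice n a"
    have "\<forall>x\<in>?L. \<exists>s. \<forall>i<n. x i = (\<Sum>j\<in>{..<n}. s j * (if i = j then 1 else 0))"
    proof
      fix x assume "x \<in> ?L"
      show "\<exists>s. \<forall>i<n. x i = (\<Sum>j\<in>{..<n}. s j * (if i = j then 1 else 0))"
        by (rule exI[of _ x]) (simp add: if_distrib[of "\<lambda>t. _ * t"] cong: if_cong)
    qed
    moreover have "\<forall>x\<in>?L. x \<noteq> (\<lambda>i. 0) \<longrightarrow> 1 \<le> nrm n x"
    proof (intro ballI impI)
      fix x assume "x \<in> ?L" "x \<noteq> (\<lambda>i. 0)"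
      then obtain y where y: "y \<in> column_lattice n a" "x = (\<lambda>i. real_of_int (y i))" by auto
      then obtain i where "y i \<noteq> 0" using \<open>x \<noteq> (\<lambda>i. 0)\<close> by auto
      moreover from this have "i < n" using y(1) by (auto simp: column_lattice_def not_le[symmetric])
      ultimately show "1 \<le> nrm n x" unfolding y(2) by (intro nrm_int_ge_1)
    qed
    ultimately obtain k b W where k: "k \<le> n" and bL: "\<forall>j<k. b j \<in> ?L"
      and gen: "\<forall>x\<in>?L. \<exists>c::nat \<Rightarrow> int. x = (\<lambda>i. \<Sum>j<k. of_int (c j) * b j i)"
      and rf: "reduced_family n k C b W" and W1: "\<forall>i<k. 1 \<le> W i"
      using red[OF column_lattice_lattice_in[of n a], of "{..<n}" "\<lambda>j i. if i = j then 1 else 0" 1] by auto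
    have "\<forall>j. \<exists>x. j < k \<longrightarrow> x \<in> column_lattice n a \<and> b j = (\<lambda>i. real_of_int (x i))" using bL by blast
    then obtain w where w: "\<And>j. j < k \<Longrightarrow> w j \<in> column_lattice n a"
      "\<And>j. j < k \<Longrightarrow> b j = (\<lambda>i. real_of_int (w j i))" by metis
    define e where "e j = nat \<lfloor>log 2 (W j)\<rfloor>" for j
    have e: "2 ^ e j \<le> W j" "W j \<le> 2 * 2 ^ e j" if "j < k" for j
    proof -
      have "0 \<le> log 2 (W j)" using W1 that by (intro zero_le_log_cancel_iff[THEN iffD2]) (auto intro: less_le_trans)
      then have "real (e j) = of_int \<lfloor>log 2 (W j)\<rfloor>" by (simp add: e_def)
      then have fl: "real (e j) \<le> log 2 (W j)" "log 2 (W j) \<le> real (e j) + 1" by linarith+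
      have pos: "W j > 0" using W1 that by force
      show "2 ^ e j \<le> W j" using fl(1) pos by (simp add: le_log_iff powr_realpow)
      have "W j \<le> 2 powr (real (e j) + 1)" using fl(2) pos by (simp add: log_le_iff)
      then show "W j \<le> 2 * 2 ^ e j" by (simp add: powr_add powr_realpow)
    qed
    have comb: "nrm n (\<lambda>l. \<Sum>j<k. of_int (c j) * b j l) = nrm n (\<lambda>l. real_of_int (\<Sum>j<k. c j * w j l))"
      for c :: "nat \<Rightarrow> int"
      using w(2) by simp
    have "reduced_type n k C' e w" unfolding reduced_type_def
    proof (intro conjI allI impI)
      fix j i assume "j < k" "i < n"
      have "real_of_int \<bar>w j i\<bar> \<le> nrm n (b j)"
        using component_le_nrm[OF \<open>i < n\<close>, of "b j"] w(2)[OF \<open>j < k\<close>] by simp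
      also have "\<dots> \<le> C * W j" using rf \<open>j < k\<close> by (auto simp: reduced_family_def)
      also have "\<dots> \<le> C * (2 * 2 ^ e j)" using e(2)[OF \<open>j < k\<close>] C by (intro mult_left_mono) auto
      also have "\<dots> \<le> C' * 2 ^ e j" using C'(2) by simp
      finally show "real_of_int \<bar>w j i\<bar> \<le> C' * 2 ^ e j" .
    next
      fix c :: "nat \<Rightarrow> int" and i B assume i: "i < k" and B: "\<forall>l<n. real_of_int \<bar>\<Sum>j<k. c j * w j l\<bar> \<le> B"
      have "real_of_int \<bar>c i\<bar> * 2 ^ e i \<le> \<bar>of_int (c i)\<bar> * W i"
        using e(1)[OF i] by (simp add: mult_left_mono)
      also have "\<dots> \<le> C * nrm n (\<lambda>l. real_of_int (\<Sum>j<k. c j * w j l))"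
        unfolding comb[symmetric] using rf i unfolding reduced_family_def by blast
      also have "\<dots> \<le> C * (real n * B)"
        using B C by (intro mult_left_mono nrm_le_sup) auto
      finally have main: "real_of_int \<bar>c i\<bar> * 2 ^ e i \<le> C * real n * B" by simp
      show "real_of_int \<bar>c i\<bar> * 2 ^ e i \<le> C' * B"
      proof (cases "n = 0")
        case True
        then show ?thesis using i k by simp
      next
        case False
        then have "B \<ge> 0" using B by force
        then show ?thesis using main mult_right_mono[OF C'(3), of B] by linarith
      qed
    next
      fix i j assume "i \<le> j" "j < k"
      then have "W i \<le> W j" "W i \<ge> 1" using rf W1 by (auto simp: reduced_family_def)
      then show "e i \<le> e j" unfolding e_def by (intro nat_mono floor_mono) simp
    qed
    moreover have "\<exists>c. \<forall>i<n. x i = (\<Sum>j<k. c j * w j i)" if x: "x \<in> column_lattice n a" for x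
    proof -
      obtain c :: "nat \<Rightarrow> int" where c: "(\<lambda>i. real_of_int (x i)) = (\<lambda>i. \<Sum>j<k. of_int (c j) * b j i)"
        using bspec[OF gen imageI[OF x]] by blast
      have "real_of_int (x i) = real_of_int (\<Sum>j<k. c j * w j i)" for i
        using fun_cong[OF c, of i] w(2) by simp
      then show ?thesis using of_int_eq_iff by blast
    qed
    ultimately show "\<exists>k e w. (\<forall>j<k. w j \<in> column_lattice n a) \<and> reduced_type n k C' e w \<and>
       (\<forall>x\<in>column_lattice n a. \<exists>c. \<forall>i<n. x i = (\<Sum>j<k. c j * w j i))"
      using w(1) by blast
  qed
qed

text \<open>Each column of \<open>a\<close> is an integer combination of the \<open>w p\<close>. The
  coefficients at a fixed \<open>p\<close> form a vector which, up to a factor, is again a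
  combination of columns, because \<open>a\<close> is alternating; saturation then makes it an
  integer combination of the \<open>w q\<close>, and so \<open>c\<close> is integral.\<close>

lemma alternating_encoding:
  "\<exists>C\<ge>1. \<forall>a r v. (\<forall>i<n. \<forall>j<n. a i j = - a j i) \<longrightarrow> independent_family n r v \<longrightarrow>
     (\<forall>l<r. \<forall>i<n. (\<Sum>j<n. a i j * v l j) = 0) \<longrightarrow>
     (\<exists>k e w c. k + r \<le> n \<and> reduced_type n k C e w \<and>
        (\<forall>i<n. \<forall>l<n. a i l = (\<Sum>p<k. \<Sum>q<k. w p i * c p q * w q l)) \<and>
        (\<forall>x. (\<forall>q<k. (\<Sum>p<k. x p * c p q) = 0) \<longrightarrow> (\<forall>p<k. x p = 0)))"
proof -
  obtain C where C: "C \<ge> 1" and basis: "\<And>a. \<exists>k e w. (\<forall>j<k. w j \<in> column_lattice n a) \<and> reduced_type n k C e w \<and>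
     (\<forall>x\<in>column_lattice n a. \<exists>c. \<forall>i<n. x i = (\<Sum>j<k. c j * w j i))"
    using column_lattice_reduced_basis[of n] by blast
  show ?thesis
  proof (intro exI[of _ C] conjI allI impI)
    show "C \<ge> 1" by fact
    fix a :: "nat \<Rightarrow> nat \<Rightarrow> int" and r and v
    assume alt: "\<forall>i<n. \<forall>j<n. a i j = - a j i" and iv: "independent_family n r v"
      and ker: "\<forall>l<r. \<forall>i<n. (\<Sum>j<n. a i j * v l j) = 0"
    obtain k e w where wL: "\<forall>j<k. w j \<in> column_lattice n a" and red: "reduced_type n k C e w"
      and gen: "\<forall>x\<in>column_lattice n a. \<exists>c. \<forall>i<n. x i = (\<Sum>j<k. c j * w j i)" using basis[of a] by blast
    have iw: "independent_family n k w" by (rule reduced_type_independent[OF red])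
    have "\<exists>z. \<forall>i<n. a i l = (\<Sum>p<k. z p * w p i)" if "l < n" for l
    proof -
      define x where "x i = (if i < n then a i l else 0)" for i
      have "(\<Sum>j<n. (if j = l then 1 else 0) * a i j) = a i l" for i
        using that by (simp add: if_distrib[of "\<lambda>t. t * _"] cong: if_cong)
      then have "x \<in> column_lattice n a" unfolding column_lattice_def x_def
        by (auto intro!: exI[of _ 1] exI[of _ "\<lambda>j. if j = l then 1 else 0"])
      then obtain z where "\<forall>i<n. x i = (\<Sum>p<k. z p * w p i)" using gen by blast
      then show ?thesis by (intro exI[of _ z]) (auto simp: x_def)
    qed
    then obtain z where z: "\<And>i l. i < n \<Longrightarrow> l < n \<Longrightarrow> a i l = (\<Sum>p<k. z l p * w p i)" by metis
    have "\<exists>c. \<forall>l<n. z l p = (\<Sum>q<k. c q * w q l)" if p: "p < k" for p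
    proof -
      obtain y d where d: "d \<noteq> 0" and y: "\<forall>q<k. (\<Sum>i<n. y i * w q i) = (if q = p then d else 0)"
        using independent_family_dual_vector[OF iw p] by blast
      define x where "x l = (if l < n then z l p else 0)" for l
      \<comment> \<open>Pairing the dual vector \<open>y\<close> with column \<open>l\<close> picks
        out the coefficient at \<open>p\<close>; as \<open>a\<close> is alternating, this value is
        also entry \<open>l\<close> of a combination of columns.\<close>
      have "d * z l p = (\<Sum>j<n. (- y j) * a l j)" if "l < n" for l
      proof -
        have "(\<Sum>j<n. (- y j) * a l j) = (\<Sum>j<n. y j * a j l)"
        proof (rule sum.cong)
          fix j assume "j \<in> {..<n}"
          then have "a l j = - a j l" using alt that by blast
          then show "- y j * a l j = y j * a j l" by simp
        qed simp
        also have "\<dots> = (\<Sum>j<n. \<Sum>q<k. z l q * (y j * w q j))"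
          using z that by (intro sum.cong) (auto simp: sum_distrib_left algebra_simps)
        also have "\<dots> = (\<Sum>q<k. \<Sum>j<n. z l q * (y j * w q j))" by (rule sum.swap)
        also have "\<dots> = (\<Sum>q<k. z l q * (\<Sum>j<n. y j * w q j))" by (simp add: sum_distrib_left)
        also have "\<dots> = (\<Sum>q<k. if q = p then z l q * d else 0)" using y by (intro sum.cong) auto
        also have "\<dots> = d * z l p" using p by simp
        finally show ?thesis by simp
      qed
      then have "x \<in> column_lattice n a" unfolding column_lattice_def x_def
        using d by (auto intro!: exI[of _ d] exI[of _ "\<lambda>j. - y j"])
      then obtain c where "\<forall>i<n. x i = (\<Sum>q<k. c q * w q i)" using gen by blast
      then show ?thesis by (intro exI[of _ c]) (auto simp: x_def)
    qed
    then have "\<forall>p. \<exists>c. p < k \<longrightarrow> (\<forall>l<n. z l p = (\<Sum>q<k. c q * w q l))" by blast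
    then obtain c where c: "\<And>p l. p < k \<Longrightarrow> l < n \<Longrightarrow> z l p = (\<Sum>q<k. c p q * w q l)" by metis
    have ac: "a i l = (\<Sum>p<k. \<Sum>q<k. w p i * c p q * w q l)" if "i < n" "l < n" for i l
      using z[OF that] c that by (simp add: sum_distrib_left sum_distrib_right algebra_simps)
    have cols: "\<exists>d t. d \<noteq> 0 \<and> (\<forall>i<n. d * w j i = (\<Sum>l<n. t l * a i l))" if "j < k" for j
      using wL that unfolding column_lattice_def by blast
    \<comment> \<open>A multiple of \<open>w j\<close> is a combination of columns. This yields
      \<open>s\<close> for which \<open>c\<close> times \<open>s\<close> is \<open>d\<close> times
      the unit vector at \<open>j\<close>, so a left null vector of \<open>c\<close> vanishes at
      \<open>j\<close>.\<close>
    have nondeg: "x j = 0" if x: "\<forall>q<k. (\<Sum>p<k. x p * c p q) = 0" and j: "j < k" for x j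
    proof -
      obtain d t where d: "d \<noteq> 0" and t: "\<forall>i<n. d * w j i = (\<Sum>l<n. t l * a i l)" using cols[OF j] by blast
      define s where "s q = (\<Sum>l<n. t l * w q l)" for q
      have "(\<Sum>p<k. ((\<Sum>q<k. c p q * s q) - (if p = j then d else 0)) * w p i) = 0" if "i < n" for i
      proof -
        have "d * w j i = (\<Sum>l<n. \<Sum>p<k. \<Sum>q<k. w p i * c p q * (t l * w q l))"
          using t ac that by (simp add: sum_distrib_left algebra_simps)
        also have "\<dots> = (\<Sum>p<k. \<Sum>l<n. \<Sum>q<k. w p i * c p q * (t l * w q l))" by (rule sum.swap)
        also have "\<dots> = (\<Sum>p<k. \<Sum>q<k. \<Sum>l<n. w p i * c p q * (t l * w q l))"
          by (intro sum.cong refl sum.swap)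
        also have "\<dots> = (\<Sum>p<k. (\<Sum>q<k. c p q * s q) * w p i)"
          by (simp add: s_def sum_distrib_left sum_distrib_right algebra_simps)
        finally have "d * w j i = (\<Sum>p<k. (\<Sum>q<k. c p q * s q) * w p i)" .
        moreover have "(\<Sum>p<k. (if p = j then d else 0) * w p i) = d * w j i"
          using j by (simp add: if_distrib[of "\<lambda>t. t * _"] cong: if_cong)
        ultimately show ?thesis by (simp add: left_diff_distrib sum_subtractf)
      qed
      then have cs: "(\<Sum>q<k. c p q * s q) = (if p = j then d else 0)" if "p < k" for p
        using iw[unfolded independent_family_def, rule_format,
            of "\<lambda>p. (\<Sum>q<k. c p q * s q) - (if p = j then d else 0)" p] that by simp
      have "0 = (\<Sum>q<k. (\<Sum>p<k. x p * c p q) * s q)" using x by simp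
      also have "\<dots> = (\<Sum>q<k. \<Sum>p<k. x p * (c p q * s q))"
        by (simp add: sum_distrib_right mult.assoc)
      also have "\<dots> = (\<Sum>p<k. \<Sum>q<k. x p * (c p q * s q))" by (rule sum.swap)
      also have "\<dots> = (\<Sum>p<k. x p * (if p = j then d else 0))"
        using cs by (simp add: sum_distrib_left[symmetric])
      also have "\<dots> = x j * d" using j by (simp add: if_distrib[of "\<lambda>t. _ * t"] cong: if_cong)
      finally show "x j = 0" using d by simp
    qed
    have orth: "(\<Sum>i<n. w p i * v l i) = 0" if pk: "p < k" and "l < r" for p l
    proof -
      obtain d t where d: "d \<noteq> 0" and t: "\<forall>i<n. d * w p i = (\<Sum>j<n. t j * a i j)" using cols[OF pk] by blast
      have "d * (\<Sum>i<n. w p i * v l i) = (\<Sum>i<n. (d * w p i) * v l i)"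
        by (simp add: sum_distrib_left mult.assoc)
      also have "\<dots> = (\<Sum>i<n. (\<Sum>j<n. t j * a i j) * v l i)" using t by simp
      also have "\<dots> = (\<Sum>i<n. \<Sum>j<n. - t j * (a j i * v l i))" unfolding sum_distrib_right
      proof (intro sum.cong refl)
        fix i j assume "i \<in> {..<n}" "j \<in> {..<n}"
        then have "a i j = - a j i" using alt by blast
        then show "t j * a i j * v l i = - t j * (a j i * v l i)" by simp
      qed
      also have "\<dots> = (\<Sum>j<n. \<Sum>i<n. - t j * (a j i * v l i))" by (rule sum.swap)
      also have "\<dots> = 0" using ker that by (simp add: sum_distrib_left[symmetric] sum_negf)
      finally show ?thesis using d by simp
    qed
    \<comment> \<open>A dependence between \<open>w\<close> and \<open>v\<close> gives a vector in
      both spans. The spans are orthogonal, so this vector is orthogonal to itself.\<close>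
    have "k + r \<le> n"
    proof (rule ccontr)
      assume "\<not> ?thesis"
      then have "card {..<n} < card {..<k + r}" by simp
      from homogeneous_system_nontrivial_solution[OF _ _ this, of "\<lambda>i j. if j < k then w j i else v (j - k) i"]
      obtain g where g: "\<exists>j\<in>{..<k + r}. g j \<noteq> 0"
        and g0: "\<forall>i\<in>{..<n}. (\<Sum>j\<in>{..<k + r}. (if j < k then w j i else v (j - k) i) * g j) = 0" by auto
      have sp: "(\<Sum>j<k. g j * w j i) + (\<Sum>j<r. g (k + j) * v j i) = 0" if "i < n" for i
      proof -
        have "(\<Sum>j<k + r. (if j < k then w j i else v (j - k) i) * g j) =
            (\<Sum>j<k. g j * w j i) + (\<Sum>j<r. g (k + j) * v j i)"
          by (induction r) (simp_all add: algebra_simps)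
        then show ?thesis using g0 that by simp
      qed
      define y where "y i = (\<Sum>j<k. g j * w j i)" for i
      have "(\<Sum>i<n. y i * y i) = (\<Sum>i<n. - (\<Sum>p<k. g p * w p i) * (\<Sum>j<r. g (k + j) * v j i))"
      proof (intro sum.cong refl)
        fix i assume "i \<in> {..<n}"
        then have "y i = - (\<Sum>j<r. g (k + j) * v j i)" using sp[of i] by (simp add: y_def)
        then show "y i * y i = - (\<Sum>p<k. g p * w p i) * (\<Sum>j<r. g (k + j) * v j i)"
          by (simp add: y_def)
      qed
      also have "\<dots> = (\<Sum>i<n. \<Sum>p<k. \<Sum>j<r. - (g p * g (k + j)) * (w p i * v j i))"
        by (simp add: sum_product sum_negf algebra_simps)
      also have "\<dots> = (\<Sum>p<k. \<Sum>i<n. \<Sum>j<r. - (g p * g (k + j)) * (w p i * v j i))" by (rule sum.swap)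
      also have "\<dots> = (\<Sum>p<k. \<Sum>j<r. \<Sum>i<n. - (g p * g (k + j)) * (w p i * v j i))"
        by (intro sum.cong refl sum.swap)
      also have "\<dots> = 0" using orth by (simp add: sum_distrib_left[symmetric] sum_negf)
      finally have y0: "\<forall>i<n. y i = 0" using sum_squares_eq_0 by blast
      then have "\<forall>j<k. g j = 0" using iw unfolding independent_family_def y_def by blast
      moreover have "(\<Sum>j<r. g (k + j) * v j i) = 0" if "i < n" for i
        using sp[OF that] y0[rule_format, OF that] by (simp only: y_def)
      then have "\<forall>j<r. g (k + j) = 0"
        using iv[unfolded independent_family_def, THEN spec, of "\<lambda>j. g (k + j)"] by blast
      ultimately have "g j = 0" if "j < k + r" for j
        using that by (cases "j < k") (auto simp: not_less dest!: spec[of _ "j - k"])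
      then show False using g by blast
    qed
    moreover have "\<forall>x. (\<forall>q<k. (\<Sum>p<k. x p * c p q) = 0) \<longrightarrow> (\<forall>p<k. x p = 0)"
      by (intro allI impI) (rule nondeg)
    moreover have "\<forall>i<n. \<forall>l<n. a i l = (\<Sum>p<k. \<Sum>q<k. w p i * c p q * w q l)"
      by (intro allI impI) (rule ac)
    ultimately show "\<exists>k e w c. k + r \<le> n \<and> reduced_type n k C e w \<and>
        (\<forall>i<n. \<forall>l<n. a i l = (\<Sum>p<k. \<Sum>q<k. w p i * c p q * w q l)) \<and>
        (\<forall>x. (\<forall>q<k. (\<Sum>p<k. x p * c p q) = 0) \<longrightarrow> (\<forall>p<k. x p = 0))"
      using red by blast
  qed
qed

subsection \<open>The exponent of the encoding count\<close>

text \<open>The arguments are grouped into dual positions \<open>p\<close>, \<open>p'\<close> and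
  \<open>q\<close>, \<open>q'\<close>, since a single term need not be bounded by its share: for
  \<open>p\<close> = \<open>q\<close> = -1 and \<open>p'\<close> = \<open>q'\<close> = 1 the first
  term is 2, and only the two mixed terms, of value -2 each, compensate it.\<close>

lemma four_term_inequality:
  fixes p p' q q' :: real
  assumes "p + p' \<le> 0" "q + q' \<le> 0"
  defines "g \<equiv> \<lambda>s t :: real. max 0 (- s - t) - \<bar>s - t\<bar>"
  shows "g p q + g p' q + g p q' + g p' q' \<le> - 2 * (p + p' + q + q')"
  unfolding g_def max_def abs_if using assms(1,2) by (simp split: if_splits)

definition pairs :: "nat \<Rightarrow> (nat \<times> nat) set" where
  "pairs k = {(i, j). i < j \<and> j < k}"

lemma finite_pairs [simp]: "finite (pairs k)"
  by (rule finite_subset[of _ "{..<k} \<times> {..<k}"]) (auto simp: pairs_def)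

lemma sum_pairs_symmetric:
  fixes f :: "nat \<Rightarrow> nat \<Rightarrow> real"
  assumes "\<And>i j. f i j = f j i"
  shows "(\<Sum>i<k. \<Sum>j<k. f i j) = 2 * (\<Sum>(i, j)\<in>pairs k. f i j) + (\<Sum>i<k. f i i)"
proof -
  let ?D = "(\<lambda>i. (i, i)) ` {..<k}" and ?S = "prod.swap ` pairs k"
  have dec: "{..<k} \<times> {..<k} = pairs k \<union> ?S \<union> ?D"
    by (auto simp: pairs_def image_iff)
  have "(\<Sum>i<k. \<Sum>j<k. f i j) = (\<Sum>(i, j)\<in>{..<k} \<times> {..<k}. f i j)"
    by (simp add: sum.cartesian_product)
  also have "\<dots> = (\<Sum>(i, j)\<in>pairs k \<union> ?S. f i j) + (\<Sum>(i, j)\<in>?D. f i j)"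
    unfolding dec by (rule sum.union_disjoint) (simp, simp, auto simp: pairs_def)
  also have "(\<Sum>(i, j)\<in>pairs k \<union> ?S. f i j) = (\<Sum>(i, j)\<in>pairs k. f i j) + (\<Sum>(i, j)\<in>?S. f i j)"
    by (rule sum.union_disjoint) (simp, simp, auto simp: pairs_def)
  also have "(\<Sum>(i, j)\<in>?S. f i j) = (\<Sum>(i, j)\<in>pairs k. f j i)"
    by (subst sum.reindex) (auto simp: case_prod_unfold inj_on_def)
  also have "\<dots> = (\<Sum>(i, j)\<in>pairs k. f i j)" using assms by metis
  also have "(\<Sum>(i, j)\<in>?D. f i j) = (\<Sum>i<k. f i i)"
    by (subst sum.reindex) (auto simp: inj_on_def)
  finally show ?thesis by simp
qed

lemma card_pairs: "2 * card (pairs k) + k = k * k"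
proof -
  have "real (k * k) = 2 * real (card (pairs k)) + real k"
    using sum_pairs_symmetric[of "\<lambda>_ _. 1" k] by (simp add: case_prod_unfold)
  then show ?thesis by linarith
qed

text \<open>\<open>y i\<close> is the logarithm of the \<open>i\<close>-th length relative to the
  square root of X, up to a constant. The terms record the choice of the basis vectors, the choice
  of the coefficients \<open>c\<close>, and the redundancy by unipotent changes of basis. Averaging
  over the reflection of each index reduces the double sum to \<open>four_term_inequality\<close>;
  the sum of the \<open>y j\<close> is not positive, so that \<open>k \<le> n\<close> points in the
  right direction.\<close>

lemma encoding_exponent_nonpos:
  fixes y :: "nat \<Rightarrow> real"
  assumes mono: "\<And>i j. i \<le> j \<Longrightarrow> j < k \<Longrightarrow> y i \<le> y j"
    and dual: "\<And>p. p < k \<Longrightarrow> y p + y (k - Suc p) \<le> 0" and "k \<le> n"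
  shows "real n * (\<Sum>j<k. y j) + (\<Sum>(i, j)\<in>pairs k. max 0 (- y i - y j) - (y j - y i)) \<le> 0"
proof -
  define g where "g = (\<lambda>s t :: real. max 0 (- s - t) - \<bar>s - t\<bar>)"
  define S where "S = (\<Sum>i<k. \<Sum>j<k. g (y i) (y j))"
  have flip: "(\<Sum>i<k. f (k - Suc i)) = (\<Sum>i<k. f i)" for f :: "nat \<Rightarrow> real"
    by (rule sum.nat_diff_reindex)
  have "2 * (\<Sum>j<k. y j) = (\<Sum>j<k. y j + y (k - Suc j))"
    using flip[of y] by (simp add: sum.distrib)
  also have "\<dots> \<le> 0" using dual by (intro sum_nonpos) auto
  finally have neg: "(\<Sum>j<k. y j) \<le> 0" by simp
  have S1: "(\<Sum>i<k. \<Sum>j<k. g (y (k - Suc i)) (y j)) = S"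
    unfolding S_def by (rule flip)
  have S2: "(\<Sum>i<k. \<Sum>j<k. g (y i) (y (k - Suc j))) = S"
    unfolding S_def by (intro sum.cong refl flip[of "\<lambda>j. g (y _) (y j)"])
  have S3: "(\<Sum>i<k. \<Sum>j<k. g (y (k - Suc i)) (y (k - Suc j))) = S"
    unfolding S2[symmetric] by (rule flip[of "\<lambda>i. \<Sum>j<k. g (y i) (y (k - Suc j))"])
  have "4 * S = (\<Sum>i<k. \<Sum>j<k. g (y i) (y j) + g (y (k - Suc i)) (y j) +
      g (y i) (y (k - Suc j)) + g (y (k - Suc i)) (y (k - Suc j)))"
    using S1 S2 S3 by (simp add: sum.distrib S_def)
  also have "\<dots> \<le> (\<Sum>i<k. \<Sum>j<k. - 2 * (y i + y (k - Suc i) + y j + y (k - Suc j)))"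
    unfolding g_def using dual by (intro sum_mono four_term_inequality) auto
  also have "\<dots> = - 2 * (\<Sum>i<k. \<Sum>j<k. y i + y (k - Suc i) + y j + y (k - Suc j))"
    by (simp only: sum_distrib_left)
  also have "(\<Sum>i<k. \<Sum>j<k. y i + y (k - Suc i) + y j + y (k - Suc j)) = 4 * (real k * (\<Sum>j<k. y j))"
    using flip[of y] by (simp add: sum.distrib sum_distrib_left[symmetric])
  also have "- 2 * (4 * (real k * (\<Sum>j<k. y j))) = - 8 * real k * (\<Sum>j<k. y j)" by simp
  finally have S: "S \<le> - 2 * real k * (\<Sum>j<k. y j)" by simp
  have "S = 2 * (\<Sum>(i, j)\<in>pairs k. g (y i) (y j)) + (\<Sum>i<k. g (y i) (y i))"
    unfolding S_def by (rule sum_pairs_symmetric) (auto simp: g_def max_def abs_minus_commute algebra_simps)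
  moreover have "(\<Sum>i<k. g (y i) (y i)) \<ge> 0" by (intro sum_nonneg) (auto simp: g_def)
  ultimately have "(\<Sum>(i, j)\<in>pairs k. g (y i) (y j)) \<le> - real k * (\<Sum>j<k. y j)" using S by linarith
  moreover have "(\<Sum>(i, j)\<in>pairs k. max 0 (- y i - y j) - (y j - y i)) = (\<Sum>(i, j)\<in>pairs k. g (y i) (y j))"
    using mono by (intro sum.cong refl) (force simp: pairs_def g_def)
  moreover have "real n * (\<Sum>j<k. y j) \<le> real k * (\<Sum>j<k. y j)"
    using neg \<open>k \<le> n\<close> by (intro mult_right_mono_neg) auto
  ultimately show ?thesis by linarith
qed

subsection \<open>Counting lattices and matrices of given reduced type\<close>

text \<open>Entries from \<open>n\<close> on are set to zero, so that equality of lattices as sets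
  ignores the values of \<open>w\<close> there.\<close>

definition zlat :: "nat \<Rightarrow> nat \<Rightarrow> (nat \<Rightarrow> nat \<Rightarrow> int) \<Rightarrow> (nat \<Rightarrow> int) set" where
  "zlat n k w = {x. \<exists>c. x = (\<lambda>i. if i < n then \<Sum>j<k. c j * w j i else 0)}"

lemma zlat_group:
  shows "(\<lambda>i. 0) \<in> zlat n k w"
    and "x \<in> zlat n k w \<Longrightarrow> y \<in> zlat n k w \<Longrightarrow> (\<lambda>i. x i - y i) \<in> zlat n k w"
proof -
  show "(\<lambda>i. 0) \<in> zlat n k w" unfolding zlat_def by (auto intro!: exI[of _ "\<lambda>j. 0"])
  assume "x \<in> zlat n k w" "y \<in> zlat n k w"
  then obtain c d where "x = (\<lambda>i. if i < n then \<Sum>j<k. c j * w j i else 0)"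
    "y = (\<lambda>i. if i < n then \<Sum>j<k. d j * w j i else 0)" unfolding zlat_def by blast
  then show "(\<lambda>i. x i - y i) \<in> zlat n k w" unfolding zlat_def
    by (auto intro!: exI[of _ "\<lambda>j. c j - d j"] simp: left_diff_distrib sum_subtractf fun_eq_iff)
qed

lemma zlat_sum_closed:
  assumes "\<And>j. j \<in> J \<Longrightarrow> b j \<in> zlat n k w"
  shows "(\<lambda>i. \<Sum>j\<in>J. c j * b j i) \<in> zlat n k w"
  using group_sum_closed[of "zlat n k w" J b c] zlat_group assms by simp

lemma zlat_subset:
  assumes "\<And>j. j < k \<Longrightarrow> (\<lambda>i. if i < n then w j i else 0) \<in> zlat n k w'"
  shows "zlat n k w \<subseteq> zlat n k w'"
proof
  fix x assume "x \<in> zlat n k w"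
  then obtain c where "x = (\<lambda>i. if i < n then \<Sum>j<k. c j * w j i else 0)" unfolding zlat_def by blast
  then have "x = (\<lambda>i. \<Sum>j<k. c j * (if i < n then w j i else 0))" by (auto simp: fun_eq_iff)
  then show "x \<in> zlat n k w'" using zlat_sum_closed[of "{..<k}" "\<lambda>j i. if i < n then w j i else 0"] assms by simp
qed

lemma zlat_member:
  assumes "j < k"
  shows "(\<lambda>i. if i < n then w j i else 0) \<in> zlat n k w"
proof -
  have "(\<Sum>l<k. (if l = j then 1 else 0) * w l i) = w j i" for i
    using assms by (simp add: if_distrib[of "\<lambda>t. t * _"] cong: if_cong)
  then show ?thesis unfolding zlat_def by (auto intro!: exI[of _ "\<lambda>l. if l = j then 1 else 0"])
qed

text \<open>For the reverse inclusion the triangular system is solved successively, by strong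
  induction on \<open>j\<close>, so that no inverse matrix has to be formed.\<close>

lemma zlat_unipotent:
  assumes w': "\<And>j i. j < k \<Longrightarrow> i < n \<Longrightarrow> w' j i = w j i + (\<Sum>l<j. U j l * w l i)"
  shows "zlat n k w' = zlat n k w"
proof
  show "zlat n k w' \<subseteq> zlat n k w"
  proof (rule zlat_subset)
    fix j assume j: "j < k"
    have s: "(\<lambda>i. \<Sum>l<j. U j l * (if i < n then w l i else 0)) \<in> zlat n k w"
      using j by (intro zlat_sum_closed zlat_member) auto
    have "(\<lambda>i. (if i < n then w j i else 0) + (\<Sum>l<j. U j l * (if i < n then w l i else 0))) \<in> zlat n k w"
      using group_add_closed[of "zlat n k w", OF _ _ zlat_member[OF j] s]
      by (metis (no_types, lifting) zlat_group)
    also have "(\<lambda>i. (if i < n then w j i else 0) + (\<Sum>l<j. U j l * (if i < n then w l i else 0))) =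
        (\<lambda>i. if i < n then w' j i else 0)" using w' j by (auto simp: fun_eq_iff)
    finally show "(\<lambda>i. if i < n then w' j i else 0) \<in> zlat n k w" .
  qed
  show "zlat n k w \<subseteq> zlat n k w'"
  proof (rule zlat_subset)
    fix j assume "j < k"
    then show "(\<lambda>i. if i < n then w j i else 0) \<in> zlat n k w'"
    proof (induction j rule: less_induct)
      case (less j)
      have "(\<lambda>i. \<Sum>l<j. U j l * (if i < n then w l i else 0)) \<in> zlat n k w'"
        using less by (intro zlat_sum_closed) auto
      from zlat_group(2)[OF zlat_member[OF less.prems, of n w'] this]
      have "(\<lambda>i. (if i < n then w' j i else 0) - (\<Sum>l<j. U j l * (if i < n then w l i else 0))) \<in> zlat n k w'" .
      also have "(\<lambda>i. (if i < n then w' j i else 0) - (\<Sum>l<j. U j l * (if i < n then w l i else 0))) =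
        (\<lambda>i. if i < n then w j i else 0)" using w' less.prems by (auto simp: fun_eq_iff)
      finally show ?case .
    qed
  qed
qed

lemma card_int_interval_le:
  assumes "B \<ge> (1::real)"
  shows "real (card {- \<lfloor>B\<rfloor>..\<lfloor>B\<rfloor>}) \<le> 3 * B"
proof -
  have "\<lfloor>B\<rfloor> \<ge> 0" using assms by simp
  then have "real (card {- \<lfloor>B\<rfloor>..\<lfloor>B\<rfloor>}) = 2 * of_int \<lfloor>B\<rfloor> + 1" by simp
  also have "\<dots> \<le> 3 * B" using assms of_int_floor_le[of B] by linarith
  finally show ?thesis .
qed

text \<open>A family in the box determines its lattice, and then, by independence of the basis
  chosen for that lattice, the unipotent matrix that produced it. So the number of lattices times
  the number of unipotent matrices is at most the number of families in the box.\<close>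

lemma card_lattices_of_reduced_type:
  fixes n k :: nat
  assumes C: "C \<ge> 1" and mono: "\<And>i j. i \<le> j \<Longrightarrow> j < k \<Longrightarrow> e i \<le> e j"
  defines "LL \<equiv> zlat n k ` {w. reduced_type n k C e w}"
  shows "finite LL"
    and "real (card LL) * (\<Prod>j<k. \<Prod>i<j. 2 ^ (e j - e i)) \<le> (\<Prod>j<k. (3 * (real k * C * 2 ^ e j)) ^ n)"
proof -
  define rho where "rho = (\<lambda>\<Lambda>. SOME w. reduced_type n k C e w \<and> zlat n k w = \<Lambda>)"
  have rho: "reduced_type n k C e (rho \<Lambda>)" "zlat n k (rho \<Lambda>) = \<Lambda>" if "\<Lambda> \<in> LL" for \<Lambda>
  proof -
    have "\<exists>w. reduced_type n k C e w \<and> zlat n k w = \<Lambda>" using that by (auto simp: LL_def)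
    from someI_ex[OF this] show "reduced_type n k C e (rho \<Lambda>)" "zlat n k (rho \<Lambda>) = \<Lambda>"
      by (auto simp: rho_def)
  qed
  \<comment> \<open>The entry at (\<open>j\<close>, \<open>i\<close>) may be as large as the ratio
    of the two lengths without making vector \<open>j\<close> longer than
    O(\<open>2 ^ e j\<close>).\<close>
  define UU where "UU = PiE {..<k} (\<lambda>j. PiE {..<j} (\<lambda>i. {0..<(2::int) ^ (e j - e i)}))"
  define WW where "WW = PiE {..<k} (\<lambda>j. PiE {..<n} (\<lambda>i. {- \<lfloor>real k * C * 2 ^ e j\<rfloor>..\<lfloor>real k * C * 2 ^ e j\<rfloor>}))"
  define \<Phi> where "\<Phi> = (\<lambda>(\<Lambda>, U). restrict (\<lambda>j. restrict (\<lambda>i. rho \<Lambda> j i + (\<Sum>l<j. U j l * rho \<Lambda> l i)) {..<n}) {..<k})"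
  have \<Phi>: "\<Phi> (\<Lambda>, U) j i = rho \<Lambda> j i + (\<Sum>l<j. U j l * rho \<Lambda> l i)" if "j < k" "i < n" for \<Lambda> U j i
    using that by (simp add: \<Phi>_def)
  have finU: "finite UU" and finW: "finite WW" unfolding UU_def WW_def by (intro finite_PiE; simp)+
  have cardU: "real (card UU) = (\<Prod>j<k. \<Prod>i<j. 2 ^ (e j - e i))"
    unfolding UU_def by (simp add: card_PiE)
  have neU: "UU \<noteq> {}" unfolding UU_def by (simp add: PiE_eq_empty_iff)
  have cardW: "real (card WW) \<le> (\<Prod>j<k. (3 * (real k * C * 2 ^ e j)) ^ n)"
  proof -
    have "real (card WW) = (\<Prod>j<k. real (card {- \<lfloor>real k * C * 2 ^ e j\<rfloor>..\<lfloor>real k * C * 2 ^ e j\<rfloor>}) ^ n)"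
      unfolding WW_def by (simp add: card_PiE del: card_atLeastAtMost_int)
    also have "\<dots> \<le> (\<Prod>j<k. (3 * (real k * C * 2 ^ e j)) ^ n)"
    proof (intro prod_mono conjI power_mono card_int_interval_le)
      fix j assume "j \<in> {..<k}"
      then have "1 * 1 * 1 \<le> real k * C * 2 ^ e j" using C by (intro mult_mono) auto
      then show "1 \<le> real k * C * 2 ^ e j" by simp
    qed auto
    finally show ?thesis .
  qed
  have maps: "\<Phi> ` (LL \<times> UU) \<subseteq> WW"
  proof safe
    fix \<Lambda> U assume L: "\<Lambda> \<in> LL" and U: "U \<in> UU"
    show "\<Phi> (\<Lambda>, U) \<in> WW" unfolding WW_def \<Phi>_def
    proof (clarsimp simp: restrict_PiE_iff)
      fix j i assume j: "j < k" and i: "i < n"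
      have rb: "real_of_int \<bar>rho \<Lambda> l i\<bar> \<le> C * 2 ^ e l" if "l < k" for l
        using rho(1)[OF L] that i by (auto simp: reduced_type_def)
      have Ub: "0 \<le> U j l" "U j l \<le> 2 ^ (e j - e l)" if "l < j" for l
        using U j that by (force simp: UU_def PiE_iff)+
      let ?x = "rho \<Lambda> j i + (\<Sum>l<j. U j l * rho \<Lambda> l i)"
      have "real_of_int \<bar>?x\<bar> \<le> real_of_int \<bar>rho \<Lambda> j i\<bar> + (\<Sum>l<j. real_of_int \<bar>U j l * rho \<Lambda> l i\<bar>)"
      proof -
        have "\<bar>?x\<bar> \<le> \<bar>rho \<Lambda> j i\<bar> + (\<Sum>l<j. \<bar>U j l * rho \<Lambda> l i\<bar>)"
          by (rule order_trans[OF abs_triangle_ineq]) (simp add: sum_abs)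
        then show ?thesis by (metis (mono_tags, lifting) of_int_add of_int_le_iff of_int_sum sum.cong)
      qed
      also have "\<dots> \<le> C * 2 ^ e j + (\<Sum>l<j. C * 2 ^ e j)"
      proof (intro add_mono sum_mono rb j)
        fix l assume "l \<in> {..<j}"
        then have l: "l < j" "l < k" using j by auto
        have "real_of_int \<bar>U j l * rho \<Lambda> l i\<bar> = real_of_int (U j l) * real_of_int \<bar>rho \<Lambda> l i\<bar>"
          using Ub(1)[OF l(1)] by (simp add: abs_mult)
        also have "\<dots> \<le> 2 ^ (e j - e l) * (C * 2 ^ e l)"
        proof (intro mult_mono rb l)
          have "real_of_int (U j l) \<le> real_of_int (2 ^ (e j - e l))" using Ub(2)[OF l(1)] by (simp only: of_int_le_iff)
          then show "real_of_int (U j l) \<le> 2 ^ (e j - e l)" by simp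
        qed (use C in auto)
        also have "\<dots> = C * 2 ^ ((e j - e l) + e l)" by (simp add: power_add)
        also have "(e j - e l) + e l = e j" using mono[of l j] l j by simp
        finally show "real_of_int \<bar>U j l * rho \<Lambda> l i\<bar> \<le> C * 2 ^ e j" .
      qed
      also have "\<dots> = (real j + 1) * (C * 2 ^ e j)" by (simp add: algebra_simps)
      also have "\<dots> \<le> real k * (C * 2 ^ e j)" using j C by (intro mult_right_mono) auto
      finally have "\<bar>?x\<bar> \<le> \<lfloor>real k * C * 2 ^ e j\<rfloor>" by (simp add: le_floor_iff mult.assoc)
      then show "- \<lfloor>real k * C * 2 ^ e j\<rfloor> \<le> ?x \<and> ?x \<le> \<lfloor>real k * C * 2 ^ e j\<rfloor>" by linarith
    qed
  qed
  have inj: "inj_on \<Phi> (LL \<times> UU)"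
  proof (rule inj_onI, clarify)
    fix \<Lambda> U \<Lambda>' U' assume L: "\<Lambda> \<in> LL" "\<Lambda>' \<in> LL" and U: "U \<in> UU" "U' \<in> UU"
      and eq: "\<Phi> (\<Lambda>, U) = \<Phi> (\<Lambda>', U')"
    have "zlat n k (\<Phi> (\<Lambda>, U)) = zlat n k (rho \<Lambda>)" by (rule zlat_unipotent) (rule \<Phi>)
    moreover have "zlat n k (\<Phi> (\<Lambda>', U')) = zlat n k (rho \<Lambda>')" by (rule zlat_unipotent) (rule \<Phi>)
    ultimately have LL: "\<Lambda> = \<Lambda>'" using eq rho(2) L by simp
    have ind: "independent_family n k (rho \<Lambda>)" using reduced_type_independent[OF rho(1)[OF L(1)]] .
    have "U j l = U' j l" if "j < k" "l < j" for j l
    proof -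
      have "(\<Sum>l<k. (if l < j then U j l - U' j l else 0) * rho \<Lambda> l i) = 0" if "i < n" for i
      proof -
        have "(\<Sum>l<k. (if l < j then U j l - U' j l else 0) * rho \<Lambda> l i) =
            (\<Sum>l<j. (if l < j then U j l - U' j l else 0) * rho \<Lambda> l i)"
          using \<open>j < k\<close> by (intro sum.mono_neutral_right) auto
        also have "\<dots> = (\<Sum>l<j. U j l * rho \<Lambda> l i) - (\<Sum>l<j. U' j l * rho \<Lambda> l i)"
          by (simp add: left_diff_distrib sum_subtractf)
        also have "\<dots> = 0" using \<Phi>[OF \<open>j < k\<close> that, of \<Lambda> U] \<Phi>[OF \<open>j < k\<close> that, of \<Lambda> U'] eq LL by simp
        finally show ?thesis .
      qed
      then have "\<forall>l<k. (if l < j then U j l - U' j l else 0) = 0"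
        by (intro ind[unfolded independent_family_def, THEN spec, THEN mp,
              of "\<lambda>l. if l < j then U j l - U' j l else 0"] allI impI)
      moreover have "l < k" using that by simp
      ultimately have "(if l < j then U j l - U' j l else 0) = 0" by blast
      then show ?thesis using that by simp
    qed
    then have Ueq: "U j = U' j" if "j \<in> {..<k}" for j
      using that PiE_mem[OF U(1)[unfolded UU_def] that] PiE_mem[OF U(2)[unfolded UU_def] that]
      by (intro PiE_ext[of "U j" "{..<j}" _ "U' j"]) auto
    have "U = U'" using U unfolding UU_def by (rule PiE_ext) (rule Ueq)
    with LL show "\<Lambda> = \<Lambda>' \<and> U = U'" by simp
  qed
  have fin: "finite (LL \<times> UU)" by (rule inj_on_finite[OF inj maps finW])
  then show "finite LL" using neU finite_cartesian_productD1 by blast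
  have "card (LL \<times> UU) \<le> card WW" by (rule card_inj_on_le[OF inj maps finW])
  then have "real (card LL) * real (card UU) \<le> real (card WW)"
    by (simp only: card_cartesian_product of_nat_mult[symmetric] of_nat_le_iff)
  then show "real (card LL) * (\<Prod>j<k. \<Prod>i<j. 2 ^ (e j - e i)) \<le> (\<Prod>j<k. (3 * (real k * C * 2 ^ e j)) ^ n)"
    using cardU cardW by simp
qed

section \<open>Coefficients of an alternating matrix with respect to a reduced basis\<close>

text \<open>The coordinate bound of \<open>reduced_type\<close> is applied once on each side of the
  product of \<open>w\<close>, \<open>c\<close> and the transpose of \<open>w\<close>.\<close>

lemma coefficient_bound:
  assumes red: "reduced_type n k C e w" and pq: "p < k" "q < k"
    and a: "\<And>i l. i < n \<Longrightarrow> l < n \<Longrightarrow> a i l = (\<Sum>p<k. \<Sum>q<k. w p i * c p q * w q l)"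
    and b: "\<And>i l. i < n \<Longrightarrow> l < n \<Longrightarrow> real_of_int \<bar>a i l\<bar> \<le> X"
  shows "real_of_int \<bar>c p q\<bar> * (2 ^ e p * 2 ^ e q) \<le> C\<^sup>2 * X"
proof -
  have red': "real_of_int \<bar>c i\<bar> * 2 ^ e i \<le> C * B"
    if "i < k" "\<And>l. l < n \<Longrightarrow> real_of_int \<bar>\<Sum>j<k. c j * w j l\<bar> \<le> B" for c i B
    using red that unfolding reduced_type_def by blast
  have "real_of_int \<bar>\<Sum>q<k. c p q * w q l\<bar> \<le> C * X / 2 ^ e p" if l: "l < n" for l
  proof -
    have "real_of_int \<bar>\<Sum>j<k. (\<Sum>q<k. c j q * w q l) * w j i\<bar> \<le> X" if "i < n" for i
      using b[OF that l] a[OF that l] by (simp add: sum_distrib_left sum_distrib_right algebra_simps)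
    from red'[of p "\<lambda>p. \<Sum>q<k. c p q * w q l", OF pq(1) this]
    show ?thesis by (simp add: field_simps)
  qed
  from red'[of q "c p", OF pq(2) this] show ?thesis
    by (simp add: field_simps power2_eq_square)
qed

text \<open>An integer of absolute value below 1 vanishes. If the bound failed, the rows of
  \<open>c\<close> from \<open>p\<close> on would be zero in all columns from
  \<open>p' = k - Suc p\<close> on; these are \<open>p' + 1\<close> rows supported in
  \<open>p'\<close> columns, hence dependent.\<close>

lemma dual_exponent_bound:
  assumes red: "reduced_type n k C e w" and "p < k"
    and a: "\<And>i l. i < n \<Longrightarrow> l < n \<Longrightarrow> a i l = (\<Sum>p<k. \<Sum>q<k. w p i * c p q * w q l)"
    and b: "\<And>i l. i < n \<Longrightarrow> l < n \<Longrightarrow> real_of_int \<bar>a i l\<bar> \<le> X"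
    and nondeg: "\<And>x p. (\<forall>q<k. (\<Sum>p<k. x p * c p q) = 0) \<Longrightarrow> p < k \<Longrightarrow> x p = 0"
  shows "2 ^ e p * 2 ^ e (k - Suc p) \<le> C\<^sup>2 * X"
proof (rule ccontr)
  assume neg: "\<not> ?thesis"
  define p' where "p' = k - Suc p"
  have mono: "e i \<le> e j" if "i \<le> j" "j < k" for i j using red that by (auto simp: reduced_type_def)
  have zero: "c i j = 0" if "p \<le> i" "i < k" "p' \<le> j" "j < k" for i j
  proof (rule ccontr)
    assume "c i j \<noteq> 0"
    then have "1 \<le> real_of_int \<bar>c i j\<bar>" by linarith
    then have "2 ^ e i * 2 ^ e j \<le> real_of_int \<bar>c i j\<bar> * (2 ^ e i * 2 ^ e j)" by simp
    also have "\<dots> \<le> C\<^sup>2 * X" using coefficient_bound[OF red _ _ a b] that by blast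
    also have "\<dots> < 2 ^ e p * 2 ^ e p'" using neg by (simp add: p'_def)
    also have "\<dots> \<le> 2 ^ e i * 2 ^ e j" using that mono by (intro mult_mono power_increasing) auto
    finally show False by simp
  qed
  have "card {..<p'} < card {p..<k}" using \<open>p < k\<close> by (simp add: p'_def)
  from homogeneous_system_nontrivial_solution[OF _ _ this, of "\<lambda>q p. c p q"]
  obtain x where x: "\<exists>j\<in>{p..<k}. x j \<noteq> 0" "\<forall>q\<in>{..<p'}. (\<Sum>j\<in>{p..<k}. c j q * x j) = 0" by auto
  define y where "y j = (if p \<le> j then x j else 0)" for j
  have "(\<Sum>j<k. y j * c j q) = 0" if "q < k" for q
  proof -
    have "(\<Sum>j<k. y j * c j q) = (\<Sum>j\<in>{p..<k}. y j * c j q)"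
      by (intro sum.mono_neutral_right) (auto simp: y_def)
    also have "\<dots> = (\<Sum>j\<in>{p..<k}. c j q * x j)" by (intro sum.cong) (auto simp: y_def)
    also have "\<dots> = 0"
    proof (cases "q < p'")
      case False
      then show ?thesis using zero that by (intro sum.neutral) auto
    qed (use x in auto)
    finally show ?thesis .
  qed
  then have "\<forall>j<k. y j = 0" using nondeg by blast
  then show False using x(1) by (auto simp: y_def)
qed

text \<open>Coordinates with respect to an independent family are unique; this is used first on the
  left and then on the right.\<close>

lemma coefficients_alternating:
  assumes ind: "independent_family n k w" and pq: "p < k" "q < k"
    and a: "\<And>i l. i < n \<Longrightarrow> l < n \<Longrightarrow> a i l = (\<Sum>p<k. \<Sum>q<k. w p i * c p q * w q l)"
    and alt: "\<And>i l. i < n \<Longrightarrow> l < n \<Longrightarrow> a i l = - a l i"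
  shows "c p q = - c q p"
proof -
  have ind': "c j = 0" if "\<And>i. i < n \<Longrightarrow> (\<Sum>l<k. c l * w l i) = 0" "j < k" for c j
    using ind that unfolding independent_family_def by blast
  have "(\<Sum>p<k. (\<Sum>q<k. (c p q + c q p) * w q l) * w p i) = 0" if "i < n" "l < n" for i l
  proof -
    have "(\<Sum>p<k. (\<Sum>q<k. (c p q + c q p) * w q l) * w p i) =
        (\<Sum>p<k. \<Sum>q<k. w p i * c p q * w q l + w q l * c q p * w p i)"
      unfolding sum_distrib_right by (intro sum.cong refl) (simp add: algebra_simps)
    also have "\<dots> = (\<Sum>p<k. \<Sum>q<k. w p i * c p q * w q l) + (\<Sum>p<k. \<Sum>q<k. w q l * c q p * w p i)"
      by (simp only: sum.distrib)
    also have "(\<Sum>p<k. \<Sum>q<k. w q l * c q p * w p i) = (\<Sum>q<k. \<Sum>p<k. w q l * c q p * w p i)"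
      by (rule sum.swap)
    finally show ?thesis using a[OF that] a[OF that(2,1)] alt[OF that] by linarith
  qed
  then have "(\<Sum>q<k. (c p q + c q p) * w q l) = 0" if "l < n" for l
    using ind'[of "\<lambda>p. \<Sum>q<k. (c p q + c q p) * w q l" p] that pq by blast
  then have "c p q + c q p = 0" using ind'[of "\<lambda>q. c p q + c q p" q] pq by blast
  then show ?thesis by simp
qed

lemma alt_matricesD:
  assumes "A \<in> alt_matrices n X" "i < n" "l < n"
  shows "A $$ (i, l) = - A $$ (l, i)" "real_of_int \<bar>A $$ (i, l)\<bar> \<le> X"
proof -
  have A: "dim_row A = n" "dim_col A = n" and "transpose_mat A = - A"
    using assms by (auto simp: alt_matrices_def)
  then have "transpose_mat A $$ (l, i) = (- A) $$ (l, i)" by simp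
  moreover have "transpose_mat A $$ (l, i) = A $$ (i, l)" using A assms by simp
  moreover have "(- A) $$ (l, i) = - A $$ (l, i)" using A assms by simp
  ultimately show "A $$ (i, l) = - A $$ (l, i)" by simp
  show "real_of_int \<bar>A $$ (i, l)\<bar> \<le> X" using assms by (auto simp: alt_matrices_def)
qed

text \<open>Only the entries of \<open>c\<close> above the diagonal are free. The maximum with 1
  accounts for the value zero, which is admissible however small the bound is.\<close>

lemma card_matrices_over_basis:
  fixes n k :: nat and X :: real
  assumes red: "reduced_type n k C e w"
  defines "MM \<equiv> {A \<in> alt_matrices n X. \<exists>c. \<forall>i<n. \<forall>l<n.
      A $$ (i, l) = (\<Sum>p<k. \<Sum>q<k. w p i * c p q * w q l)}"
  shows "finite MM"
    and "real (card MM) \<le> (\<Prod>(p, q)\<in>pairs k. 3 * max 1 (C\<^sup>2 * X / (2 ^ e p * 2 ^ e q)))"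
proof -
  define B where "B = (\<lambda>(p, q). max 1 (C\<^sup>2 * X / (2 ^ e p * 2 ^ e q)))"
  define DD where "DD = PiE (pairs k) (\<lambda>pq. {- \<lfloor>B pq\<rfloor>..\<lfloor>B pq\<rfloor>})"
  define cc where "cc d p q = (if p < q then d (p, q) else if q < p then - d (q, p) else 0)" for d :: "nat \<times> nat \<Rightarrow> int" and p q
  define F where "F d = mat n n (\<lambda>(i, l). \<Sum>p<k. \<Sum>q<k. w p i * cc d p q * w q l)" for d
  have finD: "finite DD" unfolding DD_def by (intro finite_PiE) auto
  have sub: "MM \<subseteq> F ` DD"
  proof
    fix A assume "A \<in> MM"
    then obtain c where A: "A \<in> alt_matrices n X"
      and c: "\<And>i l. i < n \<Longrightarrow> l < n \<Longrightarrow> A $$ (i, l) = (\<Sum>p<k. \<Sum>q<k. w p i * c p q * w q l)"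
      by (auto simp: MM_def)
    define d where "d = restrict (\<lambda>(p, q). c p q) (pairs k)"
    have alt: "c p q = - c q p" if "p < k" "q < k" for p q
      by (rule coefficients_alternating[where a = "\<lambda>i l. A $$ (i, l)",
            OF reduced_type_independent[OF red] that c alt_matricesD(1)[OF A]])
    have bd: "real_of_int \<bar>c p q\<bar> * (2 ^ e p * 2 ^ e q) \<le> C\<^sup>2 * X" if "p < k" "q < k" for p q
      by (rule coefficient_bound[where a = "\<lambda>i l. A $$ (i, l)", OF red that c alt_matricesD(2)[OF A]])
    have "d \<in> DD" unfolding DD_def d_def
    proof (rule restrict_PiE_iff[THEN iffD2], clarify)
      fix p q assume "(p, q) \<in> pairs k"
      then have "p < k" "q < k" by (auto simp: pairs_def)
      then have "real_of_int \<bar>c p q\<bar> \<le> C\<^sup>2 * X / (2 ^ e p * 2 ^ e q)"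
        using bd[of p q] by (simp add: field_simps)
      then have "real_of_int \<bar>c p q\<bar> \<le> B (p, q)" by (simp add: B_def)
      then have "\<bar>c p q\<bar> \<le> \<lfloor>B (p, q)\<rfloor>" by (simp add: le_floor_iff)
      then show "c p q \<in> {- \<lfloor>B (p, q)\<rfloor>..\<lfloor>B (p, q)\<rfloor>}" by auto
    qed
    moreover have "A = F d"
    proof (rule eq_matI)
      fix i l assume "i < dim_row (F d)" "l < dim_col (F d)"
      then have il: "i < n" "l < n" by (auto simp: F_def)
      have "cc d p q = c p q" if "p < k" "q < k" for p q
        using that alt[of p q] alt[of p p] by (auto simp: cc_def d_def pairs_def)
      then show "A $$ (i, l) = F d $$ (i, l)" using c[OF il] il by (simp add: F_def)
    qed (use A in \<open>auto simp: F_def alt_matrices_def\<close>)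
    ultimately show "A \<in> F ` DD" by blast
  qed
  then show "finite MM" using finD finite_surj by blast
  have "card MM \<le> card DD" by (rule surj_card_le[OF finD sub])
  then have "real (card MM) \<le> real (card DD)" by simp
  also have "\<dots> = (\<Prod>pq\<in>pairs k. real (card {- \<lfloor>B pq\<rfloor>..\<lfloor>B pq\<rfloor>}))"
    unfolding DD_def by (simp add: card_PiE del: card_atLeastAtMost_int)
  also have "\<dots> \<le> (\<Prod>pq\<in>pairs k. 3 * B pq)"
    by (intro prod_mono conjI card_int_interval_le) (auto simp: B_def)
  finally show "real (card MM) \<le> (\<Prod>(p, q)\<in>pairs k. 3 * max 1 (C\<^sup>2 * X / (2 ^ e p * 2 ^ e q)))"
    by (simp add: B_def case_prod_unfold)
qed

lemma pairs_product:
  fixes f :: "nat \<Rightarrow> nat \<Rightarrow> real"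
  shows "(\<Prod>j<k. \<Prod>i<j. f i j) = (\<Prod>(i, j)\<in>pairs k. f i j)"
proof (induction k)
  case (Suc k)
  have "pairs (Suc k) = pairs k \<union> (\<lambda>i. (i, k)) ` {..<k}" by (auto simp: pairs_def)
  also have "(\<Prod>(i, j)\<in>\<dots>. f i j) = (\<Prod>(i, j)\<in>pairs k. f i j) * (\<Prod>(i, j)\<in>(\<lambda>i. (i, k)) ` {..<k}. f i j)"
    by (rule prod.union_disjoint) (simp, simp, auto simp: pairs_def)
  also have "(\<Prod>(i, j)\<in>(\<lambda>i. (i, k)) ` {..<k}. f i j) = (\<Prod>i<k. f i k)"
    by (subst prod.reindex) (auto simp: inj_on_def)
  finally show ?case using Suc by simp
qed (simp add: pairs_def)

text \<open>Nonsingularity of \<open>c\<close> is part of the type because the dual bound for the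
  exponents rests on it.\<close>

definition matrices_of_type :: "nat \<Rightarrow> nat \<Rightarrow> real \<Rightarrow> (nat \<Rightarrow> nat) \<Rightarrow> real \<Rightarrow> int mat set" where
  "matrices_of_type n k C e X = {A \<in> alt_matrices n X. \<exists>w c. reduced_type n k C e w \<and>
     (\<forall>i<n. \<forall>l<n. A $$ (i, l) = (\<Sum>p<k. \<Sum>q<k. w p i * c p q * w q l)) \<and>
     (\<forall>x. (\<forall>q<k. (\<Sum>p<k. x p * c p q) = 0) \<longrightarrow> (\<forall>p<k. x p = 0))}"

lemma matrices_of_type_dual_bound:
  assumes "A \<in> matrices_of_type n k C e X" "p < k"
  shows "2 ^ e p * 2 ^ e (k - Suc p) \<le> C\<^sup>2 * X"
proof -
  obtain w c where red: "reduced_type n k C e w" and A: "A \<in> alt_matrices n X"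
    and a: "\<And>i l. i < n \<Longrightarrow> l < n \<Longrightarrow> A $$ (i, l) = (\<Sum>p<k. \<Sum>q<k. w p i * c p q * w q l)"
    and nondeg: "\<And>x p. (\<forall>q<k. (\<Sum>p<k. x p * c p q) = 0) \<Longrightarrow> p < k \<Longrightarrow> x p = 0"
    using assms(1) unfolding matrices_of_type_def by blast
  show ?thesis by (rule dual_exponent_bound[where a = "\<lambda>i l. A $$ (i, l)",
          OF red assms(2) a alt_matricesD(2)[OF A]]) (blast intro: nondeg)+
qed

lemma zlat_eq_coefficients:
  assumes "zlat n k w = zlat n k w'"
  obtains U where "\<And>j i. j < k \<Longrightarrow> i < n \<Longrightarrow> w j i = (\<Sum>p<k. U j p * w' p i)"
proof -
  have "\<exists>u. \<forall>i<n. w j i = (\<Sum>p<k. u p * w' p i)" if "j < k" for j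
  proof -
    have "(\<lambda>i. if i < n then w j i else 0) \<in> zlat n k w'" using zlat_member[OF that] assms by blast
    then obtain u where u: "(\<lambda>i. if i < n then w j i else 0) = (\<lambda>i. if i < n then \<Sum>p<k. u p * w' p i else 0)"
      unfolding zlat_def by blast
    have "w j i = (\<Sum>p<k. u p * w' p i)" if "i < n" for i using fun_cong[OF u, of i] that by simp
    then show ?thesis by blast
  qed
  then show thesis using that by metis
qed

text \<open>If no matrix has this type, there is nothing to prove. Otherwise a single matrix already
  makes the exponents monotone and gives them the dual bound; the product of the two counts is then
  estimated in logarithms.\<close>

lemma card_matrices_of_type:
  assumes C: "C \<ge> 1" and X: "X > 0" and kn: "k \<le> n"
  shows "finite (matrices_of_type n k C e X)"
    and "real (card (matrices_of_type n k C e X)) \<le>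
      (3 * (real n + 1) * C) ^ (n * n) * 3 ^ (n * n) * (C\<^sup>2 * X) powr (real n * real k / 2)"
proof -
  let ?T = "matrices_of_type n k C e X"
  let ?R = "(3 * (real n + 1) * C) ^ (n * n) * 3 ^ (n * n) * (C\<^sup>2 * X) powr (real n * real k / 2)"
  have R: "?R \<ge> 0" using C by (intro mult_nonneg_nonneg) auto
  show "finite ?T" "real (card ?T) \<le> ?R"
  proof (atomize (full), cases "?T = {}")
    case True
    then show "finite ?T \<and> real (card ?T) \<le> ?R" using R by simp
  next
    case False
    then obtain A0 where A0: "A0 \<in> ?T" by blast
    then obtain w0 where w0: "reduced_type n k C e w0" unfolding matrices_of_type_def by blast
    have mono: "e i \<le> e j" if "i \<le> j" "j < k" for i j using w0 that by (auto simp: reduced_type_def)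
    define LL where "LL = zlat n k ` {w. reduced_type n k C e w}"
    have finL: "finite LL" and cardL: "real (card LL) * (\<Prod>j<k. \<Prod>i<j. 2 ^ (e j - e i)) \<le> (\<Prod>j<k. (3 * (real k * C * 2 ^ e j)) ^ n)"
      unfolding LL_def using card_lattices_of_reduced_type[OF C mono] by auto
    define rho where "rho = (\<lambda>\<Lambda>. SOME w. reduced_type n k C e w \<and> zlat n k w = \<Lambda>)"
    have rho: "reduced_type n k C e (rho \<Lambda>)" "zlat n k (rho \<Lambda>) = \<Lambda>" if "\<Lambda> \<in> LL" for \<Lambda>
    proof -
      have "\<exists>w. reduced_type n k C e w \<and> zlat n k w = \<Lambda>" using that by (auto simp: LL_def)
      from someI_ex[OF this] show "reduced_type n k C e (rho \<Lambda>)" "zlat n k (rho \<Lambda>) = \<Lambda>"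
        by (auto simp: rho_def)
    qed
    define MM where "MM w = {A \<in> alt_matrices n X. \<exists>c. \<forall>i<n. \<forall>l<n.
      A $$ (i, l) = (\<Sum>p<k. \<Sum>q<k. w p i * c p q * w q l)}" for w
    define Y where "Y = C\<^sup>2 * X"
    have Y: "Y > 0" using C X by (simp add: Y_def)
    define Q where "Q = (\<Prod>(p, q)\<in>pairs k. 3 * max 1 (Y / (2 ^ e p * 2 ^ e q)))"
    have Q0: "Q \<ge> 0" unfolding Q_def by (intro prod_nonneg) auto
    have MM: "finite (MM (rho \<Lambda>))" "real (card (MM (rho \<Lambda>))) \<le> Q" if "\<Lambda> \<in> LL" for \<Lambda>
      unfolding MM_def Q_def Y_def using card_matrices_over_basis[OF rho(1)[OF that], where X = X] by auto
    have sub: "?T \<subseteq> (\<Union>\<Lambda>\<in>LL. MM (rho \<Lambda>))"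
    proof
      fix A assume "A \<in> ?T"
      then obtain w c where red: "reduced_type n k C e w" and A: "A \<in> alt_matrices n X"
        and a: "\<And>i l. i < n \<Longrightarrow> l < n \<Longrightarrow> A $$ (i, l) = (\<Sum>p<k. \<Sum>q<k. w p i * c p q * w q l)"
        unfolding matrices_of_type_def by blast
      define \<Lambda> where "\<Lambda> = zlat n k w"
      have L: "\<Lambda> \<in> LL" using red by (auto simp: LL_def \<Lambda>_def)
      obtain U where U: "\<And>j i. j < k \<Longrightarrow> i < n \<Longrightarrow> w j i = (\<Sum>p<k. U j p * rho \<Lambda> p i)"
        using zlat_eq_coefficients[of n k w "rho \<Lambda>"] rho(2)[OF L] \<Lambda>_def by metis
      \<comment> \<open>Two bases of the same lattice differ by an integer matrix \<open>U\<close>,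
        which is absorbed into the coefficients.\<close>
      define c' where "c' s t = (\<Sum>p<k. \<Sum>q<k. U p s * c p q * U q t)" for s t
      have "A $$ (i, l) = (\<Sum>s<k. \<Sum>t<k. rho \<Lambda> s i * c' s t * rho \<Lambda> t l)" if "i < n" "l < n" for i l
      proof -
        have "A $$ (i, l) = (\<Sum>p<k. \<Sum>q<k. (\<Sum>s<k. U p s * rho \<Lambda> s i) * c p q * (\<Sum>t<k. U q t * rho \<Lambda> t l))"
          using a[OF that] U that by simp
        also have "\<dots> = (\<Sum>p<k. \<Sum>q<k. \<Sum>s<k. \<Sum>t<k. rho \<Lambda> s i * (U p s * c p q * U q t) * rho \<Lambda> t l)"
          by (intro sum.cong refl) (simp add: sum_distrib_left sum_distrib_right algebra_simps)
        also have "\<dots> = (\<Sum>p<k. \<Sum>s<k. \<Sum>q<k. \<Sum>t<k. rho \<Lambda> s i * (U p s * c p q * U q t) * rho \<Lambda> t l)"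
          by (intro sum.cong refl sum.swap)
        also have "\<dots> = (\<Sum>s<k. \<Sum>p<k. \<Sum>q<k. \<Sum>t<k. rho \<Lambda> s i * (U p s * c p q * U q t) * rho \<Lambda> t l)"
          by (rule sum.swap)
        also have "\<dots> = (\<Sum>s<k. \<Sum>p<k. \<Sum>t<k. \<Sum>q<k. rho \<Lambda> s i * (U p s * c p q * U q t) * rho \<Lambda> t l)"
          by (intro sum.cong refl sum.swap)
        also have "\<dots> = (\<Sum>s<k. \<Sum>t<k. \<Sum>p<k. \<Sum>q<k. rho \<Lambda> s i * (U p s * c p q * U q t) * rho \<Lambda> t l)"
          by (intro sum.cong refl sum.swap)
        also have "\<dots> = (\<Sum>s<k. \<Sum>t<k. rho \<Lambda> s i * c' s t * rho \<Lambda> t l)"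
          unfolding c'_def by (intro sum.cong refl) (simp only: sum_distrib_left sum_distrib_right)
        finally show ?thesis .
      qed
      then have "A \<in> MM (rho \<Lambda>)" unfolding MM_def using A by blast
      then show "A \<in> (\<Union>\<Lambda>\<in>LL. MM (rho \<Lambda>))" using L by blast
    qed
    have finU: "finite (\<Union>\<Lambda>\<in>LL. MM (rho \<Lambda>))" using finL MM(1) by blast
    have "card ?T \<le> (\<Sum>\<Lambda>\<in>LL. card (MM (rho \<Lambda>)))"
      using card_mono[OF finU sub] card_UN_le[OF finL, of "\<lambda>\<Lambda>. MM (rho \<Lambda>)"] by linarith
    then have "real (card ?T) \<le> (\<Sum>\<Lambda>\<in>LL. real (card (MM (rho \<Lambda>))))"
      by (metis of_nat_le_iff of_nat_sum)
    also have "\<dots> \<le> (\<Sum>\<Lambda>\<in>LL. Q)" using MM(2) by (intro sum_mono) auto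
    finally have T: "real (card ?T) \<le> real (card LL) * Q" by simp
    \<comment> \<open>Logarithms of the lengths relative to the square root of \<open>Y\<close>, so
      that the extremal type is \<open>y\<close> = 0.\<close>
    define y where "y j = real (e j) * ln 2 - ln Y / 2" for j
    have e2: "2 ^ e j = exp (y j + ln Y / 2)" for j
      by (simp add: y_def exp_of_nat_mult)
    have neg: "real n * (\<Sum>j<k. y j) + (\<Sum>(i, j)\<in>pairs k. max 0 (- y i - y j) - (y j - y i)) \<le> 0"
    proof (rule encoding_exponent_nonpos[OF _ _ kn])
      fix p assume "p < k"
      then have "2 ^ e p * 2 ^ e (k - Suc p) \<le> Y"
        using matrices_of_type_dual_bound[OF A0] by (simp add: Y_def)
      then have "exp (y p + y (k - Suc p) + ln Y) \<le> exp (ln Y)"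
        unfolding e2 using Y by (simp add: exp_add[symmetric] algebra_simps)
      then show "y p + y (k - Suc p) \<le> 0" by simp
    qed (use mono in \<open>auto simp: y_def\<close>)
    have diffs: "(\<Prod>j<k. \<Prod>i<j. (2::real) ^ (e j - e i)) = exp (\<Sum>(i, j)\<in>pairs k. y j - y i)"
    proof -
      have "(\<Prod>j<k. \<Prod>i<j. (2::real) ^ (e j - e i)) = (\<Prod>(i, j)\<in>pairs k. 2 ^ (e j - e i))"
        by (rule pairs_product)
      also have "\<dots> = (\<Prod>(i, j)\<in>pairs k. exp (y j - y i))"
      proof (intro prod.cong refl, clarify)
        fix i j assume "(i, j) \<in> pairs k"
        then have "e i \<le> e j" using mono by (auto simp: pairs_def)
        then have "(2::real) ^ (e j - e i) = 2 ^ e j / 2 ^ e i" by (simp add: power_diff)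
        then show "(2::real) ^ (e j - e i) = exp (y j - y i)" unfolding e2 by (simp add: exp_diff[symmetric])
      qed
      finally show ?thesis by (simp add: exp_sum case_prod_unfold)
    qed
    have maxs: "Q = 3 ^ card (pairs k) * exp (\<Sum>(i, j)\<in>pairs k. max 0 (- y i - y j))"
    proof -
      have "max 1 (Y / (2 ^ e i * 2 ^ e j)) = exp (max 0 (- y i - y j))" for i j
      proof -
        have "Y / (2 ^ e i * 2 ^ e j) = exp (ln Y) / exp (y i + y j + ln Y)"
          unfolding e2 using Y by (simp add: exp_add[symmetric] algebra_simps)
        also have "\<dots> = exp (- y i - y j)" by (simp add: exp_diff[symmetric])
        finally have "Y / (2 ^ e i * 2 ^ e j) = exp (- y i - y j)" .
        then show ?thesis by (simp only:) (auto simp: max_def)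
      qed
      then have "Q = (\<Prod>(p, q)\<in>pairs k. 3 * exp (max 0 (- y p - y q)))"
        unfolding Q_def by simp
      then show ?thesis by (simp add: case_prod_unfold prod.distrib exp_sum)
    qed
    have tot: "(\<Prod>j<k. (3 * (real k * C * 2 ^ e j)) ^ n) =
        (3 * (real k * C)) ^ (k * n) * (exp (real n * (\<Sum>j<k. y j)) * Y powr (real n * real k / 2))"
    proof -
      have "(\<Prod>j<k. (3 * (real k * C * 2 ^ e j)) ^ n) = (\<Prod>j<k. (3 * (real k * C)) ^ n * exp (real n * y j + real n * ln Y / 2))"
        unfolding e2 by (intro prod.cong refl) (simp add: power_mult_distrib exp_of_nat_mult[symmetric] algebra_simps)
      also have "\<dots> = (3 * (real k * C)) ^ (k * n) * exp (\<Sum>j<k. real n * y j + real n * ln Y / 2)"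
        by (simp only: prod.distrib exp_sum finite_lessThan prod_constant card_lessThan
            power_mult[symmetric] mult.commute[of k n])
      also have "(\<Sum>j<k. real n * y j + real n * ln Y / 2) = real n * (\<Sum>j<k. y j) + real n * real k / 2 * ln Y"
        by (simp add: sum.distrib sum_distrib_left)
      finally show ?thesis using Y by (simp add: exp_add powr_def)
    qed
    let ?D = "exp (\<Sum>(i, j)\<in>pairs k. y j - y i)"
    \<comment> \<open>Multiplication by the number \<open>?D\<close> of unipotent matrices makes
      \<open>cardL\<close> applicable; \<open>neg\<close> then gives the same factor back.\<close>
    have "real (card ?T) * ?D \<le> real (card LL) * Q * ?D" using T by (intro mult_right_mono) auto
    also have "\<dots> = (real (card LL) * ?D) * Q" by simp
    also have "\<dots> \<le> ((3 * (real k * C)) ^ (k * n) * (exp (real n * (\<Sum>j<k. y j)) * Y powr (real n * real k / 2))) * Q"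
      using cardL Q0 unfolding diffs tot by (rule mult_right_mono)
    also have "\<dots> = (3 * (real k * C)) ^ (k * n) * 3 ^ card (pairs k) * Y powr (real n * real k / 2) *
        exp (real n * (\<Sum>j<k. y j) + (\<Sum>(i, j)\<in>pairs k. max 0 (- y i - y j)))"
      unfolding maxs by (simp add: exp_add algebra_simps)
    also have "\<dots> \<le> (3 * (real k * C)) ^ (k * n) * 3 ^ card (pairs k) * Y powr (real n * real k / 2) * ?D"
      using neg C by (intro mult_left_mono) (auto simp: sum_subtractf case_prod_unfold)
    finally have "real (card ?T) \<le> (3 * (real k * C)) ^ (k * n) * 3 ^ card (pairs k) * Y powr (real n * real k / 2)"
      by simp
    also have "\<dots> \<le> ?R"
    proof -
      have "(3 * (real k * C)) ^ (k * n) \<le> (3 * (real n + 1) * C) ^ (k * n)"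
        using kn C by (intro power_mono) (auto intro!: mult_mono)
      also have "\<dots> \<le> (3 * (real n + 1) * C) ^ (n * n)"
      proof (rule power_increasing)
        show "k * n \<le> n * n" using kn by simp
        have "1 * 1 * 1 \<le> 3 * (real n + 1) * C" using C by (intro mult_mono) auto
        then show "1 \<le> 3 * (real n + 1) * C" by simp
      qed
      finally have 1: "(3 * (real k * C)) ^ (k * n) \<le> (3 * (real n + 1) * C) ^ (n * n)" .
      have "card (pairs k) \<le> k * k" using card_pairs[of k] by linarith
      also have "\<dots> \<le> n * n" using kn by (intro mult_le_mono) auto
      finally have 2: "(3::real) ^ card (pairs k) \<le> 3 ^ (n * n)" by (intro power_increasing) auto
      show ?thesis unfolding Y_def using 1 2 C by (intro mult_mono) auto
    qed
    finally show "finite ?T \<and> real (card ?T) \<le> ?R" using finite_subset[OF sub finU] by blast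
  qed
qed

text \<open>The number of dyadic types is polylogarithmic in \<open>X\<close>; it is absorbed by the extra factor \<open>X\<close>.\<close>

theorem card_singular_alternating_le:
  "\<exists>K>0. \<forall>X\<ge>1. \<forall>r\<le>n. real (card {A \<in> alt_matrices n X. \<exists>v. independent_family n r v \<and>
      (\<forall>l<r. \<forall>i<n. (\<Sum>j<n. A $$ (i, j) * v l j) = 0)}) \<le> K * X powr (1 + real n * real (n - r) / 2)"
proof -
  obtain C where C: "C \<ge> 1" and enc: "\<And>a r v. (\<forall>i<n. \<forall>j<n. a i j = - a j i) \<Longrightarrow> independent_family n r v \<Longrightarrow>
     (\<forall>l<r. \<forall>i<n. (\<Sum>j<n. a i j * v l j) = 0) \<Longrightarrow>
     (\<exists>k e w c. k + r \<le> n \<and> reduced_type n k C e w \<and>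
        (\<forall>i<n. \<forall>l<n. a i l = (\<Sum>p<k. \<Sum>q<k. w p i * c p q * w q l)) \<and>
        (\<forall>x. (\<forall>q<k. (\<Sum>p<k. x p * c p q) = 0) \<longrightarrow> (\<forall>p<k. x p = 0)))"
    using alternating_encoding[of n] by blast
  define K1 where "K1 = (3 * (real n + 1) * C) ^ (n * n) * 3 ^ (n * n)"
  define K2 where "K2 = (real n / ln 2 + 1) ^ n * C\<^sup>2"
  define K where "K = (real n + 1) * K2 * (K1 * (C\<^sup>2) powr (real n * real n / 2))"
  have K1: "K1 > 0" using C by (simp add: K1_def)
  have K2: "K2 > 0" unfolding K2_def using C by (intro mult_pos_pos zero_less_power add_nonneg_pos) auto
  have K: "K > 0" unfolding K_def using C K1 K2 by simp
  show ?thesis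
  proof (intro exI[of _ K] conjI allI impI K)
    fix X :: real and r assume X: "X \<ge> 1" and r: "r \<le> n"
    let ?S = "{A \<in> alt_matrices n X. \<exists>v. independent_family n r v \<and>
      (\<forall>l<r. \<forall>i<n. (\<Sum>j<n. A $$ (i, j) * v l j) = 0)}"
    define t where "t = C\<^sup>2 * X"
    have t: "t \<ge> 1" unfolding t_def using C X by (simp add: mult_ge1_I)
    define M where "M = Suc (nat \<lfloor>log 2 t\<rfloor>)"
    define EE where "EE = Sigma {..n - r} (\<lambda>k. PiE {..<k} (\<lambda>_. {..<M}))"
    have finE: "finite EE" unfolding EE_def by (intro finite_SigmaI finite_PiE) auto
    have sub: "?S \<subseteq> (\<Union>(k, e)\<in>EE. matrices_of_type n k C e X)"
    proof
      fix A assume "A \<in> ?S"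
      then obtain v where A: "A \<in> alt_matrices n X" and v: "independent_family n r v"
        "\<forall>l<r. \<forall>i<n. (\<Sum>j<n. A $$ (i, j) * v l j) = 0" by blast
      have "\<forall>i<n. \<forall>j<n. A $$ (i, j) = - A $$ (j, i)" using alt_matricesD(1)[OF A] by blast
      from enc[of "\<lambda>i j. A $$ (i, j)", OF this v] obtain k e w c where
        k: "k + r \<le> n" and red: "reduced_type n k C e w"
        and a: "\<forall>i<n. \<forall>l<n. A $$ (i, l) = (\<Sum>p<k. \<Sum>q<k. w p i * c p q * w q l)"
        and nondeg: "\<forall>x. (\<forall>q<k. (\<Sum>p<k. x p * c p q) = 0) \<longrightarrow> (\<forall>p<k. x p = 0)" by blast
      \<comment> \<open>The values of \<open>e\<close> from \<open>k\<close> on carry no meaning;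
        fixing them leaves finitely many types.\<close>
      define e' where "e' = restrict e {..<k}"
      have "reduced_type n k C e' w" using red by (simp add: reduced_type_def e'_def)
      then have T: "A \<in> matrices_of_type n k C e' X" unfolding matrices_of_type_def using A a nondeg by blast
      have "e' j < M" if "j < k" for j
      proof -
        have "2 ^ e' j * 1 \<le> 2 ^ e' j * (2::real) ^ e' (k - Suc j)" by (intro mult_left_mono) auto
        also have "\<dots> \<le> t" using matrices_of_type_dual_bound[OF T that] by (simp add: t_def)
        finally have "2 powr (real (e' j)) \<le> t" by (simp add: powr_realpow)
        then have "real (e' j) \<le> log 2 t" using t by (simp add: le_log_iff)
        then show ?thesis unfolding M_def by (simp add: le_nat_floor less_Suc_eq_le)
      qed
      then have "(k, e') \<in> EE" using k unfolding EE_def by (auto simp: e'_def)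
      then show "A \<in> (\<Union>(k, e)\<in>EE. matrices_of_type n k C e X)" using T by blast
    qed
    have each: "finite (matrices_of_type n k C e X)"
      "real (card (matrices_of_type n k C e X)) \<le> K1 * t powr (real n * real (n - r) / 2)" if "(k, e) \<in> EE" for k e
    proof -
      have "k \<in> {..n - r}" using that unfolding EE_def by (rule SigmaD1)
      then have k: "k \<le> n - r" "k \<le> n" by auto
      show "finite (matrices_of_type n k C e X)" using card_matrices_of_type(1)[OF C _ k(2)] X by simp
      have "real (card (matrices_of_type n k C e X)) \<le> K1 * t powr (real n * real k / 2)"
        using card_matrices_of_type(2)[OF C _ k(2), of X e] X by (simp add: K1_def t_def)
      also have "\<dots> \<le> K1 * t powr (real n * real (n - r) / 2)"
        using K1 t k by (intro mult_left_mono powr_mono divide_right_mono) auto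
      finally show "real (card (matrices_of_type n k C e X)) \<le> K1 * t powr (real n * real (n - r) / 2)" .
    qed
    have "card ?S \<le> card (\<Union>(k, e)\<in>EE. matrices_of_type n k C e X)"
      using finE each(1) by (intro card_mono sub) auto
    also have "\<dots> \<le> (\<Sum>(k, e)\<in>EE. card (matrices_of_type n k C e X))"
      using card_UN_le[OF finE, of "\<lambda>(k, e). matrices_of_type n k C e X"] by (simp add: case_prod_unfold)
    finally have "real (card ?S) \<le> real (\<Sum>(k, e)\<in>EE. card (matrices_of_type n k C e X))"
      by (simp only: of_nat_le_iff)
    also have "\<dots> = (\<Sum>(k, e)\<in>EE. real (card (matrices_of_type n k C e X)))" by (simp add: case_prod_unfold)
    also have "\<dots> \<le> (\<Sum>(k, e)\<in>EE. K1 * t powr (real n * real (n - r) / 2))"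
      using each(2) by (intro sum_mono) auto
    also have "\<dots> = real (card EE) * (K1 * t powr (real n * real (n - r) / 2))" by (simp add: case_prod_unfold)
    finally have S: "real (card ?S) \<le> real (card EE) * (K1 * t powr (real n * real (n - r) / 2))" .
    have M: "real M ^ n \<le> K2 * X"
    proof (cases "n = 0")
      case True
      then show ?thesis using C X by (simp add: K2_def mult_ge1_I)
    next
      case False
      have "real M \<le> log 2 t + 1" unfolding M_def using t by simp
      \<comment> \<open>Since \<open>ln t\<close> is at most \<open>n\<close> times the
        \<open>n\<close>-th root of \<open>t\<close>, the \<open>n\<close>-th power of the number of
        exponents is only linear in \<open>t\<close>. This is the extra factor
        \<open>X\<close>.\<close>
      also have "\<dots> \<le> (real n / ln 2 + 1) * t powr (1 / real n)"
      proof -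
        have "ln t = real n * ln (t powr (1 / real n))" using False t by (simp add: ln_powr)
        also have "\<dots> \<le> real n * t powr (1 / real n)" using t by (intro mult_left_mono ln_bound) auto
        finally have "log 2 t \<le> real n / ln 2 * t powr (1 / real n)" by (simp add: log_def field_simps)
        moreover have "1 \<le> t powr (1 / real n)" using t by (simp add: ge_one_powr_ge_zero)
        ultimately show ?thesis by (simp add: algebra_simps)
      qed
      finally have "real M ^ n \<le> ((real n / ln 2 + 1) * t powr (1 / real n)) ^ n"
        by (intro power_mono) auto
      also have "\<dots> = (real n / ln 2 + 1) ^ n * t"
        using False t by (simp add: power_mult_distrib powr_powr powr_realpow[symmetric])
      finally show ?thesis by (simp add: K2_def t_def algebra_simps)
    qed
    have "real (card EE) \<le> (real n + 1) * real M ^ n"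
    proof -
      have "card EE = (\<Sum>k\<in>{..n - r}. M ^ k)" unfolding EE_def
        by (subst card_SigmaI) (auto simp: card_PiE intro!: finite_PiE)
      also have "\<dots> \<le> (\<Sum>k\<in>{..n - r}. M ^ n)"
        by (intro sum_mono power_increasing) (auto simp: M_def)
      also have "\<dots> \<le> (n + 1) * M ^ n" by simp
      finally have "card EE \<le> (n + 1) * M ^ n" .
      then have "real (card EE) \<le> real ((n + 1) * M ^ n)" by (simp only: of_nat_le_iff)
      then show ?thesis by (simp add: algebra_simps)
    qed
    also have "\<dots> \<le> (real n + 1) * (K2 * X)" using M by (intro mult_left_mono) auto
    finally have E: "real (card EE) \<le> (real n + 1) * (K2 * X)" .
    have "t powr (real n * real (n - r) / 2) = (C\<^sup>2) powr (real n * real (n - r) / 2) * X powr (real n * real (n - r) / 2)"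
      unfolding t_def using C X by (simp add: powr_mult)
    also have "\<dots> \<le> (C\<^sup>2) powr (real n * real n / 2) * X powr (real n * real (n - r) / 2)"
      using C by (intro mult_right_mono powr_mono divide_right_mono mult_left_mono) auto
    finally have tp: "t powr (real n * real (n - r) / 2) \<le> (C\<^sup>2) powr (real n * real n / 2) * X powr (real n * real (n - r) / 2)" .
    have "real (card ?S) \<le> ((real n + 1) * (K2 * X)) * (K1 * ((C\<^sup>2) powr (real n * real n / 2) * X powr (real n * real (n - r) / 2)))"
      using S E tp K1 K2 X by (elim order_trans) (intro mult_mono mult_left_mono; auto)
    also have "\<dots> = K * X powr (1 + real n * real (n - r) / 2)"
      using X by (simp add: K_def powr_add)
    finally show "real (card ?S) \<le> K * X powr (1 + real n * real (n - r) / 2)" .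
  qed
qed

subsection \<open>The rank of the integer kernel\<close>

text \<open>\<open>lin_dep\<close> speaks of some finite subset of \<open>S\<close>; extending its
  coefficients by zero turns this into coefficients on \<open>S\<close> itself.\<close>

lemma lin_dep_module_vec_iff:
  fixes S :: "int vec set"
  assumes fin: "finite S" and S: "S \<subseteq> carrier_vec n"
  shows "LinearCombinations.module.lin_dep class_ring (module_vec TYPE(int) n) S \<longleftrightarrow>
    (\<exists>a. (\<forall>i<n. (\<Sum>x\<in>S. a x * x $ i) = 0) \<and> (\<exists>v\<in>S. a v \<noteq> 0))" (is "?L \<longleftrightarrow> ?R")
proof -
  interpret vm: vec_module "TYPE(int)" n .
  have idx: "vm.lincomb a A $ i = (\<Sum>x\<in>A. a x * x $ i)" if "A \<subseteq> S" "i < n" for a A i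
  proof -
    have A: "A \<subseteq> carrier_vec n" using that S by blast
    then have "vm.lincomb a A $ i = (\<Sum>x\<in>A. (a x \<cdot>\<^sub>v x) $ i)"
      unfolding vm.lincomb_def using that by (intro vm.finsum_index) auto
    also have "\<dots> = (\<Sum>x\<in>A. a x * x $ i)"
      using A that by (intro sum.cong refl) auto
    finally show ?thesis .
  qed
  have dim: "vm.lincomb a A \<in> carrier_vec n" if "A \<subseteq> S" for a A
    using that S vm.lincomb_closed[of A a] by auto
  show ?thesis
  proof
    assume ?L
    then obtain A a v where A: "A \<subseteq> S" "vm.lincomb a A = 0\<^sub>v n" "v \<in> A" "a v \<noteq> 0"
      unfolding vm.lin_dep_def by auto
    define b where "b x = (if x \<in> A then a x else 0)" for x
    have "(\<Sum>x\<in>S. b x * x $ i) = 0" if "i < n" for i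
    proof -
      have "(\<Sum>x\<in>S. b x * x $ i) = (\<Sum>x\<in>A. b x * x $ i)"
        using A(1) fin by (intro sum.mono_neutral_right) (auto simp: b_def)
      also have "\<dots> = (\<Sum>x\<in>A. a x * x $ i)" by (intro sum.cong) (auto simp: b_def)
      also have "\<dots> = 0" using idx[OF A(1) that, of a] A(2) that by simp
      finally show ?thesis .
    qed
    then show ?R using A by (intro exI[of _ b]) (auto simp: b_def)
  next
    assume ?R
    then obtain a v where a: "\<forall>i<n. (\<Sum>x\<in>S. a x * x $ i) = 0" "v \<in> S" "a v \<noteq> 0" by blast
    have "vm.lincomb a S = 0\<^sub>v n"
      using dim[of S a] idx[of S _ a] a(1) by (intro eq_vecI) auto
    then show ?L unfolding vm.lin_dep_def using fin a by auto
  qed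
qed

lemma independent_family_le:
  assumes "independent_family n k v"
  shows "k \<le> n"
proof (rule ccontr)
  assume "\<not> ?thesis"
  then have "card {..<n} < card {..<k}" by simp
  from homogeneous_system_nontrivial_solution[OF _ _ this, of "\<lambda>i l. v l i"]
  obtain c where "\<exists>j\<in>{..<k}. c j \<noteq> 0" "\<forall>i\<in>{..<n}. (\<Sum>l<k. v l i * c l) = 0" by auto
  then show False using assms unfolding independent_family_def
    by (metis (no_types, lifting) lessThan_iff mult.commute sum.cong)
qed

lemma independent_family_mono:
  assumes ind: "independent_family n k v" and "r \<le> k"
  shows "independent_family n r v"
  unfolding independent_family_def
proof (intro allI impI)
  fix c l assume c: "\<forall>i<n. (\<Sum>l<r. c l * v l i) = 0" and l: "l < r"
  define d where "d l = (if l < r then c l else 0)" for l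
  have "(\<Sum>l<k. d l * v l i) = 0" if "i < n" for i
  proof -
    have "(\<Sum>l<k. d l * v l i) = (\<Sum>l<r. d l * v l i)"
      using \<open>r \<le> k\<close> by (intro sum.mono_neutral_right) (auto simp: d_def)
    also have "\<dots> = (\<Sum>l<r. c l * v l i)" by (intro sum.cong) (auto simp: d_def)
    finally show ?thesis using c that by simp
  qed
  then have "d l = 0" using ind l \<open>r \<le> k\<close> unfolding independent_family_def by (meson less_le_trans)
  then show "c l = 0" using l by (simp add: d_def)
qed

lemma independent_set_enumeration:
  fixes S :: "int vec set"
  assumes fin: "finite S" and S: "S \<subseteq> carrier_vec n" and h: "bij_betw h {..<k} S"
  shows "LinearCombinations.module.lin_dep class_ring (module_vec TYPE(int) n) S \<longleftrightarrow>
    \<not> independent_family n k (\<lambda>l i. h l $ i)"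
proof -
  have re: "(\<Sum>x\<in>S. a x * x $ i) = (\<Sum>l<k. a (h l) * h l $ i)" for a i
    using sum.reindex_bij_betw[OF h, of "\<lambda>x. a x * x $ i"] by simp
  show ?thesis unfolding lin_dep_module_vec_iff[OF fin S]
  proof
    assume "\<exists>a. (\<forall>i<n. (\<Sum>x\<in>S. a x * x $ i) = 0) \<and> (\<exists>v\<in>S. a v \<noteq> 0)"
    then obtain a v where a: "\<forall>i<n. (\<Sum>x\<in>S. a x * x $ i) = 0" "v \<in> S" "a v \<noteq> 0" by blast
    then obtain l where "l < k" "v = h l" using h by (auto simp: bij_betw_def)
    then show "\<not> independent_family n k (\<lambda>l i. h l $ i)"
      using a unfolding re independent_family_def by (auto intro!: exI[of _ "\<lambda>l. a (h l)"])
  next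
    assume "\<not> independent_family n k (\<lambda>l i. h l $ i)"
    then obtain c l where c: "\<forall>i<n. (\<Sum>l<k. c l * h l $ i) = 0" "l < k" "c l \<noteq> 0"
      unfolding independent_family_def by blast
    define a where "a x = c (inv_into {..<k} h x)" for x
    have "a (h l) = c l" if "l < k" for l
      using that h unfolding a_def bij_betw_def by (simp add: inv_into_f_f)
    moreover have "h l \<in> S" using c(2) h by (auto simp: bij_betw_def)
    ultimately show "\<exists>a. (\<forall>i<n. (\<Sum>x\<in>S. a x * x $ i) = 0) \<and> (\<exists>v\<in>S. a v \<noteq> 0)"
      unfolding re using c by (intro exI[of _ a] conjI bexI[of _ "h l"]) auto
  qed
qed

text \<open>\<open>Max\<close> requires a finite nonempty set: independent sets have at most
  \<open>n\<close> elements, and the empty set is independent. Subfamilies yield all smaller values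
  of \<open>r\<close>. From here on modules are replaced by families of integers.\<close>

lemma int_kernel_rank_ge_iff:
  fixes A :: "int mat"
  assumes A: "A \<in> carrier_mat n n"
  shows "r \<le> int_module_rank (dim_col A) (mat_kernel A) \<longleftrightarrow>
    (\<exists>v. independent_family n r v \<and> (\<forall>l<r. \<forall>i<n. (\<Sum>j<n. A $$ (i, j) * v l j) = 0))" (is "_ \<longleftrightarrow> ?R")
proof -
  let ?ind = "\<lambda>S. \<not> LinearCombinations.module.lin_dep class_ring (module_vec TYPE(int) n) S"
  define CC where "CC = {card S |S. finite S \<and> S \<subseteq> mat_kernel A \<and> ?ind S}"
  have K: "mat_kernel A \<subseteq> carrier_vec n" using A by (auto simp: mat_kernel_def)
  have memK: "x \<in> mat_kernel A \<longleftrightarrow> x \<in> carrier_vec n \<and> (\<forall>i<n. (\<Sum>j<n. A $$ (i, j) * x $ j) = 0)" for x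
  proof -
    have "(A *\<^sub>v x) $ i = (\<Sum>j<n. A $$ (i, j) * x $ j)" if "i < n" "x \<in> carrier_vec n" for i
      using A that by (simp add: scalar_prod_def atLeast0LessThan)
    then show ?thesis using A unfolding mat_kernel[OF A]
      by (auto simp: vec_eq_iff)
  qed
  have enum: "\<exists>h. bij_betw h {..<card S} S" if "finite S" for S :: "int vec set"
    using ex_bij_betw_nat_finite[OF that] by (simp add: atLeast0LessThan)
  have "c \<le> n" if "c \<in> CC" for c
  proof -
    obtain S where S: "finite S" "S \<subseteq> mat_kernel A" "?ind S" "c = card S" using \<open>c \<in> CC\<close> unfolding CC_def by blast
    obtain h where "bij_betw h {..<card S} S" using enum[OF S(1)] by blast
    then have "independent_family n (card S) (\<lambda>l i. h l $ i)"
      using independent_set_enumeration[of S n h "card S"] S K by blast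
    then show ?thesis using independent_family_le S(4) by blast
  qed
  then have fin: "finite CC" by (meson finite_nat_set_iff_bounded_le)
  have "?ind {}" by (subst lin_dep_module_vec_iff) auto
  then have ne: "CC \<noteq> {}" unfolding CC_def by blast
  have rank: "int_module_rank (dim_col A) (mat_kernel A) = Max CC"
    using A by (simp add: int_module_rank_def CC_def)
  show ?thesis unfolding rank
  proof
    assume r: "r \<le> Max CC"
    have "Max CC \<in> CC" by (rule Max_in[OF fin ne])
    then obtain S where S: "finite S" "S \<subseteq> mat_kernel A" "?ind S" "Max CC = card S" unfolding CC_def by blast
    obtain h where h: "bij_betw h {..<card S} S" using enum[OF S(1)] by blast
    then have ind: "independent_family n (card S) (\<lambda>l i. h l $ i)"
      using independent_set_enumeration[of S n h "card S"] S K by blast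
    have "independent_family n r (\<lambda>l i. h l $ i)" using independent_family_mono[OF ind] r S(4) by simp
    moreover have "h l \<in> mat_kernel A" if "l < r" for l
      using that r S h by (auto simp: bij_betw_def)
    ultimately show ?R using memK by (intro exI[of _ "\<lambda>l i. h l $ i"]) auto
  next
    assume ?R
    then obtain v where ind: "independent_family n r v" and ker: "\<forall>l<r. \<forall>i<n. (\<Sum>j<n. A $$ (i, j) * v l j) = 0" by blast
    define h where "h l = vec n (v l)" for l
    \<comment> \<open>Two equal vectors would satisfy the relation with coefficients 1 and
      -1.\<close>
    have inj: "inj_on h {..<r}"
    proof (rule inj_onI, rule ccontr)
      fix l m assume lm: "l \<in> {..<r}" "m \<in> {..<r}" "h l = h m" "l \<noteq> m"
      have eq: "v l i = v m i" if "i < n" for i using lm(3) that unfolding h_def by (metis index_vec)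
      define c :: "nat \<Rightarrow> int" where "c j = (if j = l then 1 else if j = m then -1 else 0)" for j
      have "(\<Sum>j<r. c j * v j i) = 0" if "i < n" for i
      proof -
        have "(\<Sum>j<r. c j * v j i) = (\<Sum>j\<in>{l, m}. c j * v j i)"
          using lm by (intro sum.mono_neutral_right) (auto simp: c_def)
        also have "\<dots> = 0" using lm(4) eq[OF that] by (simp add: c_def)
        finally show ?thesis .
      qed
      then have "c l = 0" using ind lm(1) unfolding independent_family_def by (meson lessThan_iff)
      then show False by (simp add: c_def)
    qed
    then have h: "bij_betw h {..<r} (h ` {..<r})" by (simp add: bij_betw_def)
    have "(\<Sum>l<r. c l * h l $ i) = (\<Sum>l<r. c l * v l i)" if "i < n" for c i
      using that by (simp add: h_def)
    then have "independent_family n r (\<lambda>l i. h l $ i)"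
      using ind unfolding independent_family_def by metis
    then have "?ind (h ` {..<r})"
      using independent_set_enumeration[OF _ _ h, of n] by (fastforce simp: h_def)
    moreover have "h ` {..<r} \<subseteq> mat_kernel A" using ker by (auto simp: memK h_def)
    moreover have "card (h ` {..<r}) = r" using inj by (simp add: card_image)
    ultimately have "r \<in> CC" unfolding CC_def
      by (intro CollectI exI[of _ "h ` {..<r}"]) simp
    then show "r \<le> Max CC" using fin by simp
  qed
qed

subsection \<open>Isotropic lattices of an alternating form\<close>

text \<open>\<open>R\<close> is the inverse of \<open>P\<close>. Modulo integers it defines an
  alternating pairing on the finite group of integer vectors modulo the columns of \<open>P\<close>;
  isotropic subgroups of this group supply the bordering columns.\<close>

locale nondegenerate_alternating =
  fixes k :: nat and P :: "nat \<Rightarrow> nat \<Rightarrow> int" and R :: "nat \<Rightarrow> nat \<Rightarrow> real"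
  assumes PR: "i < k \<Longrightarrow> j < k \<Longrightarrow> (\<Sum>l<k. P i l * R l j) = (if i = j then 1 else 0)"
    and RP: "i < k \<Longrightarrow> j < k \<Longrightarrow> (\<Sum>l<k. R i l * P l j) = (if i = j then 1 else 0)"
    and R_alt: "i < k \<Longrightarrow> j < k \<Longrightarrow> R i j = - R j i"
begin

definition V :: "(nat \<Rightarrow> int) set" where
  "V = {x. \<forall>i\<ge>k. x i = 0}"

definition par :: "(nat \<Rightarrow> int) \<Rightarrow> (nat \<Rightarrow> int) \<Rightarrow> real" where
  "par x y = (\<Sum>i<k. \<Sum>j<k. x i * R i j * y j)"

definition Pm :: "(nat \<Rightarrow> int) \<Rightarrow> (nat \<Rightarrow> int)" where
  "Pm u = (\<lambda>i. if i < k then \<Sum>j<k. P i j * u j else 0)"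

definition Rm :: "(nat \<Rightarrow> int) \<Rightarrow> nat \<Rightarrow> real" where
  "Rm x j = (\<Sum>l<k. R j l * x l)"

text \<open>The representative of \<open>x\<close> modulo the lattice spanned by the columns of \<open>P\<close> that lies in
  the fundamental parallelepiped.\<close>

definition rep :: "(nat \<Rightarrow> int) \<Rightarrow> (nat \<Rightarrow> int)" where
  "rep x = (\<lambda>i. x i - Pm (\<lambda>j. \<lfloor>Rm x j\<rfloor>) i)"

lemma V_add: "x \<in> V \<Longrightarrow> y \<in> V \<Longrightarrow> (\<lambda>i. x i + y i) \<in> V"
  and V_diff: "x \<in> V \<Longrightarrow> y \<in> V \<Longrightarrow> (\<lambda>i. x i - y i) \<in> V"
  and V_Pm: "Pm u \<in> V"
  by (simp_all add: V_def Pm_def)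

lemma Pm_cong: "(\<And>j. j < k \<Longrightarrow> u j = v j) \<Longrightarrow> Pm u = Pm v"
  by (auto simp: Pm_def)

lemma Pm_add: "Pm (\<lambda>j. u j + v j) i = Pm u i + Pm v i"
  by (simp add: Pm_def distrib_left sum.distrib)

lemma par_Rm: "par x y = (\<Sum>i<k. x i * Rm y i)"
  by (simp add: par_def Rm_def sum_distrib_left mult.assoc)

lemma Rm_add: "Rm (\<lambda>i. x i + y i) j = Rm x j + Rm y j"
  and Rm_diff: "Rm (\<lambda>i. x i - y i) j = Rm x j - Rm y j"
  by (simp_all add: Rm_def sum.distrib sum_subtractf algebra_simps)

lemma par_add_right: "par x (\<lambda>i. y i + z i) = par x y + par x z"
  and par_diff_right: "par x (\<lambda>i. y i - z i) = par x y - par x z"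
  and par_diff_left: "par (\<lambda>i. x i - z i) y = par x y - par z y"
  by (simp_all add: par_Rm Rm_add Rm_diff sum.distrib sum_subtractf algebra_simps)

lemma par_swap: "par x y = - par y x"
proof -
  have "par x y = (\<Sum>j<k. \<Sum>i<k. x i * R i j * y j)" unfolding par_def by (rule sum.swap)
  also have "\<dots> = (\<Sum>j<k. \<Sum>i<k. - (y j * R j i * x i))"
  proof (intro sum.cong refl)
    fix i j assume "i \<in> {..<k}" "j \<in> {..<k}"
    then have "R i j = - R j i" using R_alt by blast
    then show "x i * R i j * y j = - (y j * R j i * x i)" by simp
  qed
  finally show ?thesis by (simp add: par_def sum_negf)
qed

lemma par_self: "par x x = 0"
  using par_swap[of x x] by simp

lemma Rm_Pm: "j < k \<Longrightarrow> Rm (Pm u) j = u j"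
proof -
  assume j: "j < k"
  have "Rm (Pm u) j = (\<Sum>l<k. \<Sum>i<k. R j l * P l i * u i)"
    by (simp add: Rm_def Pm_def sum_distrib_left mult.assoc)
  also have "\<dots> = (\<Sum>i<k. \<Sum>l<k. R j l * P l i * u i)" by (rule sum.swap)
  also have "\<dots> = (\<Sum>i<k. (if j = i then 1 else 0) * real_of_int (u i))"
    using RP[OF j] by (intro sum.cong refl) (simp add: sum_distrib_right[symmetric])
  also have "\<dots> = u j" using j by (simp add: if_distrib[of "\<lambda>t. t * _"] cong: if_cong)
  finally show ?thesis .
qed

lemma P_Rm: "i < k \<Longrightarrow> (\<Sum>j<k. P i j * Rm x j) = x i"
proof -
  assume i: "i < k"
  have "(\<Sum>j<k. P i j * Rm x j) = (\<Sum>j<k. \<Sum>l<k. P i j * R j l * x l)"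
    by (simp add: Rm_def sum_distrib_left mult.assoc)
  also have "\<dots> = (\<Sum>l<k. \<Sum>j<k. P i j * R j l * x l)" by (rule sum.swap)
  also have "\<dots> = (\<Sum>l<k. (if i = l then 1 else 0) * real_of_int (x l))"
    using PR[OF i] by (intro sum.cong refl) (simp add: sum_distrib_right[symmetric])
  also have "\<dots> = x i" using i by (simp add: if_distrib[of "\<lambda>t. t * _"] cong: if_cong)
  finally show ?thesis .
qed

text \<open>The columns of \<open>P\<close> pair integrally with every integer vector, so the
  pairing modulo integers depends on classes only.\<close>

lemma par_Pm: "par x (Pm u) \<in> \<int>"
  unfolding par_Rm by (intro Ints_sum Ints_mult) (auto simp: Rm_Pm)

lemma rep_V: "x \<in> V \<Longrightarrow> rep x \<in> V"
  by (simp add: V_def rep_def Pm_def)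

lemma par_rep: "par x (rep y) - par x y \<in> \<int>"
  unfolding rep_def par_diff_right using par_Pm by simp

lemma rep_zero: "rep (\<lambda>i. 0) = (\<lambda>i. 0)"
  by (simp add: rep_def Rm_def Pm_def fun_eq_iff)

lemma rep_add_Pm: "rep (\<lambda>i. x i + Pm u i) = rep x"
proof -
  have "Pm (\<lambda>j. \<lfloor>Rm (\<lambda>i. x i + Pm u i) j\<rfloor>) = Pm (\<lambda>j. \<lfloor>Rm x j\<rfloor> + u j)"
    by (rule Pm_cong) (simp add: Rm_add Rm_Pm)
  then show ?thesis by (simp add: rep_def Pm_add)
qed

lemma rep_eqD:
  assumes "rep x = rep y"
  obtains u where "\<And>i. x i = y i + Pm u i"
proof
  fix i
  have "x i - Pm (\<lambda>j. \<lfloor>Rm x j\<rfloor>) i = y i - Pm (\<lambda>j. \<lfloor>Rm y j\<rfloor>) i"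
    using fun_cong[OF assms, of i] by (simp add: rep_def)
  then show "x i = y i + Pm (\<lambda>j. \<lfloor>Rm x j\<rfloor> - \<lfloor>Rm y j\<rfloor>) i"
    by (auto simp: Pm_def right_diff_distrib sum_subtractf split: if_splits)
qed

lemma rep_shift: "\<exists>u. \<forall>i. rep x i = x i + Pm u i"
  by (rule exI[of _ "\<lambda>j. - \<lfloor>Rm x j\<rfloor>"]) (auto simp: rep_def Pm_def sum_negf)

lemma rep_rep: "rep (rep x) = rep x"
proof -
  obtain u where "\<forall>i. rep x i = x i + Pm u i" using rep_shift by blast
  then have "rep x = (\<lambda>i. x i + Pm u i)" by auto
  then show ?thesis using rep_add_Pm[of x u] by simp
qed

text \<open>The representative is \<open>P\<close> applied to a vector of fractional parts.\<close>

lemma rep_bound: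
  assumes P: "\<And>i j. i < k \<Longrightarrow> j < k \<Longrightarrow> real_of_int \<bar>P i j\<bar> \<le> X" and i: "i < k"
  shows "real_of_int \<bar>rep x i\<bar> \<le> real k * X"
proof -
  have "real_of_int (rep x i) = (\<Sum>j<k. P i j * frac (Rm x j))"
    using P_Rm[OF i, of x] i by (simp add: rep_def Pm_def frac_def right_diff_distrib sum_subtractf)
  then have "real_of_int \<bar>rep x i\<bar> \<le> (\<Sum>j<k. \<bar>P i j * frac (Rm x j)\<bar>)" by (simp add: sum_abs)
  also have "\<dots> \<le> (\<Sum>j<k. X)"
  proof (rule sum_mono)
    fix j assume "j \<in> {..<k}"
    then have "real_of_int \<bar>P i j\<bar> \<le> X" using P i by blast
    have "\<bar>P i j * frac (Rm x j)\<bar> \<le> real_of_int \<bar>P i j\<bar> * 1"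
      unfolding abs_mult using frac_lt_1[of "Rm x j"] by (intro mult_mono) auto
    then show "\<bar>P i j * frac (Rm x j)\<bar> \<le> X" using \<open>real_of_int \<bar>P i j\<bar> \<le> X\<close> by linarith
  qed
  finally show ?thesis by simp
qed

text \<open>Counting the points of a box that contains all representatives takes the place of
  Hadamard's inequality for the determinant of \<open>P\<close>.\<close>

lemma card_rep_le:
  assumes P: "\<And>i j. i < k \<Longrightarrow> j < k \<Longrightarrow> real_of_int \<bar>P i j\<bar> \<le> X" and X: "real k * X \<ge> 1"
  shows "finite (rep ` V)" "real (card (rep ` V)) \<le> (3 * (real k * X)) ^ k"
proof -
  let ?B = "PiE {..<k} (\<lambda>_. {- \<lfloor>real k * X\<rfloor>..\<lfloor>real k * X\<rfloor>})"
  have inj: "inj_on (\<lambda>x. restrict x {..<k}) (rep ` V)"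
  proof (rule inj_onI)
    fix x y assume xy: "x \<in> rep ` V" "y \<in> rep ` V" "restrict x {..<k} = restrict y {..<k}"
    have "x i = y i" for i
    proof (cases "i < k")
      case True
      then show ?thesis using fun_cong[OF xy(3), of i] by simp
    next
      case False
      then show ?thesis using xy(1,2) rep_V by (auto simp: V_def)
    qed
    then show "x = y" by auto
  qed
  have sub: "(\<lambda>x. restrict x {..<k}) ` (rep ` V) \<subseteq> ?B"
  proof clarsimp
    fix x i assume "i < k"
    have "\<bar>rep x i\<bar> \<le> \<lfloor>real k * X\<rfloor>" using rep_bound[OF P \<open>i < k\<close>, of x] by (simp add: le_floor_iff)
    then show "- \<lfloor>real k * X\<rfloor> \<le> rep x i \<and> rep x i \<le> \<lfloor>real k * X\<rfloor>" by linarith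
  qed
  have fB: "finite ?B" by (intro finite_PiE) auto
  show "finite (rep ` V)" by (rule inj_on_finite[OF inj sub fB])
  have "card (rep ` V) \<le> card ?B" by (rule card_inj_on_le[OF inj sub fB])
  also have "card ?B = card {- \<lfloor>real k * X\<rfloor>..\<lfloor>real k * X\<rfloor>} ^ k"
    by (simp add: card_PiE del: card_atLeastAtMost_int)
  finally have "real (card (rep ` V)) \<le> real (card {- \<lfloor>real k * X\<rfloor>..\<lfloor>real k * X\<rfloor>}) ^ k"
    by (simp only: of_nat_le_iff of_nat_power[symmetric])
  also have "\<dots> \<le> (3 * (real k * X)) ^ k"
    using card_int_interval_le[OF X] by (intro power_mono) auto
  finally show "real (card (rep ` V)) \<le> (3 * (real k * X)) ^ k" .
qed

text \<open>Zorn's lemma for isotropic sets containing \<open>q\<close>. As the form is alternating,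
  a vector that pairs integrally with a maximal set can be adjoined to it, so the set is its own
  orthogonal. That it is a group then follows from this characterization.\<close>

lemma maximal_isotropic_exists:
  assumes q: "q \<in> V"
  obtains L where "q \<in> L" "L \<subseteq> V" "\<And>x. x \<in> V \<Longrightarrow> x \<in> L \<longleftrightarrow> (\<forall>y\<in>L. par x y \<in> \<int>)"
proof -
  define AA where "AA = {S. q \<in> S \<and> S \<subseteq> V \<and> (\<forall>x\<in>S. \<forall>y\<in>S. par x y \<in> \<int>)}"
  have "{q} \<in> AA" using q by (simp add: AA_def par_self)
  moreover have "\<Union>C \<in> AA" if C: "C \<noteq> {}" "subset.chain AA C" for C
  proof -
    have CA: "S \<in> AA" if "S \<in> C" for S using C(2) that by (auto simp: subset_chain_def)
    have "par x y \<in> \<int>" if "x \<in> S" "S \<in> C" "y \<in> S'" "S' \<in> C" for x y S S'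
    proof -
      have "S \<subseteq> S' \<or> S' \<subseteq> S" using C(2) that by (auto simp: subset_chain_def)
      then show ?thesis using that CA[of S] CA[of S'] by (auto simp: AA_def)
    qed
    moreover have "q \<in> S" "S \<subseteq> V" if "S \<in> C" for S using CA[OF that] by (auto simp: AA_def)
    ultimately show ?thesis using C(1) unfolding AA_def by blast
  qed
  ultimately obtain L where L: "L \<in> AA" "\<forall>S\<in>AA. L \<subseteq> S \<longrightarrow> S = L"
    using subset_Zorn_nonempty[of AA] by blast
  show thesis
  proof (rule that[of L])
    show "q \<in> L" "L \<subseteq> V" using L(1) by (auto simp: AA_def)
    fix x assume x: "x \<in> V"
    show "x \<in> L \<longleftrightarrow> (\<forall>y\<in>L. par x y \<in> \<int>)"
    proof
      assume "\<forall>y\<in>L. par x y \<in> \<int>"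
      moreover have "par y x \<in> \<int>" if "y \<in> L" "par x y \<in> \<int>" for y
        using that(2) par_swap[of y x] by simp
      ultimately have "insert x L \<in> AA" using L(1) x by (auto simp: AA_def par_self)
      then show "x \<in> L" using L(2) by blast
    qed (use L(1) in \<open>auto simp: AA_def\<close>)
  qed
qed

section \<open>The index of a maximal isotropic lattice\<close>

context
  fixes L :: "(nat \<Rightarrow> int) set"
  assumes LV: "L \<subseteq> V" and L_iff: "\<And>x. x \<in> V \<Longrightarrow> x \<in> L \<longleftrightarrow> (\<forall>y\<in>L. par x y \<in> \<int>)"
begin

lemma L_par: "x \<in> L \<Longrightarrow> y \<in> L \<Longrightarrow> par x y \<in> \<int>"
  using L_iff LV by blast

lemma L_par':
  assumes "x \<in> V" "\<And>y. y \<in> L \<Longrightarrow> par y x \<in> \<int>"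
  shows "x \<in> L"
proof -
  have "par x y \<in> \<int>" if "y \<in> L" for y
    unfolding par_swap[of x y] using assms(2)[OF that] by (rule Ints_minus)
  then show ?thesis using L_iff[OF assms(1)] by blast
qed

lemma L_diff: "x \<in> L \<Longrightarrow> y \<in> L \<Longrightarrow> (\<lambda>i. x i - y i) \<in> L"
  using LV L_par by (intro L_par' V_diff) (auto simp: par_diff_right)

lemma L_add: "x \<in> L \<Longrightarrow> y \<in> L \<Longrightarrow> (\<lambda>i. x i + y i) \<in> L"
  using LV L_par by (intro L_par' V_add) (auto simp: par_add_right)

lemma L_zero: "(\<lambda>i. 0) \<in> L"
  by (rule L_par') (auto simp: V_def par_def)

lemma L_Pm: "Pm u \<in> L"
  by (rule L_par'[OF V_Pm par_Pm])

lemma L_rep: "x \<in> L \<Longrightarrow> rep x \<in> L"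
  unfolding rep_def by (intro L_diff L_Pm)

text \<open>Translation by some \<open>y0\<close> for which \<open>par x y0\<close> is not an
  integer permutes the classes and multiplies every term by one complex number other than 1.\<close>

lemma character_sum_vanishes:
  assumes fin: "finite (rep ` L)" and x: "x \<in> V" "x \<notin> L"
  shows "(\<Sum>y\<in>rep ` L. cis (2 * pi * par x y)) = 0"
proof -
  obtain y0 where y0: "y0 \<in> L" "par x y0 \<notin> \<int>" using x L_iff by blast
  define s where "s y = rep (\<lambda>i. y i + y0 i)" for y
  have s: "s y \<in> rep ` L" if "y \<in> rep ` L" for y
    using that y0 L_add L_rep by (auto simp: s_def)
  have "inj_on s (rep ` L)"
  proof (rule inj_onI)
    fix y z assume yz: "y \<in> rep ` L" "z \<in> rep ` L" "s y = s z"
    obtain u where "\<And>i. y i + y0 i = (z i + y0 i) + Pm u i"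
      using rep_eqD[OF yz(3)[unfolded s_def]] by blast
    then have "y = (\<lambda>i. z i + Pm u i)" by (auto simp: fun_eq_iff algebra_simps)
    then have "rep y = rep z" using rep_add_Pm by simp
    then show "y = z" using yz(1,2) rep_rep by auto
  qed
  then have "bij_betw s (rep ` L) (rep ` L)"
    using endo_inj_surj[OF fin, of s] s by (auto simp: bij_betw_def)
  then have "(\<Sum>y\<in>rep ` L. cis (2 * pi * par x y)) = (\<Sum>y\<in>rep ` L. cis (2 * pi * par x (s y)))"
    by (rule sum.reindex_bij_betw[symmetric])
  also have "\<dots> = (\<Sum>y\<in>rep ` L. cis (2 * pi * par x y0) * cis (2 * pi * par x y))"
  proof (rule sum.cong[OF refl])
    fix y assume "y \<in> rep ` L"
    obtain m :: int where m: "par x (s y) - par x (\<lambda>i. y i + y0 i) = of_int m"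
      using par_rep[of x "\<lambda>i. y i + y0 i"] by (auto simp: s_def elim: Ints_cases)
    then have "2 * pi * par x (s y) = (2 * pi * par x y0 + 2 * pi * par x y) + 2 * pi * of_int m"
      by (simp add: par_add_right algebra_simps)
    then show "cis (2 * pi * par x (s y)) = cis (2 * pi * par x y0) * cis (2 * pi * par x y)"
      using cis_multiple_2pi[of "of_int m"] by (simp only: cis_mult[symmetric]) simp
  qed
  also have "\<dots> = cis (2 * pi * par x y0) * (\<Sum>y\<in>rep ` L. cis (2 * pi * par x y))"
    by (simp add: sum_distrib_left)
  finally have "(1 - cis (2 * pi * par x y0)) * (\<Sum>y\<in>rep ` L. cis (2 * pi * par x y)) = 0"
    by (simp add: algebra_simps)
  moreover have "cis (2 * pi * par x y0) \<noteq> 1"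
  proof
    assume "cis (2 * pi * par x y0) = 1"
    then obtain m :: int where "2 * pi * par x y0 = of_int m * 2 * pi"
      by (metis cis.sel(1) cos_one_2pi_int one_complex.sel(1))
    then have "par x y0 = of_int m" by simp
    then show False using y0(2) by simp
  qed
  ultimately show ?thesis by simp
qed

text \<open>A set of pairwise incongruent vectors modulo \<open>L\<close> gives distinct characters of \<open>L / P\<int>\<^sup>k\<close>;
  comparing the trivial term with the full second moment of their sum bounds their number.\<close>

lemma incongruent_le_characters:
  assumes fin: "finite (rep ` L)" "finite T" and T: "T \<subseteq> V"
    and inc: "\<And>x y. x \<in> T \<Longrightarrow> y \<in> T \<Longrightarrow> (\<lambda>i. x i - y i) \<in> L \<Longrightarrow> x = y"
  shows "card T \<le> card (rep ` L)"
proof -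
  let ?J = "rep ` L"
  define S where "S y = (\<Sum>x\<in>T. cis (2 * pi * par x y))" for y
  have "(\<Sum>y\<in>?J. S y * cnj (S y)) = (\<Sum>y\<in>?J. \<Sum>x\<in>T. \<Sum>z\<in>T. cis (2 * pi * par (\<lambda>i. x i - z i) y))"
    unfolding S_def cnj_sum sum_product
    by (intro sum.cong refl) (simp add: cis_cnj cis_mult par_diff_left algebra_simps)
  also have "\<dots> = (\<Sum>x\<in>T. \<Sum>y\<in>?J. \<Sum>z\<in>T. cis (2 * pi * par (\<lambda>i. x i - z i) y))" by (rule sum.swap)
  also have "\<dots> = (\<Sum>x\<in>T. \<Sum>z\<in>T. \<Sum>y\<in>?J. cis (2 * pi * par (\<lambda>i. x i - z i) y))"
    by (intro sum.cong refl sum.swap)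
  also have "\<dots> = (\<Sum>x\<in>T. \<Sum>z\<in>T. if x = z then of_nat (card ?J) else 0)"
  proof (intro sum.cong refl)
    fix x z assume xz: "x \<in> T" "z \<in> T"
    show "(\<Sum>y\<in>?J. cis (2 * pi * par (\<lambda>i. x i - z i) y)) = (if x = z then of_nat (card ?J) else 0)"
    proof (cases "x = z")
      case True
      then show ?thesis by (simp add: par_def)
    next
      case False
      then have "(\<lambda>i. x i - z i) \<notin> L" using inc[OF xz] by blast
      moreover have "(\<lambda>i. x i - z i) \<in> V" using T xz by (intro V_diff) auto
      ultimately show ?thesis using character_sum_vanishes[OF fin(1)] False by simp
    qed
  qed
  also have "\<dots> = of_nat (card T * card ?J)" using fin by simp
  finally have eq: "(\<Sum>y\<in>?J. S y * cnj (S y)) = of_nat (card T * card ?J)" .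
  have "(\<Sum>y\<in>?J. S y * cnj (S y)) = of_real (\<Sum>y\<in>?J. (cmod (S y))\<^sup>2)"
    by (simp only: of_real_sum complex_norm_square)
  with eq have "complex_of_real (\<Sum>y\<in>?J. (cmod (S y))\<^sup>2) = complex_of_real (real (card T * card ?J))" by simp
  then have "(\<Sum>y\<in>?J. (cmod (S y))\<^sup>2) = real (card T * card ?J)" by (simp only: of_real_eq_iff)
  moreover have "(cmod (S (\<lambda>i. 0)))\<^sup>2 \<le> (\<Sum>y\<in>?J. (cmod (S y))\<^sup>2)"
    using L_zero rep_zero fin(1) by (intro member_le_sum) (auto intro!: image_eqI[of _ _ "\<lambda>i. 0"])
  moreover have "S (\<lambda>i. 0) = of_nat (card T)" by (simp add: S_def par_def)
  ultimately have "real (card T) ^ 2 \<le> real (card T * card ?J)" by simp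
  then show ?thesis by (cases "card T = 0") (auto simp: power2_eq_square)
qed

text \<open>The number of classes modulo \<open>L\<close> is at most the order of \<open>L\<close>
  modulo the columns of \<open>P\<close>, by \<open>incongruent_le_characters\<close>. Their product
  is at most the number of all classes, since sums of an element of \<open>T\<close> and a
  representative from \<open>L\<close> are pairwise incongruent.\<close>

lemma incongruent_square_le:
  assumes fin: "finite (rep ` V)" "finite T" and T: "T \<subseteq> V"
    and inc: "\<And>x y. x \<in> T \<Longrightarrow> y \<in> T \<Longrightarrow> (\<lambda>i. x i - y i) \<in> L \<Longrightarrow> x = y"
  shows "(card T)\<^sup>2 \<le> card (rep ` V)"
proof -
  have finJ: "finite (rep ` L)" using fin(1) LV by (meson finite_subset image_mono)
  have "card T \<le> card (rep ` L)" by (rule incongruent_le_characters[OF finJ fin(2) T inc])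
  then have "(card T)\<^sup>2 \<le> card T * card (rep ` L)" by (simp add: power2_eq_square)
  also have "\<dots> = card (T \<times> rep ` L)" by (simp add: card_cartesian_product)
  also have "\<dots> \<le> card (rep ` V)"
  proof (rule card_inj_on_le[of "\<lambda>(x, y). rep (\<lambda>i. x i + y i)"])
    show "inj_on (\<lambda>(x, y). rep (\<lambda>i. x i + y i)) (T \<times> rep ` L)"
    proof (rule inj_onI, clarsimp)
      fix x x' y y' assume x: "x \<in> T" "x' \<in> T" and y: "y \<in> L" "y' \<in> L"
        and eq: "rep (\<lambda>i. x i + rep y i) = rep (\<lambda>i. x' i + rep y' i)"
      obtain u where u: "\<And>i. x i + rep y i = (x' i + rep y' i) + Pm u i" using rep_eqD[OF eq] by blast
      have "(\<lambda>i. (rep y' i - rep y i) + Pm u i) \<in> L" by (intro L_add L_diff L_rep y L_Pm)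
      also have "(\<lambda>i. (rep y' i - rep y i) + Pm u i) = (\<lambda>i. x i - x' i)"
        using u by (auto simp: fun_eq_iff algebra_simps)
      finally have "x = x'" using inc[OF x] by blast
      then have "rep y = (\<lambda>i. rep y' i + Pm u i)" using u by (auto simp: fun_eq_iff algebra_simps)
      then have "rep (rep y) = rep (rep y')" using rep_add_Pm by simp
      with \<open>x = x'\<close> show "x = x' \<and> rep y = rep y'" by (simp add: rep_rep)
    qed
    show "(\<lambda>(x, y). rep (\<lambda>i. x i + y i)) ` (T \<times> rep ` L) \<subseteq> rep ` V"
      using T LV L_rep by (fastforce simp: V_def)
  qed fact
  finally show ?thesis .
qed

text \<open>The box falls into at most \<open>card T\<close> classes modulo \<open>L\<close>, and
  subtracting a fixed member of a class maps it injectively to points of \<open>L\<close> with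
  entries bounded by \<open>M\<close>. Both sides are squared because only the square of
  \<open>card T\<close> is bounded.\<close>

lemma box_points_lower_bound:
  assumes fin: "finite (rep ` V)" and M: "M \<ge> (0::int)"
  shows "((nat M + 1) ^ k)\<^sup>2 \<le> (card {q \<in> L. \<forall>i<k. \<bar>q i\<bar> \<le> M})\<^sup>2 * card (rep ` V)"
proof -
  define Q where "Q = {q \<in> L. \<forall>i<k. \<bar>q i\<bar> \<le> M}"
  define B where "B = {x \<in> V. \<forall>i<k. 0 \<le> x i \<and> x i \<le> M}"
  have "finite {x. (\<forall>i\<ge>k. x i = 0) \<and> (\<forall>i<k. real_of_int \<bar>x i\<bar> \<le> real_of_int M)}"
    by (rule finite_bounded_int_vectors)
  then have finb: "finite {x \<in> V. \<forall>i<k. \<bar>x i\<bar> \<le> M}"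
    by (rule rev_finite_subset) (auto simp: V_def)
  have finQ: "finite Q" using finb LV by (rule_tac finite_subset[OF _ finb]) (auto simp: Q_def)
  have finB: "finite B" by (rule finite_subset[OF _ finb]) (auto simp: B_def)
  have cardB: "card B = (nat M + 1) ^ k"
  proof -
    have "bij_betw (\<lambda>x. restrict x {..<k}) B (PiE {..<k} (\<lambda>_. {0..M}))"
    proof (rule bij_betw_byWitness[where f' = "\<lambda>x i. if i < k then x i else 0"])
      show "\<forall>x\<in>B. (\<lambda>i. if i < k then restrict x {..<k} i else 0) = x"
        by (auto simp: B_def V_def fun_eq_iff)
      show "\<forall>x\<in>PiE {..<k} (\<lambda>_. {0..M}). restrict (\<lambda>i. if i < k then x i else 0) {..<k} = x"
        by (intro ballI ext) (auto simp: PiE_iff extensional_def restrict_def)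
      show "(\<lambda>x. restrict x {..<k}) ` B \<subseteq> PiE {..<k} (\<lambda>_. {0..M})"
        by (intro image_subsetI restrict_PiE_iff[THEN iffD2]) (auto simp: B_def)
      show "(\<lambda>x i. if i < k then x i else 0) ` PiE {..<k} (\<lambda>_. {0..M}) \<subseteq> B"
      proof (rule image_subsetI)
        fix x assume x: "x \<in> PiE {..<k} (\<lambda>_. {0..M})"
        have "0 \<le> x i" "x i \<le> M" if "i < k" for i using PiE_mem[OF x, of i] that by auto
        then show "(\<lambda>i. if i < k then x i else 0) \<in> B" by (simp add: B_def V_def)
      qed
    qed
    then have "card B = card (PiE {..<k} (\<lambda>_. {0..M}))" by (rule bij_betw_same_card)
    also have "\<dots> = (nat M + 1) ^ k" using M by (simp add: card_PiE nat_add_distrib)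
    finally show ?thesis .
  qed
  \<comment> \<open>\<open>T\<close> will contain exactly one point of each class that meets the
    box.\<close>
  define cl where "cl x = {y \<in> B. (\<lambda>i. y i - x i) \<in> L}" for x
  obtain T where T: "T \<subseteq> B" "inj_on cl T" "cl ` B = cl ` T"
    using iffD1[OF subset_image_inj[of "cl ` B" cl B] order_refl] by (elim exE conjE)
  have finT: "finite T" using T(1) finB finite_subset by blast
  have BV: "B \<subseteq> V" by (auto simp: B_def)
  have "x = y" if "x \<in> T" "y \<in> T" "(\<lambda>i. x i - y i) \<in> L" for x y
  proof -
    have "cl x = cl y"
    proof (intro equalityI subsetI)
      fix z assume "z \<in> cl x"
      then have "(\<lambda>i. (z i - x i) + (x i - y i)) \<in> L" using that(3) by (intro L_add) (auto simp: cl_def)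
      then show "z \<in> cl y" using \<open>z \<in> cl x\<close> by (simp add: cl_def)
    next
      fix z assume "z \<in> cl y"
      then have "(\<lambda>i. (z i - y i) - (x i - y i)) \<in> L" using that(3) by (intro L_diff[of "\<lambda>i. z i - y i"]) (auto simp: cl_def)
      then show "z \<in> cl x" using \<open>z \<in> cl y\<close> by (simp add: cl_def)
    qed
    then show ?thesis using T(2) that by (auto dest: inj_onD)
  qed
  then have cT: "(card T)\<^sup>2 \<le> card (rep ` V)"
    using T(1) BV by (intro incongruent_square_le[OF fin finT]) auto
  have "B \<subseteq> (\<Union>x\<in>T. cl x)"
  proof
    fix x assume x: "x \<in> B"
    then have "x \<in> cl x" using L_zero by (simp add: cl_def)
    moreover obtain t where "t \<in> T" "cl x = cl t" using T(3) x by blast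
    ultimately show "x \<in> (\<Union>x\<in>T. cl x)" by blast
  qed
  then have "card B \<le> card (\<Union>x\<in>T. cl x)"
    using finT finB by (intro card_mono) (auto simp: cl_def)
  also have "\<dots> \<le> (\<Sum>x\<in>T. card (cl x))" by (rule card_UN_le[OF finT])
  also have "\<dots> \<le> (\<Sum>x\<in>T. card Q)"
  proof (rule sum_mono)
    fix x assume x: "x \<in> T"
    show "card (cl x) \<le> card Q"
    proof (rule card_inj_on_le[of "\<lambda>y i. y i - x i"])
      show "inj_on (\<lambda>y i. y i - x i) (cl x)" by (auto simp: inj_on_def fun_eq_iff)
      show "(\<lambda>y i. y i - x i) ` cl x \<subseteq> Q"
      proof clarify
        fix y assume y: "y \<in> cl x"
        have "\<bar>y i - x i\<bar> \<le> M" if "i < k" for i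
        proof -
          have "0 \<le> y i" "y i \<le> M" "0 \<le> x i" "x i \<le> M"
            using y x T(1) that by (auto simp: cl_def B_def)
          then show ?thesis by linarith
        qed
        then show "(\<lambda>i. y i - x i) \<in> Q" using y by (simp add: Q_def cl_def)
      qed
    qed fact
  qed
  also have "\<dots> = card T * card Q" by simp
  finally have "card B \<le> card T * card Q" .
  then have "(card B)\<^sup>2 \<le> (card T * card Q)\<^sup>2" by (intro power_mono) auto
  also have "\<dots> = (card Q)\<^sup>2 * (card T)\<^sup>2" by (simp add: power_mult_distrib)
  also have "\<dots> \<le> (card Q)\<^sup>2 * card (rep ` V)" using cT by simp
  finally show ?thesis unfolding cardB Q_def .
qed

end

end

text \<open>A right inverse is found column by column, up to denominators; injectivity of
  \<open>P\<close> makes it a left inverse as well. That \<open>R\<close> is alternating follows by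
  evaluating the product of the transpose of \<open>R\<close> with \<open>P\<close> and
  \<open>R\<close> in two ways.\<close>

lemma nondegenerate_alternating_exists:
  fixes P :: "nat \<Rightarrow> nat \<Rightarrow> int"
  assumes alt: "\<And>i j. i < k \<Longrightarrow> j < k \<Longrightarrow> P i j = - P j i"
    and inj: "\<And>(z :: nat \<Rightarrow> real) j. (\<forall>i<k. (\<Sum>j<k. P i j * z j) = 0) \<Longrightarrow> j < k \<Longrightarrow> z j = 0"
  shows "\<exists>R. nondegenerate_alternating k P R"
proof -
  have "\<exists>z :: nat \<Rightarrow> real. \<forall>i<k. (\<Sum>l<k. P i l * z l) = (if i = j then 1 else 0)" if j: "j < k" for j
  proof -
    have "card {..<k} < card {..k}" by simp
    from homogeneous_system_nontrivial_solution[OF _ _ this,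
        of "\<lambda>i l. if l < k then P i l else if i = j then -1 else 0"]
    obtain y where y: "\<exists>l\<in>{..k}. y l \<noteq> 0"
      and y0: "\<forall>i\<in>{..<k}. (\<Sum>l\<le>k. (if l < k then P i l else if i = j then -1 else 0) * y l) = 0" by auto
    have eq: "(\<Sum>l<k. P i l * y l) = (if i = j then y k else 0)" if "i < k" for i
    proof -
      have "0 = (\<Sum>l\<le>k. (if l < k then P i l else if i = j then -1 else 0) * y l)" using y0 that by simp
      also have "\<dots> = (\<Sum>l<k. P i l * y l) + (if i = j then -1 else 0) * y k"
        by (simp add: lessThan_Suc_atMost[symmetric])
      finally show ?thesis by (auto split: if_splits)
    qed
    have eqr: "(\<Sum>l<k. P i l * real_of_int (y l)) = (if i = j then real_of_int (y k) else 0)" if "i < k" for i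
      using arg_cong[OF eq[OF that], of real_of_int] by simp
    have "y k \<noteq> 0"
    proof
      assume 0: "y k = 0"
      have "y l = 0" if "l < k" for l using inj[of "\<lambda>l. real_of_int (y l)" l] eqr 0 that by simp
      then show False using y 0 by (metis atMost_iff le_neq_implies_less)
    qed
    then show ?thesis using eqr
      by (intro exI[of _ "\<lambda>l. y l / y k"]) (simp add: sum_divide_distrib[symmetric])
  qed
  then have "\<forall>j. \<exists>z :: nat \<Rightarrow> real. j < k \<longrightarrow> (\<forall>i<k. (\<Sum>l<k. P i l * z l) = (if i = j then 1 else 0))" by blast
  then obtain z :: "nat \<Rightarrow> nat \<Rightarrow> real"
    where z: "\<And>i j. j < k \<Longrightarrow> i < k \<Longrightarrow> (\<Sum>l<k. P i l * z j l) = (if i = j then 1 else 0)"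
    by metis
  define R where "R i j = z j i" for i j
  have PR: "(\<Sum>l<k. P i l * R l j) = (if i = j then 1 else 0)" if "i < k" "j < k" for i j
    using z that by (simp add: R_def)
  have RP: "(\<Sum>l<k. R i l * P l j) = (if i = j then 1 else 0)" if i: "i < k" and j: "j < k" for i j
  proof -
    define w where "w a = (\<Sum>l<k. R a l * P l j) - (if a = j then 1 else 0)" for a
    have "(\<Sum>a<k. P b a * w a) = 0" if b: "b < k" for b
    proof -
      have "(\<Sum>a<k. P b a * (\<Sum>l<k. R a l * P l j)) = (\<Sum>a<k. \<Sum>l<k. P b a * R a l * P l j)"
        by (simp add: sum_distrib_left mult.assoc)
      also have "\<dots> = (\<Sum>l<k. \<Sum>a<k. P b a * R a l * P l j)" by (rule sum.swap)
      also have "\<dots> = (\<Sum>l<k. (if b = l then 1 else 0) * real_of_int (P l j))"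
        using PR[OF b] by (intro sum.cong refl) (simp add: sum_distrib_right[symmetric])
      also have "\<dots> = P b j" using b by (simp add: if_distrib[of "\<lambda>t. t * _"] cong: if_cong)
      finally have 1: "(\<Sum>a<k. P b a * (\<Sum>l<k. R a l * P l j)) = real_of_int (P b j)" .
      have 2: "(\<Sum>a<k. P b a * (if a = j then 1 else 0 :: real)) = real_of_int (P b j)"
        using j by (simp add: if_distrib[of "\<lambda>t. _ * t"] cong: if_cong)
      show ?thesis unfolding w_def right_diff_distrib sum_subtractf using 1 2 by simp
    qed
    then have "w i = 0" using inj[of w i] i by blast
    then show ?thesis by (simp add: w_def)
  qed
  have "R i j = - R j i" if i: "i < k" and j: "j < k" for i j
  proof -
    have "(\<Sum>a<k. \<Sum>b<k. R a i * P a b * R b j) = (\<Sum>a<k. R a i * (\<Sum>b<k. P a b * R b j))"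
      by (simp add: sum_distrib_left mult.assoc)
    also have "\<dots> = (\<Sum>a<k. R a i * (if a = j then 1 else 0))" using PR j by (intro sum.cong) auto
    also have "\<dots> = R j i" using j by (simp add: if_distrib[of "\<lambda>t. _ * t"] cong: if_cong)
    finally have 1: "(\<Sum>a<k. \<Sum>b<k. R a i * P a b * R b j) = R j i" .
    have "(\<Sum>a<k. \<Sum>b<k. R a i * P a b * R b j) = (\<Sum>b<k. \<Sum>a<k. R a i * P a b * R b j)" by (rule sum.swap)
    also have "\<dots> = (\<Sum>b<k. \<Sum>a<k. - (P b a * R a i) * R b j)"
    proof (intro sum.cong refl)
      fix a b assume "a \<in> {..<k}" "b \<in> {..<k}"
      then have "P a b = - P b a" using alt by blast
      then show "R a i * P a b * R b j = - (P b a * R a i) * R b j" by simp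
    qed
    also have "\<dots> = (\<Sum>b<k. - (\<Sum>a<k. P b a * R a i) * R b j)"
      by (simp only: sum_distrib_right[symmetric] sum_negf)
    also have "\<dots> = (\<Sum>b<k. - ((if b = i then 1 else 0) * R b j))" using PR i by (intro sum.cong) auto
    also have "\<dots> = - R i j" using i by (simp add: if_distrib[of "\<lambda>t. t * _"] sum_negf cong: if_cong)
    finally show ?thesis using 1 by simp
  qed
  then show ?thesis using PR RP by (intro exI[of _ R]) (unfold_locales; blast)
qed

subsection \<open>Many matrices of large corank\<close>

text \<open>Perturbations of \<open>T\<close> times the standard symplectic matrix.\<close>

definition block :: "int \<Rightarrow> (nat \<times> nat \<Rightarrow> int) \<Rightarrow> nat \<Rightarrow> nat \<Rightarrow> int" where
  "block T d i j =
     (if i < j then (if even i \<and> j = Suc i then T else 0) + d (i, j)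
      else if j < i then - ((if even j \<and> i = Suc j then T else 0) + d (j, i)) else 0)"

lemma block_alt: "block T d i j = - block T d j i"
  by (simp add: block_def)

text \<open>Diagonal dominance up to a permutation of the rows: at an index \<open>l\<close> where
  \<open>x\<close> is largest, row \<open>i\<close> has an entry of size at least
  \<open>T - m\<close> in column \<open>l\<close> and entries of size at most \<open>m\<close>
  elsewhere.\<close>

lemma block_invert_bound:
  fixes x :: "nat \<Rightarrow> real"
  assumes d: "\<And>i j. i < j \<Longrightarrow> j < k \<Longrightarrow> \<bar>d (i, j)\<bar> \<le> m" and k: "even k" and T: "int k * m < T" and m: "m \<ge> 0"
    and y: "\<And>i. i < k \<Longrightarrow> \<bar>\<Sum>j<k. block T d i j * x j\<bar> \<le> B" and j: "j < k"
  shows "\<bar>x j\<bar> * (T - int k * m) \<le> B"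
proof -
  have "finite ((\<lambda>j. \<bar>x j\<bar>) ` {..<k})" "(\<lambda>j. \<bar>x j\<bar>) ` {..<k} \<noteq> {}" using j by auto
  then obtain l where l: "l < k" and lmax: "\<And>j. j < k \<Longrightarrow> \<bar>x j\<bar> \<le> \<bar>x l\<bar>"
    using Max_in[of "(\<lambda>j. \<bar>x j\<bar>) ` {..<k}"] Max_ge[of "(\<lambda>j. \<bar>x j\<bar>) ` {..<k}"] by (smt (verit) imageE imageI lessThan_iff)
  \<comment> \<open>The partner of \<open>l\<close> in its block of size 2; it is below
    \<open>k\<close> because \<open>k\<close> is even.\<close>
  define i where "i = (if even l then Suc l else l - 1)"
  have i: "i < k"
  proof (cases "even l")
    case True
    then have "Suc l \<noteq> k" using k by auto
    then show ?thesis using True l by (simp add: i_def)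
  qed (use l in \<open>simp add: i_def\<close>)
  have il: "i \<noteq> l" unfolding i_def by (cases l) auto
  have big: "real_of_int \<bar>block T d i l\<bar> \<ge> T - m"
  proof (cases "even l")
    case True
    then have "block T d i l = - (T + d (l, i))" by (simp add: block_def i_def)
    moreover have "\<bar>d (l, i)\<bar> \<le> m" using d[of l i] True i by (simp add: i_def)
    ultimately show ?thesis by linarith
  next
    case False
    then obtain l' where l': "l = Suc l'" "even l'" by (cases l) auto
    then have "block T d i l = T + d (i, l)" using False by (simp add: block_def i_def)
    moreover have "\<bar>d (i, l)\<bar> \<le> m" using d[of i l] l' l by (simp add: i_def)
    ultimately show ?thesis by linarith
  qed
  have small: "real_of_int \<bar>block T d i j\<bar> \<le> m" if "j < k" "j \<noteq> l" for j
  proof -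
    have "\<bar>block T d i j\<bar> \<le> m"
    proof (cases "i < j")
      case True
      have "\<not> (even i \<and> j = Suc i)" using that(2) by (cases l) (auto simp: i_def split: if_splits)
      then show ?thesis using True d[of i j] that by (auto simp: block_def)
    next
      case False
      have "\<not> (even j \<and> i = Suc j)" using that(2) by (cases l) (auto simp: i_def split: if_splits)
      then show ?thesis using False d[of j i] i m by (auto simp: block_def)
    qed
    then show ?thesis by linarith
  qed
  define S where "S = (\<Sum>j\<in>{..<k} - {l}. block T d i j * x j)"
  have split: "(\<Sum>j<k. block T d i j * x j) = block T d i l * x l + S"
    unfolding S_def using l by (subst sum.remove[of "{..<k}" l]) auto
  have "\<bar>S\<bar> \<le> (\<Sum>j\<in>{..<k} - {l}. \<bar>block T d i j * x j\<bar>)" unfolding S_def by (rule sum_abs)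
  also have "\<dots> \<le> (\<Sum>j\<in>{..<k} - {l}. m * \<bar>x l\<bar>)"
  proof (rule sum_mono)
    fix j assume "j \<in> {..<k} - {l}"
    then show "\<bar>block T d i j * x j\<bar> \<le> m * \<bar>x l\<bar>"
      unfolding abs_mult using small[of j] lmax[of j] m by (intro mult_mono) auto
  qed
  also have "\<dots> = (real k - 1) * (m * \<bar>x l\<bar>)" using l by (simp add: of_nat_diff)
  finally have Sb: "\<bar>S\<bar> \<le> (real k - 1) * (m * \<bar>x l\<bar>)" .
  have "(T - m) * \<bar>x l\<bar> \<le> real_of_int \<bar>block T d i l\<bar> * \<bar>x l\<bar>" using big by (intro mult_right_mono) auto
  also have "\<dots> = \<bar>block T d i l * x l\<bar>" by (simp add: abs_mult)
  also have "\<dots> \<le> B + \<bar>S\<bar>" using y[OF i] split by linarith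
  finally have "\<bar>x l\<bar> * (T - int k * m) \<le> B" using Sb by (simp add: algebra_simps)
  moreover have "\<bar>x j\<bar> * (T - int k * m) \<le> \<bar>x l\<bar> * (T - int k * m)"
    using lmax[OF j] by (rule mult_right_mono) (subst of_int_0_le_iff, use T in linarith)
  ultimately show ?thesis by linarith
qed

section \<open>Bordering a nonsingular alternating matrix\<close>

text \<open>The Schur complement of the block \<open>P\<close> is \<open>D\<close> plus the values
  of the form given by the inverse of \<open>P\<close> on the columns \<open>q\<close>.\<close>

definition bordered :: "nat \<Rightarrow> nat \<Rightarrow> (nat \<Rightarrow> nat \<Rightarrow> int) \<Rightarrow> (nat \<Rightarrow> nat \<Rightarrow> int) \<Rightarrow> (nat \<Rightarrow> nat \<Rightarrow> int) \<Rightarrow> int mat" where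
  "bordered k r P q D = mat (k + r) (k + r) (\<lambda>(i, j).
     if i < k then (if j < k then P i j else q (j - k) i)
     else (if j < k then - q (i - k) j else D (i - k) (j - k)))"

lemma sum_split_at:
  fixes f :: "nat \<Rightarrow> 'a::comm_monoid_add"
  shows "(\<Sum>j<k + r. f j) = (\<Sum>j<k. f j) + (\<Sum>j<r. f (k + j))"
  by (induction r) (simp_all add: add.assoc)

text \<open>By the choice of \<open>D\<close> the Schur complement vanishes. Column \<open>l\<close>
  contributes the kernel vector whose first part solves \<open>P\<close> times \<open>y\<close> = -
  \<open>s\<close> times \<open>q l\<close> and whose second part is \<open>s\<close> at position
  \<open>l\<close>; the second parts form a diagonal matrix, so these vectors are
  independent.\<close>

lemma (in nondegenerate_alternating) bordered_corank:
  assumes q: "\<And>l. l < r \<Longrightarrow> q l \<in> V"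
    and D: "\<And>l l'. l < r \<Longrightarrow> l' < r \<Longrightarrow> real_of_int (D l l') = - par (q l) (q l')"
  defines "A \<equiv> bordered k r P q D"
  shows "\<exists>v. independent_family (k + r) r v \<and> (\<forall>l<r. \<forall>i<k + r. (\<Sum>j<k + r. A $$ (i, j) * v l j) = 0)"
proof -
  have "\<exists>y s. s \<noteq> 0 \<and> (\<forall>i<k. (\<Sum>j<k. P i j * y j) = - s * q l i)" if l: "l < r" for l
  proof -
    have "card {..<k} < card {..k}" by simp
    from homogeneous_system_nontrivial_solution[OF _ _ this, of "\<lambda>i j. if j < k then P i j else q l i"]
    obtain y where y: "\<exists>l\<in>{..k}. y l \<noteq> 0"
      and y0: "\<forall>i\<in>{..<k}. (\<Sum>j\<le>k. (if j < k then P i j else q l i) * y j) = 0" by auto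
    have eq: "(\<Sum>j<k. P i j * y j) = - y k * q l i" if "i < k" for i
    proof -
      have "0 = (\<Sum>j\<le>k. (if j < k then P i j else q l i) * y j)" using y0 that by simp
      also have "\<dots> = (\<Sum>j<k. P i j * y j) + q l i * y k"
        by (simp add: lessThan_Suc_atMost[symmetric])
      finally show ?thesis by (simp add: algebra_simps)
    qed
    have "y k \<noteq> 0"
    proof
      assume 0: "y k = 0"
      have "Pm y = (\<lambda>i. 0)" using eq 0 by (auto simp: Pm_def)
      then have "y j = 0" if "j < k" for j using Rm_Pm[OF that, of y] by (simp add: Rm_def)
      then show False using y 0 by (metis atMost_iff le_neq_implies_less)
    qed
    then show ?thesis using eq by blast
  qed
  then have "\<forall>l. \<exists>y s. l < r \<longrightarrow> s \<noteq> 0 \<and> (\<forall>i<k. (\<Sum>j<k. P i j * y j) = - s * q l i)" by blast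
  then obtain y s where s: "\<And>l. l < r \<Longrightarrow> s l \<noteq> 0"
    and y: "\<And>l i. l < r \<Longrightarrow> i < k \<Longrightarrow> (\<Sum>j<k. P i j * y l j) = - s l * q l i" by metis
  define v where "v l j = (if j < k then y l j else if j = k + l then s l else 0)" for l j
  have yR: "real_of_int (y l j) = - s l * Rm (q l) j" if l: "l < r" and j: "j < k" for l j
  proof -
    have "Pm (y l) = (\<lambda>i. - s l * q l i)"
      using y[OF l] q[OF l] by (auto simp: Pm_def V_def fun_eq_iff)
    then have "real_of_int (y l j) = Rm (\<lambda>i. - s l * q l i) j" using Rm_Pm[OF j, of "y l"] by simp
    also have "\<dots> = - s l * Rm (q l) j" by (simp add: Rm_def sum_distrib_left sum_negf algebra_simps)
    finally show ?thesis .
  qed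
  have vsum: "(\<Sum>j<k + r. f j * v l j) = (\<Sum>j<k. f j * y l j) + f (k + l) * s l" if "l < r" for f l
  proof -
    have "(\<Sum>j<r. f (k + j) * v l (k + j)) = (\<Sum>j<r. if j = l then f (k + j) * s l else 0)"
      by (intro sum.cong) (auto simp: v_def)
    also have "\<dots> = f (k + l) * s l" using that by simp
    finally show ?thesis unfolding sum_split_at by (simp add: v_def)
  qed
  have ker: "(\<Sum>j<k + r. A $$ (i, j) * v l j) = 0" if l: "l < r" and i: "i < k + r" for l i
  proof (cases "i < k")
    case True
    have "(\<Sum>j<k + r. A $$ (i, j) * v l j) = (\<Sum>j<k. P i j * y l j) + q l i * s l"
      unfolding vsum[OF l] using True l by (simp add: A_def bordered_def)
    then show ?thesis using y[OF l True] by simp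
  next
    case False
    have eq: "(\<Sum>j<k + r. A $$ (i, j) * v l j) = (\<Sum>j<k. - q (i - k) j * y l j) + D (i - k) l * s l"
      unfolding vsum[OF l] using False i l by (simp add: A_def bordered_def)
    have "real_of_int ((\<Sum>j<k. - q (i - k) j * y l j) + D (i - k) l * s l) =
        (\<Sum>j<k. - q (i - k) j * real_of_int (y l j)) + D (i - k) l * s l" by simp
    also have "(\<Sum>j<k. - q (i - k) j * real_of_int (y l j)) = (\<Sum>j<k. s l * (q (i - k) j * Rm (q l) j))"
      using yR[OF l] by (intro sum.cong) auto
    also have "\<dots> = s l * par (q (i - k)) (q l)" by (simp add: par_Rm sum_distrib_left)
    also have "\<dots> + D (i - k) l * s l = 0" using D[of "i - k" l] False i l by simp
    finally show ?thesis unfolding eq by linarith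
  qed
  have "independent_family (k + r) r v" unfolding independent_family_def
  proof (intro allI impI)
    fix c l assume c: "\<forall>i<k + r. (\<Sum>l<r. c l * v l i) = 0" and l: "l < r"
    have "(\<Sum>l'<r. c l' * v l' (k + l)) = (\<Sum>l'<r. if l' = l then c l * s l else 0)"
      by (intro sum.cong) (auto simp: v_def)
    also have "\<dots> = c l * s l" using l by simp
    finally have "c l * s l = 0" using c l by simp
    then show "c l = 0" using s[OF l] by simp
  qed
  then show ?thesis using ker by blast
qed

section \<open>Counting alternating matrices of given corank\<close>

definition singular_matrices :: "nat \<Rightarrow> nat \<Rightarrow> real \<Rightarrow> int mat set" where
  "singular_matrices n r X = {A \<in> alt_matrices n X. \<exists>v. independent_family n r v \<and>
     (\<forall>l<r. \<forall>i<n. (\<Sum>j<n. A $$ (i, j) * v l j) = 0)}"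

lemma alt_matrices_bij:
  assumes "X \<ge> 0"
  shows "bij_betw (\<lambda>d. mat n n (\<lambda>(i, j). if i < j then d (i, j) else if j < i then - d (j, i) else (0::int)))
    (PiE (pairs n) (\<lambda>_. {- \<lfloor>X\<rfloor>..\<lfloor>X\<rfloor>})) (alt_matrices n X)" (is "bij_betw ?F ?D _")
proof (rule bij_betw_byWitness[where f' = "\<lambda>A. restrict (\<lambda>(i, j). A $$ (i, j)) (pairs n)"])
  show "\<forall>d\<in>?D. restrict (\<lambda>(i, j). ?F d $$ (i, j)) (pairs n) = d"
  proof (intro ballI ext)
    fix d :: "nat \<times> nat \<Rightarrow> int" and p :: "nat \<times> nat" assume d: "d \<in> ?D"
    obtain i j where p: "p = (i, j)" by (cases p)
    show "restrict (\<lambda>(i, j). ?F d $$ (i, j)) (pairs n) p = d p"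
    proof (cases "p \<in> pairs n")
      case True
      then show ?thesis by (simp add: p pairs_def)
    next
      case False
      then show ?thesis using PiE_arb[OF d False] by simp
    qed
  qed
  show "\<forall>A\<in>alt_matrices n X. ?F (restrict (\<lambda>(i, j). A $$ (i, j)) (pairs n)) = A"
  proof
    fix A assume A: "A \<in> alt_matrices n X"
    show "?F (restrict (\<lambda>(i, j). A $$ (i, j)) (pairs n)) = A"
    proof (rule eq_matI)
      fix i j assume "i < dim_row A" "j < dim_col A"
      then have ij: "i < n" "j < n" using A by (auto simp: alt_matrices_def)
      consider "i < j" | "j < i" | "i = j" by linarith
      then show "?F (restrict (\<lambda>(i, j). A $$ (i, j)) (pairs n)) $$ (i, j) = A $$ (i, j)"
      proof cases
        case 2
        then show ?thesis using ij alt_matricesD(1)[OF A ij] by (simp add: pairs_def)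
      next
        case 3
        then show ?thesis using ij A by (simp add: alt_matrices_def)
      qed (use ij in \<open>simp add: pairs_def\<close>)
    qed (use A in \<open>auto simp: alt_matrices_def\<close>)
  qed
  show "?F ` ?D \<subseteq> alt_matrices n X"
  proof clarify
    fix d assume d: "d \<in> ?D"
    have b: "\<bar>real_of_int (d (i, j))\<bar> \<le> X" if "i < j" "j < n" for i j
    proof -
      have "d (i, j) \<in> {- \<lfloor>X\<rfloor>..\<lfloor>X\<rfloor>}" using d that by (auto simp: PiE_iff pairs_def)
      then have "\<bar>d (i, j)\<bar> \<le> \<lfloor>X\<rfloor>" by auto
      then show ?thesis by (simp add: le_floor_iff)
    qed
    show "?F d \<in> alt_matrices n X" unfolding alt_matrices_def
      using assms b by (auto intro!: eq_matI)
  qed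
  show "(\<lambda>A. restrict (\<lambda>(i, j). A $$ (i, j)) (pairs n)) ` alt_matrices n X \<subseteq> ?D"
  proof (intro image_subsetI restrict_PiE_iff[THEN iffD2] ballI)
    fix A p assume A: "A \<in> alt_matrices n X" and "p \<in> pairs n"
    then obtain i j where p: "p = (i, j)" "i < n" "j < n" by (auto simp: pairs_def)
    have "\<bar>A $$ (i, j)\<bar> \<le> \<lfloor>X\<rfloor>" using alt_matricesD(2)[OF A p(2,3)] by (simp add: le_floor_iff)
    then show "(case p of (i, j) \<Rightarrow> A $$ (i, j)) \<in> {- \<lfloor>X\<rfloor>..\<lfloor>X\<rfloor>}" using p by auto
  qed
qed

lemma card_alt_matrices:
  assumes "X \<ge> 1"
  shows "finite (alt_matrices n X)" "alt_matrices n X \<noteq> {}"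
    "X ^ card (pairs n) \<le> real (card (alt_matrices n X))"
    "real (card (alt_matrices n X)) \<le> (3 * X) ^ card (pairs n)"
proof -
  let ?D = "PiE (pairs n) (\<lambda>_. {- \<lfloor>X\<rfloor>..\<lfloor>X\<rfloor>})"
  obtain f where bij: "bij_betw f ?D (alt_matrices n X)" using alt_matrices_bij[of X n] assms by auto
  have fD: "finite ?D" by (intro finite_PiE) auto
  then show "finite (alt_matrices n X)" using bij bij_betw_finite by blast
  have cD: "card (alt_matrices n X) = card {- \<lfloor>X\<rfloor>..\<lfloor>X\<rfloor>} ^ card (pairs n)"
    unfolding bij_betw_same_card[OF bij, symmetric] by (subst card_PiE) simp_all
  have fl: "\<lfloor>X\<rfloor> \<ge> 1" using assms by simp
  have "real (card {- \<lfloor>X\<rfloor>..\<lfloor>X\<rfloor>}) = 2 * of_int \<lfloor>X\<rfloor> + 1" using fl by simp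
  then have "X \<le> real (card {- \<lfloor>X\<rfloor>..\<lfloor>X\<rfloor>})" using fl by linarith
  then show "X ^ card (pairs n) \<le> real (card (alt_matrices n X))"
    unfolding cD of_nat_power using assms by (intro power_mono) auto
  show "real (card (alt_matrices n X)) \<le> (3 * X) ^ card (pairs n)"
    unfolding cD of_nat_power by (intro power_mono card_int_interval_le assms) auto
  have "0 < X ^ card (pairs n)" using assms by simp
  also have "\<dots> \<le> real (card (alt_matrices n X))" by fact
  finally show "alt_matrices n X \<noteq> {}" by auto
qed


lemma (in nondegenerate_alternating) isotropic_box_exists:
  assumes q: "q \<in> V" and P: "\<And>i j. i < k \<Longrightarrow> j < k \<Longrightarrow> real_of_int \<bar>P i j\<bar> \<le> X"
    and X: "real k * X \<ge> 1" and M: "M \<ge> (0::int)"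
  obtains Q where "Q \<subseteq> {x \<in> V. \<forall>i<k. \<bar>x i\<bar> \<le> M}"
    "\<And>x y. x \<in> insert q Q \<Longrightarrow> y \<in> insert q Q \<Longrightarrow> par x y \<in> \<int>"
    "(real_of_int M + 1) ^ (2 * k) \<le> (real (card Q))\<^sup>2 * (3 * (real k * X)) ^ k"
proof -
  obtain L where L: "q \<in> L" "L \<subseteq> V" "\<And>x. x \<in> V \<Longrightarrow> x \<in> L \<longleftrightarrow> (\<forall>y\<in>L. par x y \<in> \<int>)"
    using maximal_isotropic_exists[OF q] by blast
  define Q where "Q = {q \<in> L. \<forall>i<k. \<bar>q i\<bar> \<le> M}"
  have "((nat M + 1) ^ k)\<^sup>2 \<le> (card Q)\<^sup>2 * card (rep ` V)"
    unfolding Q_def by (rule box_points_lower_bound[OF L(2,3) card_rep_le(1)[OF P X] M])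
  then have "real (((nat M + 1) ^ k)\<^sup>2) \<le> real ((card Q)\<^sup>2 * card (rep ` V))" by (simp only: of_nat_le_iff)
  moreover have "real (((nat M + 1) ^ k)\<^sup>2) = (real_of_int M + 1) ^ (2 * k)"
    using M by (simp add: power_mult[symmetric] mult.commute algebra_simps)
  moreover have "real ((card Q)\<^sup>2 * card (rep ` V)) \<le> (real (card Q))\<^sup>2 * (3 * (real k * X)) ^ k"
    unfolding of_nat_mult of_nat_power by (intro mult_left_mono card_rep_le(2)[OF P X]) auto
  ultimately have "(real_of_int M + 1) ^ (2 * k) \<le> (real (card Q))\<^sup>2 * (3 * (real k * X)) ^ k" by linarith
  moreover have "par x y \<in> \<int>" if "x \<in> insert q Q" "y \<in> insert q Q" for x y
    using L that by (auto simp: Q_def)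
  ultimately show thesis using L(2) by (intro that[of Q]) (auto simp: Q_def)
qed

text \<open>With \<open>T\<close> about X/2 and \<open>k * m\<close> at most X/8, the margin
  \<open>T - k * m\<close> is at least X/4. Hence \<open>P\<close> is invertible, its entries are at
  most X, and on the box the form has values at most (X/8)^2 / (X/4), which is below X. The lower
  bound for X ensures \<open>m \<ge> 1\<close>. \<open>Q\<close> depends on \<open>d\<close> and
  \<open>q0\<close>, as the isotropic lattice is built around \<open>q0\<close>.\<close>

lemma bordered_extensions:
  assumes k: "even k" "k > 0" and X: "X \<ge> 8 * real k"
  defines "T \<equiv> \<lfloor>X / 2\<rfloor>" and "m \<equiv> \<lfloor>X / (8 * real k)\<rfloor>"
  defines "Bx \<equiv> {x. (\<forall>i\<ge>k. x i = 0) \<and> (\<forall>i<k. \<bar>x i\<bar> \<le> m)}"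
  assumes d: "d \<in> PiE (pairs k) (\<lambda>_. {- m..m})" and q0: "q0 \<in> Bx"
  shows "\<exists>Q. Q \<subseteq> Bx \<and> (X / (8 * real k)) ^ (2 * k) \<le> (real (card Q))\<^sup>2 * (3 * (real k * X)) ^ k \<and>
    (\<forall>f. (\<forall>l\<in>{1..<r}. f l \<in> Q) \<longrightarrow>
      (\<exists>D. bordered k r (block T d) (\<lambda>l. if l = 0 then q0 else f l) D \<in> singular_matrices (k + r) r X))"
proof -
  have m1: "m \<ge> 1" using X k by (simp add: m_def le_floor_iff field_simps)
  have mu: "real_of_int m \<le> X / (8 * real k)" and ml: "X / (8 * real k) \<le> real_of_int m + 1"
    unfolding m_def by linarith+
  have km: "real k * real_of_int m \<le> X / 8" using mult_left_mono[OF mu, of "real k"] k by (simp add: field_simps)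
  have k1: "real k \<ge> 1" using k by simp
  have X8: "X \<ge> 8" using X k1 by linarith
  have Tl: "real_of_int T \<ge> X / 2 - 1" and Tu: "real_of_int T \<le> X / 2" unfolding T_def by linarith+
  have Tkm: "X / 4 \<le> real_of_int (T - int k * m)" using Tl km X8 by simp
  then have Tpos: "0 < real_of_int (T - int k * m)" using X8 by linarith
  then have Tm: "int k * m < T" by (simp only: of_int_0_less_iff)
  have m8: "real_of_int m \<le> X / 8"
  proof -
    have "1 * real_of_int m \<le> real k * real_of_int m" using k1 m1 by (intro mult_right_mono) auto
    then show ?thesis using km by linarith
  qed
  have db: "\<bar>d (i, j)\<bar> \<le> m" if "i < j" "j < k" for i j
  proof -
    have "d (i, j) \<in> {- m..m}" using d that by (auto simp: PiE_iff pairs_def)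
    then show ?thesis by auto
  qed
  let ?P = "block T d"
  have Pb: "real_of_int \<bar>?P i j\<bar> \<le> X" if "i < k" "j < k" for i j
  proof -
    have T0: "T \<ge> 0" using Tl X8 by linarith
    have "\<bar>?P i j\<bar> \<le> T + m"
      using that db[of i j] db[of j i] T0 m1 by (auto simp: block_def)
    then have "real_of_int \<bar>?P i j\<bar> \<le> real_of_int (T + m)" by (simp only: of_int_le_iff)
    then show ?thesis using Tu m8 X8 by simp
  qed
  have inj: "z j = 0" if z: "\<forall>i<k. (\<Sum>j<k. ?P i j * z j) = 0" and j: "j < k" for z :: "nat \<Rightarrow> real" and j
  proof -
    have "\<bar>z j\<bar> * (T - int k * m) \<le> 0"
      by (rule block_invert_bound[where d = d and m = m, OF db k(1) Tm _ _ j]) (use z m1 in auto)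
    then show ?thesis using Tpos by (simp add: mult_le_0_iff)
  qed
  have "\<exists>R. nondegenerate_alternating k ?P R"
  proof (rule nondegenerate_alternating_exists)
    show "?P i j = - ?P j i" for i j by (rule block_alt)
    show "z j = 0" if "\<forall>i<k. (\<Sum>j<k. ?P i j * z j) = 0" "j < k" for z :: "nat \<Rightarrow> real" and j
      by (rule inj[OF that])
  qed
  then obtain R where "nondegenerate_alternating k ?P R" ..
  then interpret nondegenerate_alternating k ?P R .
  have q0V: "q0 \<in> V" using q0 by (auto simp: Bx_def V_def)
  have "1 * 8 \<le> real k * X" using k1 X8 by (intro mult_mono) auto
  then have kX: "real k * X \<ge> 1" by simp
  obtain Q where Q: "Q \<subseteq> {x \<in> V. \<forall>i<k. \<bar>x i\<bar> \<le> m}"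
    and Qpar: "\<And>x y. x \<in> insert q0 Q \<Longrightarrow> y \<in> insert q0 Q \<Longrightarrow> par x y \<in> \<int>"
    and Qcard: "(real_of_int m + 1) ^ (2 * k) \<le> (real (card Q))\<^sup>2 * (3 * (real k * X)) ^ k"
    using isotropic_box_exists[OF q0V Pb kX, of m] m1 by auto
  have parb: "\<bar>par x y\<bar> \<le> X" if x: "x \<in> insert q0 Q" and y: "y \<in> insert q0 Q" for x y
  proof -
    have xb: "\<bar>x i\<bar> \<le> m" "\<bar>y i\<bar> \<le> m" if "i < k" for i using x y Q q0 that by (auto simp: Bx_def)
    have Rb: "\<bar>Rm y j\<bar> * (T - int k * m) \<le> m" if "j < k" for j
    proof (rule block_invert_bound[where d = d and m = m, OF db k(1) Tm _ _ that])
      fix i assume "i < k"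
      then show "\<bar>\<Sum>j<k. ?P i j * Rm y j\<bar> \<le> m" using P_Rm[of i y] xb(2)[of i] by simp
    qed (use m1 in auto)
    have "\<bar>par x y\<bar> * (T - int k * m) \<le> (\<Sum>i<k. \<bar>x i * Rm y i\<bar>) * (T - int k * m)"
      unfolding par_Rm by (intro mult_right_mono sum_abs less_imp_le[OF Tpos])
    also have "\<dots> = (\<Sum>i<k. \<bar>x i\<bar> * (\<bar>Rm y i\<bar> * (T - int k * m)))"
      by (simp add: sum_distrib_right abs_mult mult.assoc)
    also have "\<dots> \<le> (\<Sum>i<k. real_of_int m * m)"
    proof (rule sum_mono)
      fix i assume "i \<in> {..<k}"
      then have "real_of_int \<bar>x i\<bar> \<le> real_of_int m" using xb(1)[of i] by (simp only: of_int_le_iff lessThan_iff)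
      then show "real_of_int \<bar>x i\<bar> * (\<bar>Rm y i\<bar> * (T - int k * m)) \<le> real_of_int m * m"
        using Rb[of i] \<open>i \<in> {..<k}\<close> m1 less_imp_le[OF Tpos] by (intro mult_mono mult_nonneg_nonneg) auto
    qed
    also have "\<dots> = (real k * m) * m" by simp
    also have "\<dots> \<le> (X / 8) * (X / 8)" using km m8 m1 X8 by (intro mult_mono) auto
    also have "\<dots> \<le> X * (X / 4)" using X8 by (simp add: mult_mono)
    also have "\<dots> \<le> X * (T - int k * m)" using Tkm X8 by (intro mult_left_mono) auto
    finally show ?thesis using Tpos by (simp only: mult_le_cancel_right)
  qed
  have "\<exists>D. bordered k r ?P (\<lambda>l. if l = 0 then q0 else f l) D \<in> singular_matrices (k + r) r X"
    if f: "\<forall>l\<in>{1..<r}. f l \<in> Q" for f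
  proof -
    define q where "q l = (if l = 0 then q0 else f l)" for l
    have q: "q l \<in> insert q0 Q" if "l < r" for l using f that by (auto simp: q_def)
    \<comment> \<open>The floor only changes the type: on \<open>insert q0 Q\<close> the form has
      integral values.\<close>
    define D where "D l l' = - \<lfloor>par (q l) (q l')\<rfloor>" for l l'
    have D: "real_of_int (D l l') = - par (q l) (q l')" if "l < r" "l' < r" for l l'
      using Qpar[OF q[OF that(1)] q[OF that(2)]] by (auto simp: D_def elim: Ints_cases)
    have qb: "\<bar>real_of_int (q l i)\<bar> \<le> X" if "l < r" "i < k" for l i
    proof -
      have "\<bar>q l i\<bar> \<le> m" using q[OF that(1)] Q q0 that(2) by (auto simp: Bx_def)
      then have "real_of_int \<bar>q l i\<bar> \<le> real_of_int m" by (simp only: of_int_le_iff)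
      then show ?thesis using m8 X8 by simp
    qed
    have Dalt: "D l l' = - D l' l" if "l < r" "l' < r" for l l'
    proof -
      have "real_of_int (D l l') = real_of_int (- D l' l)"
        using D[OF that] D[OF that(2,1)] par_swap[of "q l" "q l'"] by simp
      then show ?thesis by (simp only: of_int_eq_iff)
    qed
    let ?A = "bordered k r ?P q D"
    have "?A \<in> alt_matrices (k + r) X" unfolding alt_matrices_def
    proof (intro CollectI conjI allI impI)
      show "?A \<in> carrier_mat (k + r) (k + r)" by (simp add: bordered_def)
      show "transpose_mat ?A = - ?A"
      proof (rule eq_matI)
        fix i j assume "i < dim_row (- ?A)" "j < dim_col (- ?A)"
        then have ij: "i < k + r" "j < k + r" by (auto simp: bordered_def)
        then show "transpose_mat ?A $$ (i, j) = (- ?A) $$ (i, j)"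
          using block_alt[of T d j i] Dalt[of "j - k" "i - k"] by (simp add: bordered_def)
      qed (auto simp: bordered_def)
      show "?A $$ (i, i) = 0" if "i < k + r" for i
        using that Dalt[of "i - k" "i - k"] block_alt[of T d i i] by (simp add: bordered_def)
      show "\<bar>real_of_int (?A $$ (i, j))\<bar> \<le> X" if "i < k + r" "j < k + r" for i j
      proof -
        have "\<bar>real_of_int (D (i - k) (j - k))\<bar> \<le> X" if "\<not> i < k" "\<not> j < k"
        proof -
          have l: "i - k < r" "j - k < r" using that \<open>i < k + r\<close> \<open>j < k + r\<close> by auto
          show ?thesis unfolding D[OF l] using parb[OF q[OF l(1)] q[OF l(2)]] by simp
        qed
        then show ?thesis using that Pb[of i j] qb[of "j - k" i] qb[of "i - k" j]
          by (simp add: bordered_def)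
      qed
    qed
    moreover have "q l \<in> V" if "l < r" for l using q[OF that] q0V Q by auto
    ultimately have "?A \<in> singular_matrices (k + r) r X" unfolding singular_matrices_def
      using bordered_corank[of r q D] D by blast
    then show ?thesis unfolding q_def by blast
  qed
  moreover have "(X / (8 * real k)) ^ (2 * k) \<le> (real (card Q))\<^sup>2 * (3 * (real k * X)) ^ k"
    using Qcard ml X8 by (elim order_trans[rotated]) (intro power_mono; simp)
  moreover have "Q \<subseteq> Bx" using Q by (auto simp: Bx_def V_def)
  ultimately show ?thesis by blast
qed


text \<open>The free data are the perturbation \<open>d\<close>, the first column and
  \<open>r - 1\<close> further columns, with X^(k(k - 1)/2), X^k and X^((r - 1)k/2) choices up to
  constants; these exponents add up to k(k + r)/2. All the data can be read off the matrix.\<close>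

theorem card_singular_matrices_ge:
  assumes k: "even k" "k > 0" and r: "r \<ge> 1"
  shows "\<exists>c>0. \<forall>X\<ge>8 * real k.
    c * X powr (real (k + r) * real k / 2) \<le> real (card (singular_matrices (k + r) r X))"
proof -
  define a where "a = 1 / (8 * real k)"
  have a: "a > 0" using k by (simp add: a_def)
  \<comment> \<open>From the square root of the estimate (aX)^(2k) \<le> |Q|^2 (3kX)^k.\<close>
  define c1 where "c1 = a ^ k / (3 * real k) powr (real k / 2)"
  have c1: "c1 > 0" using a k by (simp add: c1_def)
  define c where "c = a ^ card (pairs k) * a ^ k * c1 ^ (r - 1)"
  have c: "c > 0" using a c1 by (simp add: c_def)
  show ?thesis
  proof (intro exI[of _ c] conjI allI impI c)
    fix X :: real assume X: "X \<ge> 8 * real k"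
    define T where "T = \<lfloor>X / 2\<rfloor>"
    define m where "m = \<lfloor>X / (8 * real k)\<rfloor>"
    define Bx where "Bx = {x :: nat \<Rightarrow> int. (\<forall>i\<ge>k. x i = 0) \<and> (\<forall>i<k. \<bar>x i\<bar> \<le> m)}"
    define E where "E = PiE (pairs k) (\<lambda>_. {- m..m})"
    have k1: "real k \<ge> 1" using k by simp
    have X0: "X > 0" using X k1 by linarith
    have m1: "m \<ge> 1" using X k by (simp add: m_def le_floor_iff field_simps)
    have ml: "a * X \<le> 2 * real_of_int m + 1"
      using m1 unfolding a_def m_def by (simp add: mult.commute) linarith
    define good where "good d q0 Q \<longleftrightarrow>
      Q \<subseteq> Bx \<and> (X / (8 * real k)) ^ (2 * k) \<le> (real (card Q))\<^sup>2 * (3 * (real k * X)) ^ k \<and>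
      (\<forall>f. (\<forall>l\<in>{1..<r}. f l \<in> Q) \<longrightarrow>
        (\<exists>D. bordered k r (block T d) (\<lambda>l. if l = 0 then q0 else f l) D \<in> singular_matrices (k + r) r X))"
      for d q0 and Q :: "(nat \<Rightarrow> int) set"
    \<comment> \<open>The further columns range over a set that depends on \<open>d\<close> and
      \<open>q0\<close>; fixing it here makes the index set \<open>F\<close> a dependent
      sum.\<close>
    define Q where "Q d q0 = (SOME Q. good d q0 Q)" for d q0
    have good: "good d q0 (Q d q0)" if "d \<in> E" "q0 \<in> Bx" for d q0
    proof -
      have "\<exists>Q. good d q0 Q" using that unfolding good_def E_def Bx_def T_def m_def
        by (rule bordered_extensions[OF k X])
      then show ?thesis unfolding Q_def by (rule someI_ex)
    qed
    have Q1: "Q d q0 \<subseteq> Bx"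
      and Q2: "(X / (8 * real k)) ^ (2 * k) \<le> (real (card (Q d q0)))\<^sup>2 * (3 * (real k * X)) ^ k"
      and Q3: "\<And>f. (\<forall>l\<in>{1..<r}. f l \<in> Q d q0) \<Longrightarrow>
        \<exists>D. bordered k r (block T d) (\<lambda>l. if l = 0 then q0 else f l) D \<in> singular_matrices (k + r) r X"
      if "d \<in> E" "q0 \<in> Bx" for d q0
      using good[OF that] unfolding good_def by (simp_all only: simp_thms)
    have finBx: "finite Bx"
      unfolding Bx_def using finite_bounded_int_vectors[of k "real_of_int m"]
      by (rule rev_finite_subset) auto
    have cardBx: "(a * X) ^ k \<le> real (card Bx)"
    proof -
      have "inj_on (\<lambda>f i. if i < k then f i else 0 :: int) (PiE {..<k} (\<lambda>_. {- m..m}))"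
      proof (rule inj_onI)
        fix f g assume fg: "f \<in> PiE {..<k} (\<lambda>_. {- m..m})" "g \<in> PiE {..<k} (\<lambda>_. {- m..m})"
          and eq: "(\<lambda>i. if i < k then f i else 0) = (\<lambda>i. if i < k then g i else 0)"
        have "f i = g i" if "i \<in> {..<k}" for i using fun_cong[OF eq, of i] that by simp
        then show "f = g" using PiE_ext[OF fg] by blast
      qed
      moreover have "(\<lambda>f i. if i < k then f i else 0 :: int) ` PiE {..<k} (\<lambda>_. {- m..m}) \<subseteq> Bx"
      proof (rule image_subsetI)
        fix f assume f: "f \<in> PiE {..<k} (\<lambda>_. {- m..m})"
        have "\<bar>f i\<bar> \<le> m" if "i < k" for i using PiE_mem[OF f, of i] that by auto
        then show "(\<lambda>i. if i < k then f i else 0) \<in> Bx" by (simp add: Bx_def)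
      qed
      ultimately have "card (PiE {..<k} (\<lambda>_. {- m..m})) \<le> card Bx"
        using finBx by (rule card_inj_on_le)
      moreover have "card (PiE {..<k} (\<lambda>_. {- m..m})) = card {- m..m} ^ k" by (simp add: card_PiE)
      ultimately have "real (card {- m..m}) ^ k \<le> real (card Bx)"
        by (simp only: of_nat_le_iff of_nat_power[symmetric])
      moreover have "(a * X) ^ k \<le> real (card {- m..m}) ^ k"
        using ml m1 a X0 by (intro power_mono) auto
      ultimately show ?thesis by linarith
    qed
    have cardE: "(a * X) ^ card (pairs k) \<le> real (card E)"
    proof -
      have "real (card E) = real (card {- m..m}) ^ card (pairs k)" unfolding E_def
        by (subst card_PiE) simp_all
      then show ?thesis using ml m1 a X0 by (simp only:) (intro power_mono; auto)
    qed
    have half_power: "z ^ k = (z powr (real k / 2))\<^sup>2" if "z > 0" for z :: real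
      using that by (simp add: power2_eq_square powr_add[symmetric] powr_realpow[symmetric])
    have cardQ: "c1 * X powr (real k / 2) \<le> real (card (Q d q0))" if "d \<in> E" "q0 \<in> Bx" for d q0
    proof -
      have "((a * X) ^ k)\<^sup>2 = (X / (8 * real k)) ^ (2 * k)"
        by (simp add: a_def power_mult[symmetric] mult.commute)
      also have "\<dots> \<le> (real (card (Q d q0)))\<^sup>2 * (3 * (real k * X)) ^ k" by (rule Q2[OF that])
      also have "(3 * (real k * X)) ^ k = ((3 * (real k * X)) powr (real k / 2))\<^sup>2"
        using k X0 by (intro half_power) auto
      finally have "((a * X) ^ k)\<^sup>2 \<le> (real (card (Q d q0)) * (3 * (real k * X)) powr (real k / 2))\<^sup>2"
        by (simp add: power_mult_distrib)
      then have "(a * X) ^ k \<le> real (card (Q d q0)) * (3 * (real k * X)) powr (real k / 2)"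
        by (rule power2_le_imp_le) simp
      also have "(3 * (real k * X)) powr (real k / 2) = (3 * real k) powr (real k / 2) * X powr (real k / 2)"
        using X0 k powr_mult[of "3 * real k" X "real k / 2"] by (simp add: mult.assoc)
      finally have "a ^ k * X ^ k \<le> real (card (Q d q0)) * ((3 * real k) powr (real k / 2) * X powr (real k / 2))"
        by (simp add: power_mult_distrib)
      moreover have "X ^ k = X powr (real k / 2) * X powr (real k / 2)"
        using half_power[OF X0] by (simp add: power2_eq_square)
      ultimately have "(a ^ k * X powr (real k / 2)) * X powr (real k / 2) \<le>
          (real (card (Q d q0)) * (3 * real k) powr (real k / 2)) * X powr (real k / 2)"
        by (simp add: algebra_simps)
      then have "a ^ k * X powr (real k / 2) \<le> real (card (Q d q0)) * (3 * real k) powr (real k / 2)"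
        using X0 by simp
      then show ?thesis using k by (simp add: c1_def field_simps)
    qed
    define F where "F = (SIGMA d:E. SIGMA q0:Bx. PiE {1..<r} (\<lambda>_. Q d q0))"
    define Phi where "Phi = (\<lambda>(d, q0, f). SOME A. A \<in> singular_matrices (k + r) r X \<and>
        (\<exists>D. A = bordered k r (block T d) (\<lambda>l. if l = 0 then q0 else f l) D))"
    have Phi: "Phi (d, q0, f) \<in> singular_matrices (k + r) r X"
      "\<exists>D. Phi (d, q0, f) = bordered k r (block T d) (\<lambda>l. if l = 0 then q0 else f l) D"
      if "d \<in> E" "q0 \<in> Bx" "f \<in> PiE {1..<r} (\<lambda>_. Q d q0)" for d q0 f
    proof -
      have "\<forall>l\<in>{1..<r}. f l \<in> Q d q0" using that(3) by (auto simp: PiE_iff)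
      then have "\<exists>A. A \<in> singular_matrices (k + r) r X \<and>
        (\<exists>D. A = bordered k r (block T d) (\<lambda>l. if l = 0 then q0 else f l) D)"
        using Q3[OF that(1,2)] by blast
      from someI_ex[OF this] show "Phi (d, q0, f) \<in> singular_matrices (k + r) r X"
        "\<exists>D. Phi (d, q0, f) = bordered k r (block T d) (\<lambda>l. if l = 0 then q0 else f l) D"
        by (auto simp: Phi_def)
    qed
    have inj: "inj_on Phi F"
    proof (rule inj_onI)
      fix u u' assume u: "u \<in> F" "u' \<in> F" and eq: "Phi u = Phi u'"
      obtain d q0 f where u1: "u = (d, q0, f)" "d \<in> E" "q0 \<in> Bx" "f \<in> PiE {1..<r} (\<lambda>_. Q d q0)"
        using u(1) unfolding F_def by blast
      obtain d' q0' f' where u2: "u' = (d', q0', f')" "d' \<in> E" "q0' \<in> Bx" "f' \<in> PiE {1..<r} (\<lambda>_. Q d' q0')"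
        using u(2) unfolding F_def by blast
      obtain D where D: "Phi u = bordered k r (block T d) (\<lambda>l. if l = 0 then q0 else f l) D"
        using Phi(2)[OF u1(2-4)] u1(1) by blast
      obtain D' where D': "Phi u' = bordered k r (block T d') (\<lambda>l. if l = 0 then q0' else f' l) D'"
        using Phi(2)[OF u2(2-4)] u2(1) by blast
      have e: "bordered k r (block T d) (\<lambda>l. if l = 0 then q0 else f l) D $$ (i, j) =
          bordered k r (block T d') (\<lambda>l. if l = 0 then q0' else f' l) D' $$ (i, j)" for i j
        using eq D D' by simp
      \<comment> \<open>Above the diagonal, \<open>block\<close> is \<open>d\<close> plus a term
        that does not involve \<open>d\<close>.\<close>
      have "d p = d' p" if p: "p \<in> pairs k" for p
      proof -
        obtain i j where ij: "p = (i, j)" "i < j" "j < k" using p by (auto simp: pairs_def)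
        then show ?thesis using e[of i j] by (simp add: bordered_def block_def)
      qed
      then have dd: "d = d'" using u1(2) u2(2) unfolding E_def by (intro PiE_ext[of d _ _ d'])
      have qq: "(if l = 0 then q0 else f l) i = (if l = 0 then q0' else f' l) i" if "l < r" "i < k" for l i
        using e[of i "k + l"] that by (cases "l = 0") (simp_all add: bordered_def)
      have ext: "x = y" if "x \<in> Bx" "y \<in> Bx" "\<And>i. i < k \<Longrightarrow> x i = y i" for x y
      proof
        fix i show "x i = y i" using that by (cases "i < k") (auto simp: Bx_def)
      qed
      have q0q: "q0 = q0'" using qq[of 0] r u1(3) u2(3) by (intro ext) auto
      have "f l = f' l" if l: "l \<in> {1..<r}" for l
      proof (rule ext)
        show "f l \<in> Bx" using PiE_mem[OF u1(4) l] Q1[OF u1(2,3)] by blast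
        show "f' l \<in> Bx" using PiE_mem[OF u2(4) l] Q1[OF u2(2,3)] by blast
        show "f l i = f' l i" if "i < k" for i using qq[of l i] l that by simp
      qed
      then have "f = f'" using u1(4) u2(4) dd q0q by (intro PiE_ext[of f _ _ f']) auto
      then show "u = u'" using u1(1) u2(1) dd q0q by simp
    qed
    have "X \<ge> 1" using X k1 by linarith
    then have finS: "finite (singular_matrices (k + r) r X)"
      unfolding singular_matrices_def using card_alt_matrices(1)[of X "k + r"] by auto
    have "Phi ` F \<subseteq> singular_matrices (k + r) r X" using Phi(1) unfolding F_def by auto
    then have le: "card F \<le> card (singular_matrices (k + r) r X)"
      by (rule card_inj_on_le[OF inj _ finS])
    have finE: "finite E" unfolding E_def by (intro finite_PiE) auto
    have finQ: "finite (Q d q0)" if "d \<in> E" "q0 \<in> Bx" for d q0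
      using Q1[OF that] finBx by (rule finite_subset)
    have "real (card F) = (\<Sum>d\<in>E. \<Sum>q0\<in>Bx. real (card (Q d q0)) ^ (r - 1))"
    proof -
      have "card F = (\<Sum>d\<in>E. card (SIGMA q0:Bx. PiE {1..<r} (\<lambda>_. Q d q0)))"
        unfolding F_def using finE finBx finQ
        by (intro card_SigmaI) (auto intro!: finite_SigmaI finite_PiE)
      also have "\<dots> = (\<Sum>d\<in>E. \<Sum>q0\<in>Bx. card (PiE {1..<r} (\<lambda>_. Q d q0)))"
        using finBx finQ by (intro sum.cong refl card_SigmaI) (auto intro!: finite_PiE)
      also have "\<dots> = (\<Sum>d\<in>E. \<Sum>q0\<in>Bx. card (Q d q0) ^ (r - 1))"
        by (simp add: card_PiE)
      finally show ?thesis by simp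
    qed
    moreover have "(\<Sum>d\<in>E. \<Sum>q0\<in>Bx. (c1 * X powr (real k / 2)) ^ (r - 1)) \<le> (\<Sum>d\<in>E. \<Sum>q0\<in>Bx. real (card (Q d q0)) ^ (r - 1))"
      using cardQ c1 by (intro sum_mono power_mono) auto
    moreover have "(\<Sum>d\<in>E. \<Sum>q0\<in>Bx. (c1 * X powr (real k / 2)) ^ (r - 1)) = real (card E) * real (card Bx) * (c1 * X powr (real k / 2)) ^ (r - 1)"
      by simp
    moreover have "(a * X) ^ card (pairs k) * (a * X) ^ k * (c1 * X powr (real k / 2)) ^ (r - 1) \<le>
        real (card E) * real (card Bx) * (c1 * X powr (real k / 2)) ^ (r - 1)"
      using cardE cardBx a X0 c1 by (intro mult_right_mono mult_mono) auto
    ultimately have "(a * X) ^ card (pairs k) * (a * X) ^ k * (c1 * X powr (real k / 2)) ^ (r - 1) \<le>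
        real (card (singular_matrices (k + r) r X))" using le by linarith
    moreover have "(a * X) ^ card (pairs k) * (a * X) ^ k * (c1 * X powr (real k / 2)) ^ (r - 1) =
        c * X powr (real (k + r) * real k / 2)"
    proof -
      have "2 * card (pairs k) + k = k * k" by (rule card_pairs)
      then have "real (2 * card (pairs k) + k) = real (k * k)" by (simp only:)
      then have cp: "real (card (pairs k)) = (real k * real k - real k) / 2" by simp
      have "(X powr (real k / 2)) ^ (r - 1) = X powr (real k / 2 * real (r - 1))"
        using X0 by (simp only: powr_realpow[symmetric] powr_powr powr_gt_zero)
      then have "X ^ card (pairs k) * X ^ k * (X powr (real k / 2)) ^ (r - 1) =
          X powr (real (card (pairs k)) + real k + real k / 2 * real (r - 1))"
        using X0 by (simp only: powr_add powr_realpow)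
      also have "real (card (pairs k)) + real k + real k / 2 * real (r - 1) = real (k + r) * real k / 2"
        using r unfolding cp by (simp add: of_nat_diff field_simps)
      finally show ?thesis by (simp add: c_def power_mult_distrib algebra_simps)
    qed
    ultimately show "c * X powr (real (k + r) * real k / 2) \<le> real (card (singular_matrices (k + r) r X))" by simp
  qed
qed

subsection \<open>The law of the corank\<close>

definition rank_ge :: "nat \<Rightarrow> int mat set" where
  "rank_ge r = {A. r \<le> int_module_rank (dim_col A) (mat_kernel A)}"

lemma prob_rank_ge:
  assumes "X \<ge> 1"
  shows "measure_pmf.prob (pmf_of_set (alt_matrices n X)) (rank_ge r) =
    real (card (singular_matrices n r X)) / real (card (alt_matrices n X))"
proof -
  have "alt_matrices n X \<inter> rank_ge r = singular_matrices n r X"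
  proof (intro equalityI subsetI)
    fix A assume "A \<in> alt_matrices n X \<inter> rank_ge r"
    then show "A \<in> singular_matrices n r X"
      using int_kernel_rank_ge_iff[of A n r] by (auto simp: rank_ge_def singular_matrices_def alt_matrices_def)
  next
    fix A assume "A \<in> singular_matrices n r X"
    then show "A \<in> alt_matrices n X \<inter> rank_ge r"
      using int_kernel_rank_ge_iff[of A n r] by (auto simp: rank_ge_def singular_matrices_def alt_matrices_def)
  qed
  then show ?thesis using measure_pmf_of_set[OF card_alt_matrices(2,1)[OF assms]] by simp
qed

lemma card_pairs_real: "real (card (pairs n)) = real n * (real n - 1) / 2"
proof -
  have "real (2 * card (pairs n) + n) = real (n * n)" by (simp only: card_pairs)
  then show ?thesis by (simp add: algebra_simps)
qed

text \<open>The sample space has at least X^(n(n - 1)/2) elements, and 1 + n(n - r)/2 - n(n - 1)/2 =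
  1 - n(r - 1)/2.\<close>

lemma rank_prob_upper:
  "\<exists>K>0. \<forall>X\<ge>1. \<forall>r\<le>n. measure_pmf.prob (pmf_of_set (alt_matrices n X)) (rank_ge r)
     \<le> K * X powr (1 - real n * (real r - 1) / 2)"
proof -
  obtain K where K: "K > 0" and up: "\<And>X r. X \<ge> 1 \<Longrightarrow> r \<le> n \<Longrightarrow>
      real (card (singular_matrices n r X)) \<le> K * X powr (1 + real n * real (n - r) / 2)"
    using card_singular_alternating_le[of n] unfolding singular_matrices_def by blast
  show ?thesis
  proof (intro exI[of _ K] conjI allI impI K)
    fix X :: real and r assume X: "X \<ge> 1" and r: "r \<le> n"
    have pos: "0 < X ^ card (pairs n)" using X by simp
    have "measure_pmf.prob (pmf_of_set (alt_matrices n X)) (rank_ge r) \<le>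
        (K * X powr (1 + real n * real (n - r) / 2)) / X ^ card (pairs n)"
      unfolding prob_rank_ge[OF X] using up[OF X r] card_alt_matrices(3)[OF X, of n] pos K
      by (intro frac_le) auto
    also have "\<dots> = K * (X powr (1 + real n * real (n - r) / 2) / X powr real (card (pairs n)))"
      using X by (simp add: powr_realpow)
    also have "X powr (1 + real n * real (n - r) / 2) / X powr real (card (pairs n)) =
        X powr (1 + real n * real (n - r) / 2 - real (card (pairs n)))"
      by (simp add: powr_diff)
    also have "1 + real n * real (n - r) / 2 - real (card (pairs n)) = 1 - real n * (real r - 1) / 2"
      using r unfolding card_pairs_real by (simp add: of_nat_diff field_simps)
    finally show "measure_pmf.prob (pmf_of_set (alt_matrices n X)) (rank_ge r)
     \<le> K * X powr (1 - real n * (real r - 1) / 2)" .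
  qed
qed

text \<open>The parity condition reflects that alternating matrices have even rank;
  \<open>r < n\<close> keeps the nonsingular block nonempty.\<close>

lemma rank_prob_lower:
  assumes r: "1 \<le> r" "r < n" "even (n - r)"
  shows "\<exists>c>0. \<forall>X\<ge>8 * real n. c * X powr (- (real n * (real r - 1) / 2)) \<le>
    measure_pmf.prob (pmf_of_set (alt_matrices n X)) (rank_ge r)"
proof -
  have nr: "n - r + r = n" "n - r > 0" using r by auto
  obtain c where c: "c > 0" and lo: "\<And>X. X \<ge> 8 * real (n - r) \<Longrightarrow>
      c * X powr (real n * real (n - r) / 2) \<le> real (card (singular_matrices n r X))"
    using card_singular_matrices_ge[OF r(3) nr(2) r(1)] unfolding nr(1) by blast
  define c' where "c' = c / 3 ^ card (pairs n)"
  have c': "c' > 0" using c by (simp add: c'_def)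
  show ?thesis
  proof (intro exI[of _ c'] conjI allI impI c')
    fix X :: real assume X: "X \<ge> 8 * real n"
    have X1: "X \<ge> 1" using X r by linarith
    have X2: "X \<ge> 8 * real (n - r)" using X by (simp add: of_nat_diff r less_imp_le)
    have "- (real n * (real r - 1) / 2) = real n * real (n - r) / 2 - real (card (pairs n))"
      using r unfolding card_pairs_real by (simp add: of_nat_diff field_simps)
    then have "c' * X powr (- (real n * (real r - 1) / 2)) =
        c' * X powr (real n * real (n - r) / 2 - real (card (pairs n)))" by (simp only:)
    also have "\<dots> = (c * X powr (real n * real (n - r) / 2)) / (3 * X) ^ card (pairs n)"
      using X1 by (simp add: powr_diff powr_realpow c'_def power_mult_distrib)
    also have "\<dots> \<le> real (card (singular_matrices n r X)) / real (card (alt_matrices n X))"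
    proof (rule frac_le)
      have "0 < X ^ card (pairs n)" using X1 by simp
      then show "0 < real (card (alt_matrices n X))" using card_alt_matrices(3)[OF X1, of n] by linarith
    qed (use lo[OF X2] card_alt_matrices(4)[OF X1, of n] in auto)
    finally show "c' * X powr (- (real n * (real r - 1) / 2)) \<le>
      measure_pmf.prob (pmf_of_set (alt_matrices n X)) (rank_ge r)"
      unfolding prob_rank_ge[OF X1] .
  qed
qed

text \<open>One constant per size serves all coranks below it, as upper constant, as reciprocal of
  the lower constant and as threshold for X. Monotonicity and \<open>n \<le> K n\<close> prepare the
  slowing down of \<eta>: keeping \<open>K\<close> small for all admissible sizes then also bounds
  \<eta> itself.\<close>

theorem rank_prob_bounds:
  "\<exists>K :: nat \<Rightarrow> real. mono K \<and> (\<forall>n. real n \<le> K n \<and> 1 \<le> K n) \<and>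
     (\<forall>n X r. K n \<le> X \<longrightarrow> 1 \<le> r \<longrightarrow> r < n \<longrightarrow>
        measure_pmf.prob (pmf_of_set (alt_matrices n X)) (rank_ge r) \<le> K n * X powr (1 - real n * (real r - 1) / 2) \<and>
        (even (n - r) \<longrightarrow> X powr (- (real n * (real r - 1) / 2)) / K n \<le>
          measure_pmf.prob (pmf_of_set (alt_matrices n X)) (rank_ge r)))"
proof -
  let ?p = "\<lambda>n X r. measure_pmf.prob (pmf_of_set (alt_matrices n X)) (rank_ge r)"
  obtain U where U: "\<And>n. U n > 0" and up: "\<And>n X r. X \<ge> 1 \<Longrightarrow> r \<le> n \<Longrightarrow>
      ?p n X r \<le> U n * X powr (1 - real n * (real r - 1) / 2)"
    using rank_prob_upper by metis
  \<comment> \<open>The constants are needed as a function of all \<open>n\<close> and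
    \<open>r\<close>; where the conditions fail, any positive value does.\<close>
  have "\<forall>n r. \<exists>c>0. 1 \<le> r \<and> r < n \<and> even (n - r) \<longrightarrow>
      (\<forall>X\<ge>8 * real n. c * X powr (- (real n * (real r - 1) / 2)) \<le> ?p n X r)"
  proof (intro allI)
    fix n r
    show "\<exists>c>0. 1 \<le> r \<and> r < n \<and> even (n - r) \<longrightarrow>
      (\<forall>X\<ge>8 * real n. c * X powr (- (real n * (real r - 1) / 2)) \<le> ?p n X r)"
    proof (cases "1 \<le> r \<and> r < n \<and> even (n - r)")
      case True
      then show ?thesis using rank_prob_lower[of r n] by blast
    qed (auto intro: exI[of _ 1])
  qed
  then obtain c where c: "\<And>n r. c n r > 0" and lo: "\<And>n r X. 1 \<le> r \<Longrightarrow> r < n \<Longrightarrow> even (n - r) \<Longrightarrow>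
      X \<ge> 8 * real n \<Longrightarrow> c n r * X powr (- (real n * (real r - 1) / 2)) \<le> ?p n X r"
    by metis
  \<comment> \<open>The summands are the threshold for X in the lower bound, the upper constant, and
    the reciprocals of the lower constants.\<close>
  define K0 where "K0 n = 1 + 8 * real n + U n + (\<Sum>r<n. 1 / c n r)" for n
  define K where "K n = (\<Sum>i\<le>n. K0 i)" for n
  have sum0: "(\<Sum>r<n. 1 / c n r) \<ge> 0" for n using c by (intro sum_nonneg) (auto simp: less_imp_le)
  have K0: "K0 n \<ge> 1 + 8 * real n" "K0 n \<ge> U n" for n
    using U[of n] sum0[of n] unfolding K0_def by linarith+
  have K0c: "K0 n \<ge> 1 / c n r" if "r < n" for n r
  proof -
    have "1 / c n r \<le> (\<Sum>r<n. 1 / c n r)"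
      using that c by (intro member_le_sum) (auto simp: less_imp_le)
    then show ?thesis using U[of n] unfolding K0_def by simp
  qed
  have K0pos: "K0 n \<ge> 0" for n using K0(1)[of n] by linarith
  have KK0: "K n \<ge> K0 n" for n unfolding K_def using K0pos by (intro member_le_sum) auto
  have "mono K" unfolding mono_def K_def using K0pos by (intro allI impI sum_mono2) auto
  moreover have "real n \<le> K n \<and> 1 \<le> K n" for n using KK0[of n] K0(1)[of n] by linarith
  moreover have "?p n X r \<le> K n * X powr (1 - real n * (real r - 1) / 2) \<and>
      (even (n - r) \<longrightarrow> X powr (- (real n * (real r - 1) / 2)) / K n \<le> ?p n X r)"
    if X: "K n \<le> X" and r: "1 \<le> r" "r < n" for n X r
  proof (intro conjI impI)
    have X8: "X \<ge> 8 * real n" "X \<ge> 1" using X KK0[of n] K0(1)[of n] by linarith+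
    have "?p n X r \<le> U n * X powr (1 - real n * (real r - 1) / 2)" using up[of X r n] X8 r by simp
    also have "\<dots> \<le> K n * X powr (1 - real n * (real r - 1) / 2)"
      using KK0[of n] K0(2)[of n] by (intro mult_right_mono) auto
    finally show "?p n X r \<le> K n * X powr (1 - real n * (real r - 1) / 2)" .
    assume ev: "even (n - r)"
    have "1 / c n r \<le> K n" using K0c[OF r(2)] KK0[of n] by linarith
    then have "1 / K n \<le> c n r" using c[of n r] KK0[of n] K0(1)[of n] by (simp add: field_simps)
    then have "1 / K n * X powr (- (real n * (real r - 1) / 2)) \<le> c n r * X powr (- (real n * (real r - 1) / 2))"
      by (intro mult_right_mono) auto
    also have "\<dots> \<le> ?p n X r" using lo[OF r ev X8(1)] .
    finally show "X powr (- (real n * (real r - 1) / 2)) / K n \<le> ?p n X r" by simp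
  qed
  ultimately show ?thesis by (intro exI[of _ K]) blast
qed

text \<open>A half-open interval of length 2 contains exactly two integers. They are consecutive, so
  each parity is chosen with probability 1/2.\<close>

lemma matrix_pmf_prob:
  assumes \<eta>: "\<eta> H \<ge> 0" and X: "X H \<ge> 1"
  defines "m \<equiv> nat \<lceil>\<eta> H\<rceil>"
  shows "measure_pmf.prob (matrix_pmf \<eta> X H) R =
    (measure_pmf.prob (pmf_of_set (alt_matrices m (X H))) R +
     measure_pmf.prob (pmf_of_set (alt_matrices (Suc m) (X H))) R) / 2"
    "\<eta> H \<le> real m" "real (Suc m) < \<eta> H + 2"
proof -
  have m: "real m = of_int \<lceil>\<eta> H\<rceil>" using \<eta> unfolding m_def by (simp add: ceiling_mono)
  show 1: "\<eta> H \<le> real m" and 2: "real (Suc m) < \<eta> H + 2" using m by linarith+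
  have S: "{n :: nat. \<eta> H \<le> real n \<and> real n < \<eta> H + 2} = {m, Suc m}"
  proof (intro equalityI subsetI)
    fix n assume "n \<in> {n :: nat. \<eta> H \<le> real n \<and> real n < \<eta> H + 2}"
    then have n: "\<eta> H \<le> real n" "real n < \<eta> H + 2" by auto
    have "m \<le> n" unfolding m_def using n(1) by (simp add: ceiling_le_iff nat_le_iff)
    moreover have "real n < real m + 2" using n(2) 1 by linarith
    then have "n < m + 2" by linarith
    ultimately show "n \<in> {m, Suc m}" by auto
  qed (use 1 2 in auto)
  have fin: "finite (set_pmf (pmf_of_set (alt_matrices n (X H))))" for n
    using card_alt_matrices(1,2)[OF X, of n] by simp
  have "measure_pmf.prob (matrix_pmf \<eta> X H) R = measure_pmf.expectation (matrix_pmf \<eta> X H) (indicator R)"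
    by simp
  also have "\<dots> = (\<Sum>n\<in>{m, Suc m}. measure_pmf.expectation (pmf_of_set (alt_matrices n (X H))) (indicator R) /\<^sub>R real (card {m, Suc m}))"
    unfolding matrix_pmf_def S using fin by (subst pmf_expectation_bind_pmf_of_set) (auto simp: field_simps)
  also have "\<dots> = (measure_pmf.prob (pmf_of_set (alt_matrices m (X H))) R +
     measure_pmf.prob (pmf_of_set (alt_matrices (Suc m) (X H))) R) / 2"
    by (simp add: field_simps)
  finally show "measure_pmf.prob (matrix_pmf \<eta> X H) R =
    (measure_pmf.prob (pmf_of_set (alt_matrices m (X H))) R +
     measure_pmf.prob (pmf_of_set (alt_matrices (Suc m) (X H))) R) / 2" .
qed

subsection \<open>Counting curves by height\<close>

text \<open>The exponent is 1/3 + 1/2, from the bounds for \<open>A\<close> and for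
  \<open>B\<close>; each of the two intervals contributes a factor 3.\<close>

lemma curves_upto_le:
  assumes H: "H \<ge> 1"
  shows "finite (curves_upto H)" "real (card (curves_upto H)) \<le> 9 * H powr (5 / 6)"
proof -
  let ?a = "H powr (1 / 3)" and ?b = "H powr (1 / 2)"
  let ?S = "{- \<lfloor>?a\<rfloor>..\<lfloor>?a\<rfloor>} \<times> {- \<lfloor>?b\<rfloor>..\<lfloor>?b\<rfloor>}"
  have ab: "?a \<ge> 1" "?b \<ge> 1" using H by (auto simp: ge_one_powr_ge_zero)
  have root: "\<bar>x\<bar> \<le> \<lfloor>H powr (1 / real k)\<rfloor>" if "real_of_int \<bar>x\<bar> ^ k \<le> H" "k > 0" for x :: int and k
  proof (cases "x = 0")
    case False
    then have "real_of_int \<bar>x\<bar> = (real_of_int \<bar>x\<bar> ^ k) powr (1 / real k)"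
      using that(2) by (simp add: powr_realpow[symmetric] powr_powr)
    also have "\<dots> \<le> H powr (1 / real k)" using that by (intro powr_mono2) auto
    finally show ?thesis by (simp add: le_floor_iff)
  qed simp
  have sub: "curves_upto H \<subseteq> ?S"
  proof
    fix E assume E: "E \<in> curves_upto H"
    obtain A B where AB: "E = (A, B)" by (cases E)
    have h: "real_of_int (max \<bar>4 * A ^ 3\<bar> \<bar>27 * B ^ 2\<bar>) \<le> H" using E by (simp add: AB curves_upto_def height_def)
    have "real_of_int \<bar>4 * A ^ 3\<bar> \<le> real_of_int (max \<bar>4 * A ^ 3\<bar> \<bar>27 * B ^ 2\<bar>)"
      by (simp only: of_int_le_iff max.cobounded1)
    then have h1: "real_of_int \<bar>4 * A ^ 3\<bar> \<le> H" using h by linarith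
    have "real_of_int \<bar>27 * B ^ 2\<bar> \<le> real_of_int (max \<bar>4 * A ^ 3\<bar> \<bar>27 * B ^ 2\<bar>)"
      by (simp only: of_int_le_iff max.cobounded2)
    then have h2: "real_of_int \<bar>27 * B ^ 2\<bar> \<le> H" using h by linarith
    have "real_of_int \<bar>A\<bar> ^ 3 \<le> 4 * real_of_int \<bar>A\<bar> ^ 3" by simp
    also have "\<dots> \<le> H" using h1 by (simp add: abs_mult power_abs)
    finally have A: "\<bar>A\<bar> \<le> \<lfloor>?a\<rfloor>" using root[of A 3] by simp
    have "real_of_int \<bar>B\<bar> ^ 2 \<le> 27 * real_of_int \<bar>B\<bar> ^ 2" by simp
    also have "\<dots> \<le> H" using h2 by (simp add: abs_mult power_abs)
    finally have B: "\<bar>B\<bar> \<le> \<lfloor>?b\<rfloor>" using root[of B 2] by simp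
    show "E \<in> ?S" unfolding AB using A B by auto
  qed
  show "finite (curves_upto H)" by (rule finite_subset[OF sub]) simp
  have "card (curves_upto H) \<le> card ?S" by (intro card_mono sub) simp
  then have "real (card (curves_upto H)) \<le> real (card {- \<lfloor>?a\<rfloor>..\<lfloor>?a\<rfloor>}) * real (card {- \<lfloor>?b\<rfloor>..\<lfloor>?b\<rfloor>})"
    by (simp only: card_cartesian_product of_nat_mult[symmetric] of_nat_le_iff)
  also have "\<dots> \<le> (3 * ?a) * (3 * ?b)" using ab by (intro mult_mono card_int_interval_le) auto
  also have "\<dots> = 9 * H powr (5 / 6)" by (simp add: powr_add[symmetric])
  finally show "real (card (curves_upto H)) \<le> 9 * H powr (5 / 6)" .
qed

lemma card_multiples_le: "q > 0 \<Longrightarrow> card {x \<in> {1..a::nat}. q dvd x} \<le> a div q"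
proof -
  assume q: "q > 0"
  have "{x \<in> {1..a}. q dvd x} \<subseteq> (\<lambda>i. q * i) ` {1..a div q}"
  proof
    fix x assume "x \<in> {x \<in> {1..a}. q dvd x}"
    then obtain i where "x = q * i" "1 \<le> x" "x \<le> a" by (auto elim: dvdE)
    moreover from this q have "i \<le> a div q" by (simp add: less_eq_div_iff_mult_less_eq mult.commute)
    moreover have "i \<noteq> 0" using \<open>x = q * i\<close> \<open>1 \<le> x\<close> by auto
    ultimately show "x \<in> (\<lambda>i. q * i) ` {1..a div q}" by (intro image_eqI[of _ _ i]) auto
  qed
  then have "card {x \<in> {1..a}. q dvd x} \<le> card {1..a div q}" by (rule surj_card_le[rotated]) simp
  then show ?thesis by simp
qed

text \<open>The tenth power of \<open>p\<close> is at least \<open>4 * (p * (p - 1))\<close>, and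
  the reciprocals of \<open>p * (p - 1)\<close> telescope. Any bound below 1 would leave a positive
  proportion of pairs.\<close>

lemma sum_inverse_tenth_powers: "(\<Sum>p\<in>{2..a::nat}. 1 / real p ^ 10) \<le> 1 / 4"
proof -
  have tel: "(\<Sum>p\<in>{2..a::nat}. 1 / (real p * (real p - 1))) \<le> 1 - 1 / real a" if "a \<ge> 1" for a
    using that
  proof (induction a rule: dec_induct)
    case (step a)
    have "(\<Sum>p\<in>{2..Suc a}. 1 / (real p * (real p - 1))) =
        (\<Sum>p\<in>{2..a}. 1 / (real p * (real p - 1))) + 1 / (real (Suc a) * (real (Suc a) - 1))"
      using step by (simp add: atLeastAtMostSuc_conv)
    also have "\<dots> \<le> 1 - 1 / real a + 1 / (real (Suc a) * (real (Suc a) - 1))" using step by simp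
    also have "\<dots> = 1 - 1 / real (Suc a)"
    proof -
      have "real a + real a * real a > 0" using step.hyps by (intro add_pos_pos mult_pos_pos) auto
      then show ?thesis using step.hyps by (simp add: field_simps)
    qed
    finally show ?case .
  qed simp
  show ?thesis
  proof (cases "a \<ge> 1")
    case True
    have "(\<Sum>p\<in>{2..a}. 1 / real p ^ 10) \<le> (\<Sum>p\<in>{2..a}. 1 / 4 * (1 / (real p * (real p - 1))))"
    proof (rule sum_mono)
      fix p assume "p \<in> {2..a}"
      then have p: "real p \<ge> 2" by auto
      have "4 * (real p * (real p - 1)) \<le> 2 ^ 8 * real p ^ 2"
        using p by (simp add: power2_eq_square algebra_simps)
      also have "\<dots> \<le> real p ^ 8 * real p ^ 2" using p by (intro mult_right_mono power_mono) auto
      also have "\<dots> = real p ^ 10" by (simp add: power_add[symmetric])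
      finally have "1 / real p ^ 10 \<le> 1 / (4 * (real p * (real p - 1)))" using p by (intro divide_left_mono) auto
      then show "1 / real p ^ 10 \<le> 1 / 4 * (1 / (real p * (real p - 1)))" by simp
    qed
    also have "\<dots> = 1 / 4 * (\<Sum>p\<in>{2..a}. 1 / (real p * (real p - 1)))" by (simp only: sum_distrib_left)
    also have "\<dots> \<le> 1 / 4 * 1" using tel[OF True] by (intro mult_left_mono) (auto intro: order_trans)
    finally show ?thesis by simp
  qed simp
qed

text \<open>A union bound over all \<open>p \<ge> 2\<close>, prime or not: each excludes at most the
  proportion 1/p^10, and \<open>p \<le> p ^ 4 \<le> x\<close> makes the union finite.\<close>

lemma card_pairs_without_common_power:
  "real (card {(x, y) \<in> {1..a::nat} \<times> {1..b::nat}. \<not> (\<exists>p\<ge>2. p ^ 4 dvd x \<and> p ^ 6 dvd y)}) \<ge> 3 / 4 * (real a * real b)"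
proof -
  let ?G = "{(x, y) \<in> {1..a} \<times> {1..b}. \<not> (\<exists>p\<ge>2. p ^ 4 dvd x \<and> p ^ 6 dvd y)}"
  let ?B = "\<lambda>p. {x \<in> {1..a}. p ^ 4 dvd x} \<times> {y \<in> {1..b}. p ^ 6 dvd y}"
  have "{1..a} \<times> {1..b} \<subseteq> ?G \<union> (\<Union>p\<in>{2..a}. ?B p)"
  proof
    fix z assume "z \<in> {1..a} \<times> {1..b}"
    then obtain x y where z: "z = (x, y)" "x \<in> {1..a}" "y \<in> {1..b}" by auto
    show "z \<in> ?G \<union> (\<Union>p\<in>{2..a}. ?B p)"
    proof (cases "\<exists>p\<ge>2. p ^ 4 dvd x \<and> p ^ 6 dvd y")
      case True
      then obtain p where p: "p \<ge> 2" "p ^ 4 dvd x" "p ^ 6 dvd y" by blast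
      have "p \<le> p ^ 4" using p(1) by (intro self_le_power) auto
      also have "\<dots> \<le> x" using p(2) z(2) by (intro dvd_imp_le) auto
      finally have "p \<in> {2..a}" using p(1) z(2) by simp
      then show ?thesis using p z by auto
    qed (use z in auto)
  qed
  then have "card ({1..a} \<times> {1..b}) \<le> card (?G \<union> (\<Union>p\<in>{2..a}. ?B p))"
    by (intro card_mono) (auto intro: finite_subset[of _ "{1..a} \<times> {1..b}"])
  also have "\<dots> \<le> card ?G + card (\<Union>p\<in>{2..a}. ?B p)" by (rule card_Un_le)
  also have "card (\<Union>p\<in>{2..a}. ?B p) \<le> (\<Sum>p\<in>{2..a}. card (?B p))" by (rule card_UN_le) simp
  finally have "a * b \<le> card ?G + (\<Sum>p\<in>{2..a}. card (?B p))" by simp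
  then have "real (a * b) \<le> real (card ?G + (\<Sum>p\<in>{2..a}. card (?B p)))" by (simp only: of_nat_le_iff)
  then have main: "real a * real b \<le> real (card ?G) + (\<Sum>p\<in>{2..a}. real (card (?B p)))" by simp
  have "(\<Sum>p\<in>{2..a}. real (card (?B p))) \<le> (\<Sum>p\<in>{2..a}. real a * real b * (1 / real p ^ 10))"
  proof (rule sum_mono)
    fix p assume p: "p \<in> {2..a}"
    have "card (?B p) \<le> (a div p ^ 4) * (b div p ^ 6)"
      unfolding card_cartesian_product using p by (intro mult_le_mono card_multiples_le) auto
    then have "real (card (?B p)) \<le> real (a div p ^ 4) * real (b div p ^ 6)"
      by (simp only: of_nat_mult[symmetric] of_nat_le_iff)
    also have "\<dots> \<le> (real a / real p ^ 4) * (real b / real p ^ 6)"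
      using of_nat_div_le_of_nat[of a "p ^ 4", where 'a = real] of_nat_div_le_of_nat[of b "p ^ 6", where 'a = real]
      by (intro mult_mono) auto
    also have "\<dots> = real a * real b * (1 / real p ^ 10)" by (simp add: power_add[symmetric])
    finally show "real (card (?B p)) \<le> real a * real b * (1 / real p ^ 10)" .
  qed
  also have "\<dots> = real a * real b * (\<Sum>p\<in>{2..a}. 1 / real p ^ 10)" by (simp only: sum_distrib_left)
  also have "\<dots> \<le> real a * real b * (1 / 4)" by (intro mult_left_mono sum_inverse_tenth_powers) auto
  finally show ?thesis using main by linarith
qed

text \<open>For positive \<open>A\<close> and \<open>B\<close> the discriminant condition is
  automatic. From \<open>H \<ge> 108\<close> both side lengths are at least 2, as 108/27 = 4 and
  108/4 \<ge> 8, so that rounding them down loses at most a factor 2 each.\<close>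

lemma curves_upto_ge:
  "\<exists>c>0. \<forall>H\<ge>108. c * H powr (5 / 6) \<le> real (card (curves_upto H))"
proof -
  define c :: real where "c = 3 / 16 * ((1 / 4) powr (1 / 3) * (1 / 27) powr (1 / 2))"
  have c: "c > 0" by (simp add: c_def)
  show ?thesis
  proof (intro exI[of _ c] conjI allI impI c)
    fix H :: real assume H: "H \<ge> 108"
    define \<alpha> where "\<alpha> = (H / 4) powr (1 / 3)"
    define \<beta> where "\<beta> = (H / 27) powr (1 / 2)"
    define a where "a = nat \<lfloor>\<alpha>\<rfloor>"
    define b where "b = nat \<lfloor>\<beta>\<rfloor>"
    have "(8::real) powr (1 / 3) \<le> \<alpha>" unfolding \<alpha>_def using H by (intro powr_mono2) auto
    moreover have "(8::real) powr (1 / 3) = (2 powr 3) powr (1 / 3)" by simp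
    ultimately have \<alpha>2: "\<alpha> \<ge> 2" unfolding powr_powr by simp
    have "(4::real) powr (1 / 2) \<le> \<beta>" unfolding \<beta>_def using H by (intro powr_mono2) auto
    moreover have "(4::real) powr (1 / 2) = (2 powr 2) powr (1 / 2)" by simp
    ultimately have \<beta>2: "\<beta> \<ge> 2" unfolding powr_powr by simp
    have al: "\<alpha> / 2 \<le> real a" "real a \<le> \<alpha>" and bl: "\<beta> / 2 \<le> real b" "real b \<le> \<beta>"
      using \<alpha>2 \<beta>2 unfolding a_def b_def by (auto simp: of_nat_nat) linarith+
    let ?G = "{(x, y) \<in> {1..a} \<times> {1..b}. \<not> (\<exists>p\<ge>2. p ^ 4 dvd x \<and> p ^ 6 dvd y)}"
    have "(\<lambda>(x, y). (int x, int y)) ` ?G \<subseteq> curves_upto H"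
    proof clarify
      fix x y assume xy: "x \<in> {1..a}" "y \<in> {1..b}" and np: "\<not> (\<exists>p\<ge>2. p ^ 4 dvd x \<and> p ^ 6 dvd y)"
      have "4 * int x ^ 3 + 27 * int y ^ 2 > 0" using xy by (intro add_pos_pos) auto
      moreover have "\<not> (\<exists>p::int. prime p \<and> p ^ 4 dvd int x \<and> p ^ 6 dvd int y)"
      proof
        assume "\<exists>p::int. prime p \<and> p ^ 4 dvd int x \<and> p ^ 6 dvd int y"
        then obtain p :: int where p: "prime p" "p ^ 4 dvd int x" "p ^ 6 dvd int y" by blast
        have p2: "p \<ge> 2" using prime_ge_2_int[OF p(1)] .
        have "int (nat p ^ 4) dvd int x" "int (nat p ^ 6) dvd int y" using p p2 by simp_all
        then have "nat p ^ 4 dvd x" "nat p ^ 6 dvd y" by (simp_all only: int_dvd_int_iff)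
        moreover have "nat p \<ge> 2" using p2 by simp
        ultimately show False using np by blast
      qed
      moreover have "height (int x, int y) \<le> H"
      proof -
        have "real x ^ 3 \<le> \<alpha> ^ 3" using xy al by (intro power_mono) auto
        also have "\<alpha> ^ 3 = H / 4" unfolding \<alpha>_def using H by (simp add: powr_realpow[symmetric] powr_powr)
        finally have 1: "4 * real x ^ 3 \<le> H" by simp
        have "real y ^ 2 \<le> \<beta> ^ 2" using xy bl by (intro power_mono) auto
        also have "\<beta> ^ 2 = H / 27" unfolding \<beta>_def using H by (simp add: powr_realpow[symmetric] powr_powr)
        finally have 2: "27 * real y ^ 2 \<le> H" by simp
        have "height (int x, int y) = max (4 * real x ^ 3) (27 * real y ^ 2)"
          by (simp add: height_def of_int_max)
        then show ?thesis using 1 2 by simp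
      qed
      ultimately show "(int x, int y) \<in> curves_upto H"
        unfolding curves_upto_def elliptic_curves_def by auto
    qed
    moreover have "inj_on (\<lambda>(x, y). (int x, int y)) ?G" by (auto simp: inj_on_def)
    moreover have "finite (curves_upto H)" using curves_upto_le(1) H by simp
    ultimately have "card ?G \<le> card (curves_upto H)" by (intro card_inj_on_le) auto
    then have "real (card ?G) \<le> real (card (curves_upto H))" by simp
    moreover have "3 / 4 * (real a * real b) \<le> real (card ?G)" by (rule card_pairs_without_common_power)
    moreover have "3 / 4 * ((\<alpha> / 2) * (\<beta> / 2)) \<le> 3 / 4 * (real a * real b)"
      using al bl \<alpha>2 \<beta>2 by (intro mult_left_mono mult_mono) auto
    moreover have "3 / 4 * ((\<alpha> / 2) * (\<beta> / 2)) = c * H powr (5 / 6)"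
    proof -
      have "\<alpha> = H powr (1 / 3) * (1 / 4) powr (1 / 3)" unfolding \<alpha>_def using H powr_mult[of H "1 / 4" "1 / 3"] by simp
      moreover have "\<beta> = H powr (1 / 2) * (1 / 27) powr (1 / 2)" unfolding \<beta>_def using H powr_mult[of H "1 / 27" "1 / 2"] by simp
      moreover have "H powr (5 / 6) = H powr (1 / 3) * H powr (1 / 2)" by (simp add: powr_add[symmetric])
      ultimately show ?thesis by (simp add: c_def)
    qed
    ultimately show "c * H powr (5 / 6) \<le> real (card (curves_upto H))" by linarith
  qed
qed

lemma curves_upto_mono: "H \<le> H' \<Longrightarrow> curves_upto H \<subseteq> curves_upto H'"
  by (auto simp: curves_upto_def)

definition curve_block :: "nat \<Rightarrow> (int \<times> int) set" where
  "curve_block j = curves_upto (2 ^ Suc j) - curves_upto (2 ^ j)"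

text \<open>The constant 18 bounds 9 * 2^(5/6), from the number of curves up to the upper end of the
  block. Since \<open>s \<ge> 0\<close>, the lower end of the block controls every term.\<close>

lemma curve_block_sum_le:
  assumes s: "s \<ge> 0" and f: "\<And>E. E \<in> elliptic_curves \<Longrightarrow> h0 \<le> height E \<Longrightarrow> f E \<le> height E powr (- s)"
    and j: "h0 \<le> 2 ^ j"
  shows "(\<Sum>E\<in>curve_block j. f E) \<le> 18 * 2 powr (real j * (5 / 6 - s))"
proof -
  have "f E \<le> (2 ^ j) powr (- s)" if E: "E \<in> curve_block j" for E
  proof -
    have E': "E \<in> elliptic_curves" "2 ^ j < height E"
      using E by (auto simp: curve_block_def curves_upto_def)
    then have "f E \<le> height E powr (- s)" using f j by auto
    also have "\<dots> \<le> (2 ^ j) powr (- s)" using s E'(2) by (intro powr_mono2') auto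
    finally show ?thesis .
  qed
  then have "(\<Sum>E\<in>curve_block j. f E) \<le> real (card (curve_block j)) * (2 ^ j) powr (- s)"
    using sum_bounded_above[of "curve_block j" f "(2 ^ j) powr (- s)"] by simp
  also have "\<dots> \<le> 9 * (2 ^ Suc j) powr (5 / 6) * (2 ^ j) powr (- s)"
  proof (intro mult_right_mono)
    have one: "(1::real) \<le> 2 ^ Suc j" by (rule one_le_power) simp
    have "card (curve_block j) \<le> card (curves_upto (2 ^ Suc j))"
      by (intro card_mono curves_upto_le(1)[OF one]) (auto simp: curve_block_def)
    then have "real (card (curve_block j)) \<le> real (card (curves_upto (2 ^ Suc j)))"
      by (simp only: of_nat_le_iff)
    then show "real (card (curve_block j)) \<le> 9 * (2 ^ Suc j) powr (5 / 6)"
      using curves_upto_le(2)[OF one] by (rule order_trans)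
  qed auto
  also have "(2 ^ Suc j :: real) powr (5 / 6) = 2 powr (5 / 6) * (2 ^ j) powr (5 / 6)"
    by (simp add: powr_mult)
  also have "9 * (2 powr (5 / 6) * (2 ^ j) powr (5 / 6)) * (2 ^ j) powr (- s) =
      9 * 2 powr (5 / 6) * ((2 ^ j) powr (5 / 6) * (2 ^ j) powr (- s))" by simp
  also have "(2 ^ j :: real) powr (5 / 6) * (2 ^ j) powr (- s) = 2 powr (real j * (5 / 6 - s))"
    by (simp add: powr_add[symmetric] powr_realpow[symmetric] powr_powr right_diff_distrib)
  also have "9 * 2 powr (5 / 6) * 2 powr (real j * (5 / 6 - s)) \<le> 9 * 2 powr 1 * 2 powr (real j * (5 / 6 - s))"
    by (intro mult_right_mono mult_left_mono powr_mono) auto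
  finally show ?thesis by simp
qed

text \<open>Summation over dyadic blocks. The factor linear in \<open>j\<close> covers the case of
  exponent 0, where the block bounds do not grow geometrically; \<open>C\<close> accounts for the
  curves of small height, where \<open>f\<close> is not controlled.\<close>

lemma curves_upto_sum_le:
  assumes s: "s \<ge> 0" "s \<le> 5 / 6 + \<delta>" "\<delta> \<ge> 0" and f0: "\<And>E. 0 \<le> f E"
    and f: "\<And>E. E \<in> elliptic_curves \<Longrightarrow> h0 \<le> height E \<Longrightarrow> f E \<le> height E powr (- s)"
  shows "\<exists>C\<ge>0. \<forall>j. (\<Sum>E\<in>curves_upto (2 ^ j). f E) \<le> (C + 18 * real j) * 2 powr (real j * (5 / 6 + \<delta> - s))"
proof -
  obtain j0 where "h0 < 2 ^ j0" using real_arch_pow[of 2 h0] by auto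
  then have j0: "h0 \<le> 2 ^ j0" by simp
  define C where "C = (\<Sum>E\<in>curves_upto (2 ^ j0). f E)"
  have C: "C \<ge> 0" unfolding C_def by (intro sum_nonneg f0)
  have fin: "finite (curves_upto (2 ^ j))" for j using curves_upto_le(1)[of "2 ^ j"] by simp
  have e1: "1 \<le> 2 powr (real j * (5 / 6 + \<delta> - s))" for j using s by (intro ge_one_powr_ge_zero) auto
  have emono: "2 powr (real j * (5 / 6 + \<delta> - s)) \<le> 2 powr (real (Suc j) * (5 / 6 + \<delta> - s))" for j
    using s by (intro powr_mono mult_right_mono) auto
  have "(\<Sum>E\<in>curves_upto (2 ^ j). f E) \<le> (C + 18 * real j) * 2 powr (real j * (5 / 6 + \<delta> - s))" for j
  proof (cases "j \<le> j0")
    case True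
    have "(\<Sum>E\<in>curves_upto (2 ^ j). f E) \<le> C"
      unfolding C_def using True by (intro sum_mono2 fin curves_upto_mono f0) auto
    also have "\<dots> \<le> (C + 18 * real j) * 1" by simp
    also have "\<dots> \<le> (C + 18 * real j) * 2 powr (real j * (5 / 6 + \<delta> - s))" using C e1 by (intro mult_left_mono) auto
    finally show ?thesis .
  next
    case False
    then have "j0 \<le> j" by simp
    then show ?thesis
    proof (induction j rule: dec_induct)
      case base
      have "(\<Sum>E\<in>curves_upto (2 ^ j0). f E) = C * 1" by (simp add: C_def)
      also have "\<dots> \<le> (C + 18 * real j0) * 2 powr (real j0 * (5 / 6 + \<delta> - s))" using C e1 by (intro mult_mono) auto
      finally show ?case .
    next
      case (step j)
      have un: "curves_upto (2 ^ Suc j) = curves_upto (2 ^ j) \<union> curve_block j"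
        using curves_upto_mono[of "2 ^ j" "2 ^ Suc j"] by (auto simp: curve_block_def)
      have "(\<Sum>E\<in>curves_upto (2 ^ Suc j). f E) = (\<Sum>E\<in>curves_upto (2 ^ j). f E) + (\<Sum>E\<in>curve_block j. f E)"
        unfolding un using fin fin[of "Suc j"] by (intro sum.union_disjoint) (auto simp: curve_block_def)
      also have "\<dots> \<le> (C + 18 * real j) * 2 powr (real j * (5 / 6 + \<delta> - s)) + 18 * 2 powr (real j * (5 / 6 + \<delta> - s))"
      proof (intro add_mono step.IH)
        have "h0 \<le> 2 ^ j" using j0 power_increasing[OF step.hyps(1), of "2::real"] by linarith
        then have "(\<Sum>E\<in>curve_block j. f E) \<le> 18 * 2 powr (real j * (5 / 6 - s))"
          using curve_block_sum_le[OF s(1) f] by blast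
        also have "\<dots> \<le> 18 * 2 powr (real j * (5 / 6 + \<delta> - s))"
          using s(3) by (intro mult_left_mono powr_mono) auto
        finally show "(\<Sum>E\<in>curve_block j. f E) \<le> 18 * 2 powr (real j * (5 / 6 + \<delta> - s))" .
      qed
      also have "\<dots> = (C + 18 * real (Suc j)) * 2 powr (real j * (5 / 6 + \<delta> - s))" by (simp add: algebra_simps)
      also have "\<dots> \<le> (C + 18 * real (Suc j)) * 2 powr (real (Suc j) * (5 / 6 + \<delta> - s))"
        using C emono by (intro mult_left_mono) auto
      finally show ?case .
    qed
  qed
  then show ?thesis using C by blast
qed

subsection \<open>Counting successes in an independent family\<close>

context
  fixes I :: "'i set" and q :: "'i \<Rightarrow> 'a pmf" and M :: "('i \<Rightarrow> 'a) measure"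
  defines "M \<equiv> PiM I (\<lambda>i. measure_pmf (q i))"
begin

interpretation P: product_prob_space "\<lambda>i. measure_pmf (q i)" I ..

lemma component_measurable [measurable]: "i \<in> I \<Longrightarrow> (\<lambda>\<omega>. \<omega> i) \<in> measurable M (measure_pmf (q i))"
  unfolding M_def by (rule measurable_component_singleton)

lemma indicator_component_measurable [measurable]:
  assumes "i \<in> I" shows "(\<lambda>\<omega>. indicator R (\<omega> i) :: real) \<in> borel_measurable M"
  by (rule measurable_compose[OF component_measurable[OF assms]]) simp

lemma integral_component:
  fixes f :: "'a \<Rightarrow> real"
  assumes i: "i \<in> I"
  shows "integral\<^sup>L M (\<lambda>\<omega>. f (\<omega> i)) = measure_pmf.expectation (q i) f"
proof -
  have "measure_pmf.expectation (q i) f = integral\<^sup>L (distr M (measure_pmf (q i)) (\<lambda>\<omega>. \<omega> i)) f"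
    unfolding M_def using P.PiM_component[OF i] by simp
  also have "\<dots> = integral\<^sup>L M (\<lambda>\<omega>. f (\<omega> i))"
    by (rule integral_distr[OF component_measurable[OF i]]) simp
  finally show ?thesis by simp
qed

lemma prob_space_M: "prob_space M"
  unfolding M_def by (rule P.prob_space_axioms)

interpretation MP: prob_space M by (rule prob_space_M)

text \<open>Restricting a point of the product space to \<open>I\<close> changes nothing, so the
  joint law of the coordinates is the product of their laws.\<close>

lemma indep_components:
  "MP.indep_vars (\<lambda>i. measure_pmf (q i)) (\<lambda>i \<omega>. \<omega> i) I"
proof (cases "I = {}")
  case True
  then show ?thesis by (simp add: MP.indep_vars_def MP.indep_sets_def)
next
  case False
  have "distr M (PiM I (\<lambda>i. measure_pmf (q i))) (\<lambda>\<omega>. \<lambda>i\<in>I. \<omega> i) = distr M M (\<lambda>\<omega>. \<omega>)"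
    by (rule distr_cong) (auto simp: M_def space_PiM)
  also have "\<dots> = M" by (rule distr_id2) simp
  also have "\<dots> = PiM I (\<lambda>i. distr M (measure_pmf (q i)) (\<lambda>\<omega>. \<omega> i))"
    unfolding M_def using P.PiM_component by (intro PiM_cong) auto
  finally show ?thesis
    using MP.indep_vars_iff_distr_eq_PiM'[OF False, of "\<lambda>i \<omega>. \<omega> i" "\<lambda>i. measure_pmf (q i)"]
      component_measurable by simp
qed

lemma card_as_sum:
  assumes "finite J"
  shows "real (card {i \<in> J. \<omega> i \<in> R}) = (\<Sum>i\<in>J. indicator R (\<omega> i))"
  using assms by (simp add: sum.If_cases indicator_def Int_def)

lemma success_count_Markov:
  assumes J: "finite J" "J \<subseteq> I" and t: "t > 0"
  shows "{\<omega> \<in> space M. t \<le> real (card {i \<in> J. \<omega> i \<in> R})} \<in> sets M"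
    and "measure M {\<omega> \<in> space M. t \<le> real (card {i \<in> J. \<omega> i \<in> R})} \<le> (\<Sum>i\<in>J. measure_pmf.prob (q i) R) / t"
proof -
  have mI[measurable]: "(\<lambda>\<omega>. indicator R (\<omega> i) :: real) \<in> borel_measurable M" if "i \<in> J" for i
    using indicator_component_measurable that J(2) by blast
  have int: "integrable M (\<lambda>\<omega>. indicator R (\<omega> i) :: real)" if "i \<in> J" for i
    using mI[OF that] by (intro MP.integrable_const_bound[where B = 1]) (auto simp: indicator_def)
  have meas: "(\<lambda>\<omega>. \<Sum>i\<in>J. indicator R (\<omega> i) :: real) \<in> borel_measurable M"
    using mI by (intro borel_measurable_sum) auto
  show "{\<omega> \<in> space M. t \<le> real (card {i \<in> J. \<omega> i \<in> R})} \<in> sets M"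
    unfolding card_as_sum[OF J(1)] using meas by measurable
  have "measure M {\<omega> \<in> space M. t \<le> (\<Sum>i\<in>J. indicator R (\<omega> i))} \<le> (\<integral>\<omega>. (\<Sum>i\<in>J. indicator R (\<omega> i) :: real) \<partial>M) / t"
    using int t by (intro integral_Markov_inequality_measure[where A = "{}"]) (auto intro!: sum_nonneg)
  also have "(\<integral>\<omega>. (\<Sum>i\<in>J. indicator R (\<omega> i) :: real) \<partial>M) = (\<Sum>i\<in>J. \<integral>\<omega>. (indicator R (\<omega> i) :: real) \<partial>M)"
    using int by (rule Bochner_Integration.integral_sum)
  also have "\<dots> = (\<Sum>i\<in>J. measure_pmf.prob (q i) R)"
    using J(2) integral_component[of _ "indicator R"] by (intro sum.cong) auto
  finally show "measure M {\<omega> \<in> space M. t \<le> real (card {i \<in> J. \<omega> i \<in> R})} \<le> (\<Sum>i\<in>J. measure_pmf.prob (q i) R) / t"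
    unfolding card_as_sum[OF J(1)] .
qed

text \<open>The exponential moment of minus the count: each factor is 1 - (1 - 1/e) p \<le> exp
  (-p/2), so the moment is at most exp (-\<mu>/2), and Markov's inequality at the level exp
  (-\<mu>/4) leaves exp (-\<mu>/4).\<close>

lemma success_count_lower_tail:
  fixes R :: "'a set"
  assumes J: "finite J" "J \<subseteq> I"
  defines "\<mu> \<equiv> (\<Sum>i\<in>J. measure_pmf.prob (q i) R)"
  shows "{\<omega> \<in> space M. real (card {i \<in> J. \<omega> i \<in> R}) \<le> \<mu> / 4} \<in> sets M"
    and "measure M {\<omega> \<in> space M. real (card {i \<in> J. \<omega> i \<in> R}) \<le> \<mu> / 4} \<le> exp (- \<mu> / 4)"
proof -
  have mI[measurable]: "(\<lambda>\<omega>. indicator R (\<omega> i) :: real) \<in> borel_measurable M" if "i \<in> J" for i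
    using indicator_component_measurable that J(2) by blast
  have meas[measurable]: "(\<lambda>\<omega>. \<Sum>i\<in>J. indicator R (\<omega> i) :: real) \<in> borel_measurable M"
    using mI by (intro borel_measurable_sum) auto
  show "{\<omega> \<in> space M. real (card {i \<in> J. \<omega> i \<in> R}) \<le> \<mu> / 4} \<in> sets M"
    unfolding card_as_sum[OF J(1)] by measurable
  define u where "u \<omega> = (\<Prod>i\<in>J. exp (- indicator R (\<omega> i)) :: real)" for \<omega> :: "'i \<Rightarrow> 'a"
  have u: "u \<omega> = exp (- (\<Sum>i\<in>J. indicator R (\<omega> i)))" for \<omega>
    unfolding u_def using J(1) by (simp add: exp_sum sum_negf[symmetric])
  have u0: "0 \<le> u \<omega>" for \<omega> by (simp add: u)
  have int1: "integrable M (\<lambda>\<omega>. exp (- indicator R (\<omega> i)) :: real)" if "i \<in> J" for i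
    using mI[OF that] by (intro MP.integrable_const_bound[where B = 1]) (auto simp: indicator_def)
  have ind: "MP.indep_vars (\<lambda>_. borel) (\<lambda>i \<omega>. exp (- indicator R (\<omega> i)) :: real) J"
    using MP.indep_vars_compose2[OF MP.indep_vars_subset[OF indep_components J(2)],
        of "\<lambda>i x. exp (- indicator R x) :: real" "\<lambda>_. borel"] by simp
  have intu: "integrable M u"
    unfolding u_def by (rule MP.indep_vars_integrable[OF J(1) ind int1])
  have "integral\<^sup>L M u = (\<Prod>i\<in>J. \<integral>\<omega>. (exp (- indicator R (\<omega> i)) :: real) \<partial>M)"
    unfolding u_def by (rule MP.indep_vars_lebesgue_integral[OF J(1) ind int1])
  also have "\<dots> \<le> (\<Prod>i\<in>J. exp (- measure_pmf.prob (q i) R / 2))"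
  proof (intro prod_mono conjI)
    fix i assume i: "i \<in> J"
    show "0 \<le> (\<integral>\<omega>. (exp (- indicator R (\<omega> i)) :: real) \<partial>M)" by (intro Bochner_Integration.integral_nonneg) auto
    let ?p = "measure_pmf.prob (q i) R"
    have "(\<integral>\<omega>. (exp (- indicator R (\<omega> i)) :: real) \<partial>M) = measure_pmf.expectation (q i) (\<lambda>x. exp (- indicator R x))"
      using i J(2) by (intro integral_component) auto
    also have "\<dots> = measure_pmf.expectation (q i) (\<lambda>x. 1 - (1 - exp (- 1)) * indicator R x)"
      by (intro Bochner_Integration.integral_cong) (auto simp: indicator_def)
    also have "\<dots> = 1 - (1 - exp (- 1)) * ?p"
      by (subst Bochner_Integration.integral_diff) (auto simp: measure_pmf.integrable_const_bound[where B = 1])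
    also have "\<dots> \<le> 1 - 1 / 2 * ?p"
    proof -
      have "2 \<le> exp (1::real)" using exp_ge_add_one_self[of 1] by simp
      then have "exp (- 1 :: real) \<le> 1 / 2" by (simp add: exp_minus field_simps)
      then have "1 / 2 * ?p \<le> (1 - exp (- 1)) * ?p" by (intro mult_right_mono) auto
      then show ?thesis by linarith
    qed
    also have "\<dots> \<le> exp (- ?p / 2)" using exp_ge_add_one_self[of "- ?p / 2"] by simp
    finally show "(\<integral>\<omega>. (exp (- indicator R (\<omega> i)) :: real) \<partial>M) \<le> exp (- ?p / 2)" .
  qed
  also have "\<dots> = exp (- \<mu> / 2)"
    unfolding \<mu>_def using J(1) by (simp add: exp_sum[symmetric] sum_negf sum_divide_distrib)
  finally have E: "integral\<^sup>L M u \<le> exp (- \<mu> / 2)" .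
  have "{\<omega> \<in> space M. real (card {i \<in> J. \<omega> i \<in> R}) \<le> \<mu> / 4} = {\<omega> \<in> space M. exp (- \<mu> / 4) \<le> u \<omega>}"
    unfolding card_as_sum[OF J(1)] u by auto
  moreover have "measure M {\<omega> \<in> space M. exp (- \<mu> / 4) \<le> u \<omega>} \<le> integral\<^sup>L M u / exp (- \<mu> / 4)"
    using intu u0 by (intro integral_Markov_inequality_measure[where A = "{}"]) auto
  moreover have "integral\<^sup>L M u / exp (- \<mu> / 4) \<le> exp (- \<mu> / 2) / exp (- \<mu> / 4)"
    using E by (intro divide_right_mono) auto
  moreover have "exp (- \<mu> / 2) / exp (- \<mu> / 4) = exp (- \<mu> / 4)" by (simp add: exp_diff[symmetric])
  ultimately show "measure M {\<omega> \<in> space M. real (card {i \<in> J. \<omega> i \<in> R}) \<le> \<mu> / 4} \<le> exp (- \<mu> / 4)" by simp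
qed

lemma AE_eventually_count_less:
  assumes J: "\<And>j. finite (J j)" "\<And>j. J j \<subseteq> I" and t: "\<And>j. t j > 0"
    and s: "summable (\<lambda>j. (\<Sum>i\<in>J j. measure_pmf.prob (q i) R) / t j)"
  shows "AE \<omega> in M. \<forall>\<^sub>F j in sequentially. real (card {i \<in> J j. \<omega> i \<in> R}) < t j"
proof -
  let ?A = "\<lambda>j. {\<omega> \<in> space M. t j \<le> real (card {i \<in> J j. \<omega> i \<in> R})}"
  have "AE \<omega> in M. \<forall>\<^sub>F j in sequentially. \<omega> \<in> space M - ?A j"
  proof (rule borel_cantelli_AE1)
    show "?A j \<in> sets M" for j by (rule success_count_Markov(1)[OF J t])
    show "emeasure M (?A j) < \<infinity>" for j by (simp add: MP.emeasure_eq_measure)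
    show "summable (\<lambda>j. measure M (?A j))"
      using success_count_Markov(2)[OF J t] by (intro summable_comparison_test[OF _ s]) auto
  qed
  then show ?thesis by eventually_elim (auto elim!: eventually_mono)
qed

lemma AE_eventually_count_greater:
  assumes J: "\<And>j. finite (J j)" "\<And>j. J j \<subseteq> I"
    and s: "summable (\<lambda>j. exp (- (\<Sum>i\<in>J j. measure_pmf.prob (q i) R) / 4))"
  shows "AE \<omega> in M. \<forall>\<^sub>F j in sequentially.
    (\<Sum>i\<in>J j. measure_pmf.prob (q i) R) / 4 < real (card {i \<in> J j. \<omega> i \<in> R})"
proof -
  let ?A = "\<lambda>j. {\<omega> \<in> space M. real (card {i \<in> J j. \<omega> i \<in> R}) \<le> (\<Sum>i\<in>J j. measure_pmf.prob (q i) R) / 4}"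
  have "AE \<omega> in M. \<forall>\<^sub>F j in sequentially. \<omega> \<in> space M - ?A j"
  proof (rule borel_cantelli_AE1)
    show "?A j \<in> sets M" for j by (rule success_count_lower_tail(1)[OF J])
    show "emeasure M (?A j) < \<infinity>" for j by (simp add: MP.emeasure_eq_measure)
    show "summable (\<lambda>j. measure M (?A j))"
      using success_count_lower_tail(2)[OF J] by (intro summable_comparison_test[OF _ s]) auto
  qed
  then show ?thesis by eventually_elim (auto elim!: eventually_mono)
qed

end

subsection \<open>Powers of the height up to \<open>H\<^bsup>o(1)\<^esup>\<close>\<close>

lemma eq_pow_o1I:
  assumes "\<And>\<epsilon>. \<epsilon> > 0 \<Longrightarrow> \<forall>\<^sub>F H in at_top. H powr (c - \<epsilon>) \<le> f H"
    and "\<And>\<epsilon>. \<epsilon> > 0 \<Longrightarrow> \<forall>\<^sub>F H in at_top. f H \<le> H powr (c + \<epsilon>)"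
  shows "eq_pow_o1 f c"
  unfolding eq_pow_o1_def
\<comment> \<open>The error term is found by solving the equation for the exponent.\<close>
proof (intro exI[of _ "\<lambda>H. ln (f H) / ln H - c"] conjI)
  have one: "(0::real) < 1" by simp
  \<comment> \<open>The lower bound for one fixed value, here 1, makes \<open>f\<close> eventually
    positive, so that its logarithm is meaningful.\<close>
  have pos: "\<forall>\<^sub>F H in at_top. H > (1::real) \<and> f H > 0"
    using assms(1)[OF one] eventually_gt_at_top[of 1]
  proof eventually_elim
    case (elim H)
    then have "0 < H powr (c - 1)" by simp
    then show ?case using elim by linarith
  qed
  then show "\<forall>\<^sub>F H in at_top. f H = H powr (c + (ln (f H) / ln H - c))"
    by eventually_elim (simp add: powr_def)
  show "((\<lambda>H. ln (f H) / ln H - c) \<longlongrightarrow> 0) at_top"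
  proof (rule tendstoI)
    fix e :: real assume e: "e > 0"
    then have "e / 2 > 0" by simp
    from assms(1)[OF this] assms(2)[OF this] pos
    show "\<forall>\<^sub>F H in at_top. dist (ln (f H) / ln H - c) 0 < e"
    proof eventually_elim
      case (elim H)
      then have L: "ln H > 0" by simp
      have "ln (H powr (c - e / 2)) \<le> ln (f H)" using elim by (intro ln_mono) auto
      then have 1: "(c - e / 2) * ln H \<le> ln (f H)" using elim by (simp add: ln_powr)
      have "ln (f H) \<le> ln (H powr (c + e / 2))" using elim by (intro ln_mono) auto
      then have 2: "ln (f H) \<le> (c + e / 2) * ln H" using elim by (simp add: ln_powr)
      have "c - e / 2 \<le> ln (f H) / ln H" "ln (f H) / ln H \<le> c + e / 2"
        using 1 2 L by (simp_all add: le_divide_eq divide_le_eq)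
      then show ?case using e unfolding dist_real_def diff_0_right by (simp only: abs_less_iff) linarith
    qed
  qed
qed

text \<open>Replacing \<open>f\<close> by its maximum with 1 avoids the logarithm of zero and costs
  nothing in an upper bound.\<close>

lemma le_pow_o1I:
  assumes "\<And>\<epsilon>. \<epsilon> > 0 \<Longrightarrow> \<forall>\<^sub>F H in at_top. f H \<le> H powr \<epsilon>"
  shows "le_pow_o1 f 0"
  unfolding le_pow_o1_def
proof (intro exI[of _ "\<lambda>H. ln (max 1 (f H)) / ln H"] conjI)
  have pos: "\<forall>\<^sub>F H in at_top. H > (1::real)" by (rule eventually_gt_at_top)
  then show "\<forall>\<^sub>F H in at_top. f H \<le> H powr (0 + ln (max 1 (f H)) / ln H)"
    by eventually_elim (simp add: powr_def)
  show "((\<lambda>H. ln (max 1 (f H)) / ln H) \<longlongrightarrow> 0) at_top"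
  proof (rule tendstoI)
    fix e :: real assume e: "e > 0"
    then have "e / 2 > 0" by simp
    from assms[OF this] pos
    show "\<forall>\<^sub>F H in at_top. dist (ln (max 1 (f H)) / ln H) 0 < e"
    proof eventually_elim
      case (elim H)
      then have L: "ln H > 0" by simp
      have "1 \<le> H powr (e / 2)" using elim e by (intro ge_one_powr_ge_zero) auto
      then have "ln (max 1 (f H)) \<le> ln (H powr (e / 2))" using elim by (intro ln_mono) auto
      then have "ln (max 1 (f H)) / ln H \<le> e / 2" using L elim by (simp add: ln_powr divide_le_eq)
      moreover have "0 \<le> ln (max 1 (f H)) / ln H" using L by (intro divide_nonneg_nonneg) auto
      ultimately show ?case using e unfolding dist_real_def diff_0_right by (simp only: abs_of_nonneg)
    qed
  qed
qed

text \<open>Rounding \<open>H\<close> up to a power of 2 costs at most the factor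
  \<open>2 powr b\<close>, which \<open>H powr \<epsilon>\<close> absorbs.\<close>

lemma dyadic_upper_bound:
  assumes mono: "\<And>H H'. H \<le> H' \<Longrightarrow> F H \<le> (F H' :: real)" and b: "b \<ge> 0"
    and ev: "\<forall>\<^sub>F j in sequentially. F (2 ^ j) \<le> 2 powr (real j * b)" and e: "\<epsilon> > 0"
  shows "\<forall>\<^sub>F H in at_top. F H \<le> H powr (b + \<epsilon>)"
proof -
  obtain j0 where j0: "\<And>j. j \<ge> j0 \<Longrightarrow> F (2 ^ j) \<le> 2 powr (real j * b)"
    using ev by (auto simp: eventually_sequentially)
  have "\<forall>\<^sub>F H :: real in at_top. 2 powr b \<le> H powr \<epsilon>" using e by real_asymp
  moreover have "\<forall>\<^sub>F H :: real in at_top. H \<ge> 2 ^ j0" by (rule eventually_ge_at_top)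
  ultimately show ?thesis using eventually_ge_at_top[of 1]
  proof eventually_elim
    case (elim H)
    define j where "j = nat \<lceil>log 2 H\<rceil>"
    have l0: "log 2 H \<ge> 0" using elim by simp
    have "real j = of_int \<lceil>log 2 H\<rceil>" unfolding j_def using l0 by (intro of_nat_nat) linarith
    then have j: "log 2 H \<le> real j" "real j \<le> log 2 H + 1" by linarith+
    have "real j0 \<le> log 2 H" using elim by (simp add: le_log_iff powr_realpow)
    then have "j0 \<le> j" using j(1) by linarith
    have "H = 2 powr (log 2 H)" using elim by simp
    also have "\<dots> \<le> 2 powr (real j)" using j(1) by (intro powr_mono) auto
    finally have "F H \<le> F (2 ^ j)" by (intro mono) (simp add: powr_realpow)
    also have "\<dots> \<le> 2 powr (real j * b)" by (rule j0) fact
    also have "\<dots> \<le> 2 powr ((log 2 H + 1) * b)" using j(2) b by (intro powr_mono mult_right_mono) auto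
    also have "\<dots> = 2 powr b * (2 powr (log 2 H)) powr b"
      by (simp add: powr_powr powr_add[symmetric] algebra_simps)
    also have "\<dots> = 2 powr b * H powr b" using elim by simp
    also have "\<dots> \<le> H powr \<epsilon> * H powr b" using elim by (intro mult_right_mono) auto
    finally show ?case by (simp add: powr_add[symmetric] add.commute)
  qed
qed

text \<open>Here \<open>H\<close> is rounded down; both \<open>c\<close> and the factor
  \<open>2 powr (- b)\<close> are absorbed by \<open>H powr \<epsilon>\<close>.\<close>

lemma dyadic_lower_bound:
  assumes mono: "\<And>H H'. H \<le> H' \<Longrightarrow> F H \<le> (F H' :: real)" and b: "b \<ge> 0" and c: "c > 0"
    and ev: "\<forall>\<^sub>F j in sequentially. c * 2 powr (real j * b) \<le> F (2 ^ j)" and e: "\<epsilon> > 0"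
  shows "\<forall>\<^sub>F H in at_top. H powr (b - \<epsilon>) \<le> F H"
proof -
  obtain j0 where j0: "\<And>j. j \<ge> j0 \<Longrightarrow> c * 2 powr (real j * b) \<le> F (2 ^ j)"
    using ev by (auto simp: eventually_sequentially)
  have "c * 2 powr (- b) > 0" using c by simp
  then have "\<forall>\<^sub>F H :: real in at_top. H powr (- \<epsilon>) \<le> c * 2 powr (- b)" using e by real_asymp
  moreover have "\<forall>\<^sub>F H :: real in at_top. H \<ge> 2 ^ Suc j0" by (rule eventually_ge_at_top)
  ultimately show ?thesis using eventually_ge_at_top[of 1]
  proof eventually_elim
    case (elim H)
    define j where "j = nat \<lfloor>log 2 H\<rfloor>"
    have l0: "log 2 H \<ge> 0" using elim by simp
    then have "real j = of_int \<lfloor>log 2 H\<rfloor>" unfolding j_def by simp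
    then have j: "real j \<le> log 2 H" "log 2 H - 1 \<le> real j" by linarith+
    have "2 powr real (Suc j0) \<le> H" using elim powr_realpow[of 2 "Suc j0"] by simp
    then have "real (Suc j0) \<le> log 2 H" using elim by (simp only: le_log_iff)
    then have "j0 \<le> j" using j(2) by linarith
    have "H powr (b - \<epsilon>) = H powr (- \<epsilon>) * H powr b" by (simp add: powr_add[symmetric])
    also have "\<dots> \<le> c * 2 powr (- b) * H powr b" using elim by (intro mult_right_mono) auto
    also have "\<dots> = c * (2 powr (- b) * (2 powr (log 2 H)) powr b)" using elim by simp
    also have "\<dots> = c * 2 powr ((log 2 H - 1) * b)"
      by (simp add: powr_powr powr_add[symmetric] algebra_simps)
    also have "\<dots> \<le> c * 2 powr (real j * b)" using j(2) b c by (intro mult_left_mono powr_mono mult_right_mono) auto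
    also have "\<dots> \<le> F (2 ^ j)" by (rule j0) fact
    also have "\<dots> \<le> F H"
    proof (rule mono)
      have "2 powr real j \<le> 2 powr (log 2 H)" using j(1) by (intro powr_mono) auto
      then show "2 ^ j \<le> H" using elim by (simp add: powr_realpow)
    qed
    finally show ?case .
  qed
qed

text \<open>\<open>g H\<close> counts the \<open>i\<close> for which \<open>K (i + 2)\<close> is
  below the threshold; by monotonicity they form an initial segment, and the shift by 2 provides for
  sizes up to \<eta> + 2. The threshold \<open>sqrt (ln H)\<close> is H^o(1), yet large enough to
  tend to infinity, and X turns out to exceed it as soon as \<eta> does not.\<close>

lemma slow_function_exists:
  fixes K :: "nat \<Rightarrow> real"
  assumes mono: "mono K" and K: "\<And>n. real n \<le> K n"
  obtains g where "filterlim g at_top at_top"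
    "\<forall>\<^sub>F H in at_top. \<forall>n. real n < g H + 2 \<longrightarrow> K n \<le> sqrt (ln H)"
proof -
  define S where "S H = {i. K (i + 2) \<le> sqrt (ln H)}" for H :: real
  have fin: "finite (S H)" for H
  proof (rule finite_subset)
    show "S H \<subseteq> {i. i \<le> nat \<lceil>sqrt (ln H)\<rceil>}"
    proof
      fix i assume "i \<in> S H"
      then have "real (i + 2) \<le> sqrt (ln H)" using K[of "i + 2"] by (simp add: S_def)
      then have "int i \<le> \<lceil>sqrt (ln H)\<rceil>" by linarith
      then show "i \<in> {i. i \<le> nat \<lceil>sqrt (ln H)\<rceil>}" by simp
    qed
  qed simp
  have lim: "filterlim (\<lambda>H :: real. sqrt (ln H)) at_top at_top" by real_asymp
  have big: "\<forall>\<^sub>F H in at_top. Z \<le> sqrt (ln H)" for Z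
    using lim by (simp add: filterlim_at_top)
  show thesis
  proof (rule that[of "\<lambda>H. real (card (S H))"])
    show "filterlim (\<lambda>H. real (card (S H))) at_top at_top"
      unfolding filterlim_at_top
    proof
      fix Z :: real
      define m where "m = nat \<lceil>Z\<rceil>"
      show "\<forall>\<^sub>F H in at_top. Z \<le> real (card (S H))"
        using big[of "K (m + 2)"]
      proof eventually_elim
        case (elim H)
        have "{..<m} \<subseteq> S H"
        proof
          fix i assume "i \<in> {..<m}"
          then have "K (i + 2) \<le> K (m + 2)" using mono by (auto simp: mono_def)
          then show "i \<in> S H" using elim by (simp add: S_def)
        qed
        then have "card {..<m} \<le> card (S H)" by (intro card_mono fin)
        moreover have "Z \<le> real m" unfolding m_def by linarith
        ultimately show ?case by simp
      qed
    qed
    show "\<forall>\<^sub>F H in at_top. \<forall>n. real n < real (card (S H)) + 2 \<longrightarrow> K n \<le> sqrt (ln H)"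
      using big[of "K 2"]
    proof eventually_elim
      case (elim H)
      show ?case
      proof (intro allI impI, rule ccontr)
        fix n assume n: "real n < real (card (S H)) + 2" and neg: "\<not> K n \<le> sqrt (ln H)"
        have "n > 2"
        proof (rule ccontr)
          assume "\<not> n > 2"
          then have "K n \<le> K 2" using mono by (auto simp: mono_def)
          then show False using elim neg by simp
        qed
        have "S H \<subseteq> {..<n - 2}"
        proof
          fix i assume i: "i \<in> S H"
          have "\<not> n \<le> i + 2"
          proof
            assume "n \<le> i + 2"
            then have "K n \<le> K (i + 2)" using mono by (auto simp: mono_def)
            then show False using i neg by (simp add: S_def)
          qed
          then show "i \<in> {..<n - 2}" by simp
        qed
        then have "card (S H) \<le> card {..<n - 2}" by (intro card_mono) auto
        then show False using n \<open>n > 2\<close> by simp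
      qed
    qed
  qed
qed

subsection \<open>The corank probabilities as powers of the height\<close>

text \<open>In logarithms the hypothesis reads \<eta> ln X = (1/12 + o(1)) ln H. Since
  \<open>n\<close> differs from \<eta> by less than 2, n (r - 1)/2 times ln X is (r - 1)/24 times ln
  H up to small errors. One of the two admissible sizes has the parity of \<open>r\<close>, which
  suffices for the lower bound.\<close>

lemma rank_prob_power_bounds:
  fixes K :: "nat \<Rightarrow> real" and \<eta> X g :: "real \<Rightarrow> real"
  assumes K: "\<And>n. real n \<le> K n"
    and KP: "\<forall>n X r. K n \<le> X \<longrightarrow> 1 \<le> r \<longrightarrow> r < n \<longrightarrow>
        measure_pmf.prob (pmf_of_set (alt_matrices n X)) (rank_ge r) \<le> K n * X powr (1 - real n * (real r - 1) / 2) \<and>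
        (even (n - r) \<longrightarrow> X powr (- (real n * (real r - 1) / 2)) / K n \<le>
          measure_pmf.prob (pmf_of_set (alt_matrices n X)) (rank_ge r))"
    and g: "\<forall>\<^sub>F H in at_top. \<forall>n. real n < g H + 2 \<longrightarrow> K n \<le> sqrt (ln H)"
    and \<eta>: "filterlim \<eta> at_top at_top" "\<forall>\<^sub>F H in at_top. \<eta> H \<le> g H"
    and X: "filterlim X at_top at_top" and pow: "eq_pow_o1 (\<lambda>H. X H powr \<eta> H) (1 / 12)"
    and r: "1 \<le> r" "r \<le> 22" and \<epsilon>: "\<epsilon> > 0"
  shows "\<forall>\<^sub>F H in at_top.
    H powr (- ((real r - 1) / 24) - \<epsilon>) \<le> measure_pmf.prob (matrix_pmf \<eta> X H) (rank_ge r) \<and>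
    measure_pmf.prob (matrix_pmf \<eta> X H) (rank_ge r) \<le> H powr (- ((real r - 1) / 24) + \<epsilon>)"
proof -
  \<comment> \<open>The errors add up to at most 33.5 times \<open>\<delta> * l\<close>: 1 for ln 2,
    1 for \<open>ln s\<close>, 21 for the shift between \<open>n\<close> and \<eta>, and 21/2 for
    the error term of the hypothesis. The factor 21 bounds \<open>r - 1\<close>.\<close>
  define \<delta> where "\<delta> = \<epsilon> / 40"
  have \<delta>: "\<delta> > 0" using \<epsilon> by (simp add: \<delta>_def)
  obtain \<epsilon>1 where \<epsilon>1: "(\<epsilon>1 \<longlongrightarrow> 0) at_top" "\<forall>\<^sub>F H in at_top. X H powr \<eta> H = H powr (1 / 12 + \<epsilon>1 H)"
    using pow unfolding eq_pow_o1_def by blast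
  have "\<forall>\<^sub>F H in at_top. dist (\<epsilon>1 H) 0 < min \<delta> (1 / 24)"
    using \<delta> by (intro tendstoD[OF \<epsilon>1(1)]) auto
  then have e1: "\<forall>\<^sub>F H in at_top. \<bar>\<epsilon>1 H\<bar> \<le> \<delta> \<and> \<bar>\<epsilon>1 H\<bar> \<le> 1 / 24"
    by eventually_elim (auto simp: dist_real_def)
  \<comment> \<open>The bound 23 ensures \<open>r < n\<close> for all \<open>r \<le> 22\<close>, and
    1 / \<delta> makes ln X at most \<delta> ln H.\<close>
  have e2: "\<forall>\<^sub>F H in at_top. max 23 (1 / \<delta>) \<le> \<eta> H" using \<eta>(1) unfolding filterlim_at_top by blast
  have e3: "\<forall>\<^sub>F H in at_top. 1 \<le> X H" using X by (simp add: filterlim_at_top)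
  have e4: "\<forall>\<^sub>F H :: real in at_top. sqrt (ln H) \<le> exp (sqrt (ln H) / 24)" by real_asymp
  have e5: "\<forall>\<^sub>F H :: real in at_top. ln (sqrt (ln H)) \<le> \<delta> * ln H" using \<delta> by real_asymp
  have e6: "\<forall>\<^sub>F H :: real in at_top. ln 2 \<le> \<delta> * ln H" using \<delta> by real_asymp
  have e7: "\<forall>\<^sub>F H :: real in at_top. 1 \<le> sqrt (ln H)" by real_asymp
  show ?thesis
    using e1 e2 e3 e4 e5 e6 e7 \<epsilon>1(2) g \<eta>(2) eventually_gt_at_top[of 1]
  proof eventually_elim
    case (elim H)
    define l where "l = ln H"
    define x where "x = ln (X H)"
    define s where "s = sqrt (ln H)"
    define t where "t = \<eta> H"
    have t: "t \<ge> 23" "1 / \<delta> \<le> t" using elim(2) by (auto simp: t_def)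
    have X1: "X H \<ge> 1" by fact
    have l: "l > 0" using elim by (simp add: l_def)
    have x0: "x \<ge> 0" using X1 by (simp add: x_def)
    have s: "s \<ge> 1" "s * s = l" using elim(7) l by (auto simp: s_def l_def)
    have "ln (X H powr t) = ln (H powr (1 / 12 + \<epsilon>1 H))" using elim(8) by (simp add: t_def)
    then have tx: "t * x = (1 / 12 + \<epsilon>1 H) * l" using X1 elim(11) by (simp add: ln_powr x_def l_def)
    define u where "u = \<epsilon>1 H * l"
    have u: "\<bar>u\<bar> \<le> \<delta> * l" using elim(1) l unfolding u_def abs_mult by (intro mult_mono) auto
    have u2: "\<bar>u\<bar> \<le> 1 / 24 * l" using elim(1) l unfolding u_def abs_mult by (intro mult_mono) auto
    have tx': "t * x = l / 12 + u" using tx by (simp add: u_def algebra_simps)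
    have xl: "x \<le> \<delta> * l"
    proof -
      have "1 / \<delta> * x \<le> t * x" using t x0 by (intro mult_right_mono) auto
      also have "\<dots> \<le> l" using tx' u2 l by linarith
      finally show ?thesis using \<delta> by (simp add: field_simps)
    qed
    define mm where "mm = nat \<lceil>t\<rceil>"
    have m: "t \<le> real mm" "real (Suc mm) < t + 2"
      using matrix_pmf_prob(2,3)[of \<eta> H X] t X1 by (auto simp: t_def mm_def)
    have Ks: "K n \<le> s" if "real n < t + 2" for n
      using elim(9,10) that by (auto simp: s_def t_def)
    have "real mm < t + 2" using m by linarith
    then have "t \<le> s" using m(1) K[of mm] Ks[of mm] by linarith
    \<comment> \<open>From \<open>t \<le> s\<close> and \<open>t * x \<ge> s * s / 24\<close>
      follows \<open>x \<ge> s / 24\<close>. So the slow growth of \<eta> forces X above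
      \<open>s\<close>, and hence above every \<open>K n\<close> that occurs.\<close>
    have sX: "s \<le> X H"
    proof -
      have "s * (s / 24) = l / 24" using s by simp
      also have "\<dots> \<le> t * x" using tx' u2 by linarith
      also have "\<dots> \<le> s * x" using \<open>t \<le> s\<close> x0 by (intro mult_right_mono) auto
      finally have "s * (s / 24) \<le> s * x" .
      then have "s / 24 \<le> x" using s(1) mult_le_cancel_left_pos[of s "s / 24" x] by linarith
      then have "exp (s / 24) \<le> exp x" by simp
      also have "exp x = X H" using X1 by (simp add: x_def)
      finally show ?thesis using elim(4) by (simp add: s_def)
    qed
    have lns: "ln s \<le> \<delta> * l" "ln s \<ge> 0" using elim(5) s by (auto simp: s_def l_def)
    have Hp: "H powr a = exp (a * l)" for a using elim(11) by (simp add: powr_def l_def)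
    have Xp: "X H powr a = exp (a * x)" for a using X1 by (simp add: powr_def x_def)
    define p where "p n = measure_pmf.prob (pmf_of_set (alt_matrices n (X H))) (rank_ge r)" for n
    have P: "measure_pmf.prob (matrix_pmf \<eta> X H) (rank_ge r) = (p mm + p (Suc mm)) / 2"
      using matrix_pmf_prob(1)[of \<eta> H X "rank_ge r"] t X1 by (simp add: t_def p_def mm_def)
    have r1: "real r - 1 \<ge> 0" "real r - 1 \<le> 21" using r by auto
    define w where "w = real r - 1"
    have up: "p n \<le> exp ((- ((real r - 1) / 24) + \<epsilon>) * l)" if n: "t \<le> real n" "real n < t + 2" for n
    proof -
      have rn: "r < n" using n t r by linarith
      have "K n \<le> X H" using Ks[OF n(2)] sX by simp
      then have "p n \<le> K n * X H powr (1 - real n * (real r - 1) / 2)"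
        using KP r(1) rn unfolding p_def by blast
      also have "\<dots> \<le> s * exp ((1 - real n * (real r - 1) / 2) * x)"
        unfolding Xp using Ks[OF n(2)] by (intro mult_right_mono) auto
      also have "\<dots> = exp (ln s + (1 - real n * (real r - 1) / 2) * x)" using s by (simp add: exp_add)
      also have "\<dots> \<le> exp ((- ((real r - 1) / 24) + \<epsilon>) * l)"
      proof -
        have "t * x * w \<le> real n * x * w"
          using n x0 r1 by (intro mult_right_mono) (auto simp: w_def)
        then have 1: "(1 - real n * w / 2) * x \<le> x - (t * x) * w / 2"
          by (simp add: algebra_simps)
        have "- u * w \<le> (\<delta> * l) * 21" using u r1 \<delta> l by (intro mult_mono) (auto simp: w_def)
        moreover have "- (t * x) * w / 2 = - (l / 12) * w / 2 + (- u * w) / 2"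
          unfolding tx' by (simp add: field_simps)
        ultimately have 2: "- (t * x) * w / 2 \<le> - (l / 12) * w / 2 + 21 / 2 * (\<delta> * l)" by linarith
        define A where "A = (1 - real n * w / 2) * x"
        define B where "B = t * x * w / 2"
        define D where "D = \<delta> * l"
        define G where "G = l * w / 24"
        have "A \<le> x - B" using 1 by (simp only: A_def B_def)
        moreover have "- B \<le> - G + 21 / 2 * D" using 2 by (simp add: B_def G_def D_def)
        moreover have "x \<le> D" "ln s \<le> D" "D > 0" using xl lns mult_pos_pos[OF \<delta> l] by (auto simp: D_def)
        ultimately have "ln s + A \<le> - G + 40 * D" by linarith
        also have "\<dots> = (- (w / 24) + \<epsilon>) * l" by (simp add: G_def D_def \<delta>_def algebra_simps)
        finally have "ln s + (1 - real n * w / 2) * x \<le> (- (w / 24) + \<epsilon>) * l" by (simp only: A_def)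
        then show ?thesis unfolding w_def by (simp only: exp_le_cancel_iff)
      qed
      finally show ?thesis .
    qed
    \<comment> \<open>The factor 2 makes up for the probability 1/2 of choosing the size of the
      right parity.\<close>
    have lo: "2 * exp ((- ((real r - 1) / 24) - \<epsilon>) * l) \<le> p n"
      if n: "t \<le> real n" "real n < t + 2" and ev: "even (n - r)" for n
    proof -
      have rn: "r < n" using n t r by linarith
      have "K n \<le> X H" using Ks[OF n(2)] sX by simp
      then have p: "X H powr (- (real n * (real r - 1) / 2)) / K n \<le> p n"
        using KP r(1) rn ev unfolding p_def by blast
      have "2 * exp ((- ((real r - 1) / 24) - \<epsilon>) * l) = exp (ln 2 + (- ((real r - 1) / 24) - \<epsilon>) * l)"
        by (simp add: exp_add)
      also have "\<dots> \<le> exp (- (real n * (real r - 1) / 2) * x - ln s)"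
      proof -
        have "real n * x * w \<le> (t + 2) * x * w"
          using n x0 r1 by (intro mult_right_mono) (auto simp: w_def)
        then have 1: "- ((t * x) * w / 2) - x * w \<le> - (real n * w / 2) * x"
          by (simp add: algebra_simps)
        have "u * w \<le> (\<delta> * l) * 21" using u r1 \<delta> l by (intro mult_mono) (auto simp: w_def)
        moreover have "- ((t * x) * w / 2) = - ((l / 12) * w / 2) - (u * w) / 2"
          unfolding tx' by (simp add: field_simps)
        ultimately have 2: "- ((l / 12) * w / 2) - 21 / 2 * (\<delta> * l) \<le> - ((t * x) * w / 2)" by linarith
        have 3: "x * w \<le> (\<delta> * l) * 21" using xl r1 x0 \<delta> l by (intro mult_mono) (auto simp: w_def)
        have 4: "ln 2 \<le> \<delta> * l" using elim(6) by (simp add: l_def)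
        define A where "A = - (real n * w / 2) * x"
        define B where "B = t * x * w / 2"
        define D where "D = \<delta> * l"
        define G where "G = l * w / 24"
        define Q where "Q = x * w"
        have "- B - Q \<le> A" using 1 by (simp only: A_def B_def Q_def)
        moreover have "- G - 21 / 2 * D \<le> - B" using 2 by (simp add: B_def G_def D_def)
        moreover have "ln s \<le> D" "D > 0" "Q \<le> 21 * D" "ln 2 \<le> D"
          using lns mult_pos_pos[OF \<delta> l] 3 4 by (auto simp: D_def Q_def)
        ultimately have "ln 2 + (- G - 40 * D) \<le> A - ln s" by linarith
        moreover have "- G - 40 * D = (- (w / 24) - \<epsilon>) * l" by (simp add: G_def D_def \<delta>_def algebra_simps)
        ultimately have "ln 2 + (- (w / 24) - \<epsilon>) * l \<le> - (real n * w / 2) * x - ln s" by (simp only: A_def)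
        then show ?thesis unfolding w_def by (simp only: exp_le_cancel_iff)
      qed
      also have "\<dots> = X H powr (- (real n * (real r - 1) / 2)) / s"
        unfolding Xp using s by (simp add: exp_diff)
      also have "\<dots> \<le> X H powr (- (real n * (real r - 1) / 2)) / K n"
        using Ks[OF n(2)] K[of n] rn s by (intro divide_left_mono) (auto intro!: mult_pos_pos less_le_trans[OF _ K[of n]])
      also have "\<dots> \<le> p n" by (rule p)
      finally show ?thesis .
    qed
    have p0: "p n \<ge> 0" for n by (simp add: p_def)
    show ?case unfolding P Hp
    proof
      have m2: "real mm < t + 2" "t \<le> real (Suc mm)" using m by linarith+
      show "(p mm + p (Suc mm)) / 2 \<le> exp ((- ((real r - 1) / 24) + \<epsilon>) * l)"
      proof -
        have "p mm + p (Suc mm) \<le> exp ((- ((real r - 1) / 24) + \<epsilon>) * l) + exp ((- ((real r - 1) / 24) + \<epsilon>) * l)"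
          by (intro add_mono up m m2)
        then show ?thesis by simp
      qed
      have rm: "r < mm" using m t r by linarith
      show "exp ((- ((real r - 1) / 24) - \<epsilon>) * l) \<le> (p mm + p (Suc mm)) / 2"
      proof (cases "even (mm - r)")
        case True
        then show ?thesis using add_mono[OF lo[OF m(1) m2(1)] p0[of "Suc mm"]] by simp
      next
        case False
        then have "even (Suc mm - r)" using rm by (simp add: Suc_diff_le less_imp_le)
        then show ?thesis using add_mono[OF p0[of mm] lo[OF m2(2) m(2)]] by simp
      qed
    qed
  qed
qed

lemma summable_poly_geometric:
  assumes "a > 0"
  shows "summable (\<lambda>j. (C + 18 * real j) * 2 powr (- (real j * a)))"
proof -
  have "\<forall>\<^sub>F j in sequentially. \<bar>C\<bar> + 18 * real j \<le> 2 powr (real j * (a / 2))" using assms by real_asymp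
  then have "\<forall>\<^sub>F j in sequentially. norm ((C + 18 * real j) * 2 powr (- (real j * a))) \<le> (2 powr (- (a / 2))) ^ j"
  proof eventually_elim
    case (elim j)
    have "norm ((C + 18 * real j) * 2 powr (- (real j * a))) \<le> (\<bar>C\<bar> + 18 * real j) * 2 powr (- (real j * a))"
      unfolding real_norm_def abs_mult by (intro mult_mono) auto
    also have "\<dots> \<le> 2 powr (real j * (a / 2)) * 2 powr (- (real j * a))" using elim by (intro mult_right_mono) auto
    also have "\<dots> = 2 powr (- (a / 2) * real j)" by (simp add: powr_add[symmetric] algebra_simps)
    also have "\<dots> = (2 powr (- (a / 2))) ^ j" by (subst powr_powr[symmetric]) (rule powr_realpow, simp)
    finally show ?case .
  qed
  moreover have "summable (\<lambda>j. (2 powr (- (a / 2))) ^ j :: real)"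
  proof (rule summable_geometric)
    have "(2::real) powr (- (a / 2)) < 2 powr 0" using assms by (intro powr_less_mono) auto
    then show "norm ((2::real) powr (- (a / 2))) < 1" by simp
  qed
  ultimately show ?thesis by (rule summable_comparison_test_ev)
qed

subsection \<open>Almost sure counts\<close>

lemma random_model_PiM:
  "random_model \<eta> X = PiM elliptic_curves (\<lambda>E. measure_pmf (matrix_pmf \<eta> X (height E)))"
  by (simp add: random_model_def)

lemma finite_curves_upto_dyadic: "finite (curves_upto (2 ^ j))"
  by (rule curves_upto_le(1)) (rule one_le_power, simp)

lemma curves_upto_subset: "curves_upto H \<subseteq> elliptic_curves"
  by (auto simp: curves_upto_def)

text \<open>The expected number of curves is 2^(j (21 - r)/24) up to a small loss in the exponent;
  raising the threshold by \<epsilon> makes the bounds from Markov's inequality summable.\<close>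

lemma AE_count_upper:
  assumes r: "1 \<le> r" "r \<le> 21" and \<epsilon>: "\<epsilon> > 0"
    and pb: "\<And>\<epsilon>. \<epsilon> > 0 \<Longrightarrow> \<forall>\<^sub>F H in at_top.
      measure_pmf.prob (matrix_pmf \<eta> X H) (rank_ge r) \<le> H powr (- ((real r - 1) / 24) + \<epsilon>)"
  shows "AE \<omega> in random_model \<eta> X. \<forall>\<^sub>F j in sequentially.
    real (card {E \<in> curves_upto (2 ^ j). \<omega> E \<in> rank_ge r}) < 2 powr (real j * ((21 - real r) / 24 + \<epsilon>))"
proof -
  define p where "p H = measure_pmf.prob (matrix_pmf \<eta> X H) (rank_ge r)" for H
  \<comment> \<open>If (r - 1)/24 is below \<epsilon>/4, as for \<open>r = 1\<close>, the power
    bound exceeds 1 and is replaced by the trivial bound 1.\<close>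
  define s where "s = max 0 ((real r - 1) / 24 - \<epsilon> / 4)"
  define b where "b = (21 - real r) / 24 + \<epsilon>"
  have s: "s \<ge> 0" "s \<le> 5 / 6 + 0" "5 / 6 - s \<le> b - 3 / 4 * \<epsilon>"
    using r \<epsilon> by (auto simp: s_def b_def max_def field_simps)
  have "\<epsilon> / 4 > 0" using \<epsilon> by simp
  from pb[OF this] obtain h where h: "\<And>H. H \<ge> h \<Longrightarrow> p H \<le> H powr (- ((real r - 1) / 24) + \<epsilon> / 4)"
    unfolding p_def eventually_at_top_linorder by blast
  have f: "p (height E) \<le> height E powr (- s)" if "E \<in> elliptic_curves" "max h 1 \<le> height E" for E
  proof (cases "(real r - 1) / 24 - \<epsilon> / 4 \<ge> 0")
    case True
    then show ?thesis using h[of "height E"] that by (simp add: s_def)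
  next
    case False
    then have "s = 0" by (simp add: s_def)
    then show ?thesis using that by (simp add: p_def)
  qed
  have p0: "0 \<le> p (height E)" for E by (simp add: p_def)
  obtain C where C: "C \<ge> 0" and sum: "\<And>j. (\<Sum>E\<in>curves_upto (2 ^ j). p (height E)) \<le>
      (C + 18 * real j) * 2 powr (real j * (5 / 6 + 0 - s))"
    using curves_upto_sum_le[OF s(1,2) order_refl p0 f] by blast
  have "summable (\<lambda>j. (\<Sum>E\<in>curves_upto (2 ^ j). p (height E)) / 2 powr (real j * b))"
  proof (rule summable_comparison_test)
    show "summable (\<lambda>j. (C + 18 * real j) * 2 powr (- (real j * (3 / 4 * \<epsilon>))))"
      using \<epsilon> by (intro summable_poly_geometric) simp
    show "\<exists>N. \<forall>j\<ge>N. norm ((\<Sum>E\<in>curves_upto (2 ^ j). p (height E)) / 2 powr (real j * b)) \<le>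
        (C + 18 * real j) * 2 powr (- (real j * (3 / 4 * \<epsilon>)))"
    proof (intro exI allI impI)
      fix j
      have "norm ((\<Sum>E\<in>curves_upto (2 ^ j). p (height E)) / 2 powr (real j * b)) =
          (\<Sum>E\<in>curves_upto (2 ^ j). p (height E)) / 2 powr (real j * b)"
        using p0 by (simp add: sum_nonneg)
      also have "\<dots> \<le> (C + 18 * real j) * 2 powr (real j * (5 / 6 + 0 - s)) / 2 powr (real j * b)"
        using sum[of j] by (intro divide_right_mono) auto
      also have "\<dots> = (C + 18 * real j) * 2 powr (real j * (5 / 6 + 0 - s) - real j * b)"
        by (simp add: powr_diff)
      also have "\<dots> \<le> (C + 18 * real j) * 2 powr (- (real j * (3 / 4 * \<epsilon>)))"
      proof (intro mult_left_mono powr_mono)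
        have "real j * (5 / 6 - s) \<le> real j * (b - 3 / 4 * \<epsilon>)" using s(3) by (intro mult_left_mono) auto
        then show "real j * (5 / 6 + 0 - s) - real j * b \<le> - (real j * (3 / 4 * \<epsilon>))" by (simp add: algebra_simps)
      qed (use C in auto)
      finally show "norm ((\<Sum>E\<in>curves_upto (2 ^ j). p (height E)) / 2 powr (real j * b)) \<le>
        (C + 18 * real j) * 2 powr (- (real j * (3 / 4 * \<epsilon>)))" .
    qed
  qed
  then show ?thesis unfolding random_model_PiM p_def b_def
    by (intro AE_eventually_count_less finite_curves_upto_dyadic curves_upto_subset) auto
qed

text \<open>For \<open>r \<le> 20\<close> and \<open>\<epsilon> \<le> 1 / 48\<close> the exponent is
  at least 1/24 - 1/48 > 0, so the expected number grows exponentially in \<open>j\<close> and the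
  lower tail bounds are summable.\<close>

lemma AE_count_lower:
  assumes r: "1 \<le> r" "r \<le> 20" and \<epsilon>: "\<epsilon> > 0" "\<epsilon> \<le> 1 / 48"
    and pb: "\<And>\<epsilon>. \<epsilon> > 0 \<Longrightarrow> \<forall>\<^sub>F H in at_top.
      H powr (- ((real r - 1) / 24) - \<epsilon>) \<le> measure_pmf.prob (matrix_pmf \<eta> X H) (rank_ge r)"
  shows "\<exists>c>0. AE \<omega> in random_model \<eta> X. \<forall>\<^sub>F j in sequentially.
    c * 2 powr (real j * ((21 - real r) / 24 - \<epsilon>)) < real (card {E \<in> curves_upto (2 ^ j). \<omega> E \<in> rank_ge r})"
proof -
  define p where "p H = measure_pmf.prob (matrix_pmf \<eta> X H) (rank_ge r)" for H
  define s where "s = (real r - 1) / 24 + \<epsilon>"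
  define b where "b = (21 - real r) / 24 - \<epsilon>"
  define \<mu> where "\<mu> j = (\<Sum>E\<in>curves_upto (2 ^ j). p (height E))" for j
  have b: "b > 0" "b = 5 / 6 - s" using r \<epsilon> by (auto simp: b_def s_def field_simps)
  have s: "s \<ge> 0" using r \<epsilon> by (simp add: s_def)
  from pb[OF \<epsilon>(1)] obtain h where h: "\<And>H. H \<ge> h \<Longrightarrow> H powr (- s) \<le> p H"
    unfolding p_def s_def eventually_at_top_linorder by auto
  obtain c where c: "c > 0" and lo: "\<And>H. H \<ge> 108 \<Longrightarrow> c * H powr (5 / 6) \<le> real (card (curves_upto H))"
    using curves_upto_ge by blast
  \<comment> \<open>The finitely many curves of height at most \<open>h'\<close>, for which the
    probability is not controlled, are discarded. Eventually they make up at most half of the lower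
    bound for the number of curves.\<close>
  define h' where "h' = max h 1"
  define N where "N = real (card (curves_upto h'))"
  have "\<forall>\<^sub>F j in sequentially. N \<le> c / 2 * 2 powr (real j * (5 / 6))" using c by real_asymp
  moreover have "\<forall>\<^sub>F j in sequentially. (108::real) \<le> 2 powr real j" by real_asymp
  ultimately have ev: "\<forall>\<^sub>F j in sequentially. c / 2 * 2 powr (real j * b) \<le> \<mu> j"
  proof eventually_elim
    case (elim j)
    let ?A = "curves_upto (2 ^ j)" and ?B = "curves_upto h'"
    have fin: "finite ?A" "finite ?B" using finite_curves_upto_dyadic curves_upto_le(1)[of h'] by (auto simp: h'_def)
    have "c * 2 powr (real j * (5 / 6)) = c * (2 ^ j) powr (5 / 6)"
      by (simp add: powr_realpow[symmetric] powr_powr)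
    also have "\<dots> \<le> real (card ?A)" using elim(2) by (intro lo) (simp add: powr_realpow)
    finally have cA: "c / 2 * 2 powr (real j * (5 / 6)) \<le> real (card ?A) - N" using elim(1) by simp
    have "card ?A \<le> card ?B + card (?A - ?B)"
      using card_Un_le[of ?B "?A - ?B"] card_mono[of "?B \<union> (?A - ?B)" ?A] fin by auto
    then have cAB: "real (card ?A) - N \<le> real (card (?A - ?B))" unfolding N_def by linarith
    have "c / 2 * 2 powr (real j * b) = c / 2 * 2 powr (real j * (5 / 6)) * (2 ^ j) powr (- s)"
      unfolding b(2) by (simp add: powr_realpow[symmetric] powr_powr powr_add[symmetric] algebra_simps)
    also have "\<dots> \<le> real (card (?A - ?B)) * (2 ^ j) powr (- s)"
      using cA cAB by (intro mult_right_mono) auto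
    also have "\<dots> = (\<Sum>E\<in>?A - ?B. (2 ^ j) powr (- s))" by simp
    also have "\<dots> \<le> (\<Sum>E\<in>?A - ?B. p (height E))"
    proof (rule sum_mono)
      fix E assume "E \<in> ?A - ?B"
      then have E: "height E \<le> 2 ^ j" "h' < height E" by (auto simp: curves_upto_def)
      have "(2 ^ j) powr (- s) \<le> height E powr (- s)" using E s by (intro powr_mono2') (auto simp: h'_def)
      also have "\<dots> \<le> p (height E)" using E by (intro h) (simp add: h'_def)
      finally show "(2 ^ j) powr (- s) \<le> p (height E)" .
    qed
    also have "\<dots> \<le> \<mu> j" unfolding \<mu>_def using fin by (intro sum_mono2) (auto simp: p_def)
    finally show ?case .
  qed
  have "summable (\<lambda>j. exp (- \<mu> j / 4))"
  proof (rule summable_comparison_test_ev)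
    show "summable (\<lambda>j. 8 / c * (2 powr (- b)) ^ j :: real)"
    proof (intro summable_mult summable_geometric)
      have "(2::real) powr (- b) < 2 powr 0" using b by (intro powr_less_mono) auto
      then show "norm ((2::real) powr (- b)) < 1" by simp
    qed
    show "\<forall>\<^sub>F j in sequentially. norm (exp (- \<mu> j / 4)) \<le> 8 / c * (2 powr (- b)) ^ j"
      using ev
    proof eventually_elim
      case (elim j)
      define y where "y = c / 8 * 2 powr (real j * b)"
      have y: "y > 0" using c by (simp add: y_def)
      have "norm (exp (- \<mu> j / 4)) \<le> exp (- y)" using elim by (simp add: y_def)
      \<comment> \<open>The reciprocal is enough, since \<open>y\<close> grows
        geometrically.\<close>
      also have "\<dots> \<le> 1 / y"
      proof -
        have "y \<le> exp y" using exp_ge_add_one_self[of y] by linarith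
        then show ?thesis using y by (simp add: exp_minus field_simps)
      qed
      also have "\<dots> = 8 / c * 2 powr (- b * real j)" by (simp add: y_def powr_minus field_simps)
      also have "2 powr (- b * real j) = (2 powr (- b)) ^ j" by (subst powr_powr[symmetric]) (rule powr_realpow, simp)
      finally show ?case .
    qed
  qed
  then have "AE \<omega> in random_model \<eta> X. \<forall>\<^sub>F j in sequentially.
      \<mu> j / 4 < real (card {E \<in> curves_upto (2 ^ j). \<omega> E \<in> rank_ge r})"
    unfolding random_model_PiM p_def \<mu>_def
    by (intro AE_eventually_count_greater finite_curves_upto_dyadic curves_upto_subset)
  then have "AE \<omega> in random_model \<eta> X. \<forall>\<^sub>F j in sequentially.
      c / 8 * 2 powr (real j * b) < real (card {E \<in> curves_upto (2 ^ j). \<omega> E \<in> rank_ge r})"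
  proof eventually_elim
    case (elim \<omega>)
    from elim ev show ?case by eventually_elim simp
  qed
  then show ?thesis unfolding b_def using c by (intro exI[of _ "c / 8"]) simp
qed

text \<open>The exponent 21/24 - 1/48 = 41/48 exceeds 5/6 = 40/48, so the expected numbers in the
  dyadic blocks are summable. A count below 1 is 0, so almost surely only finitely many blocks
  contain an exception.\<close>

lemma AE_finite_exceptions:
  assumes pb: "\<forall>\<^sub>F H in at_top.
      measure_pmf.prob (matrix_pmf \<eta> X H) (rank_ge 22) \<le> H powr (- ((real 22 - 1) / 24) + 1 / 48)"
  shows "AE \<omega> in random_model \<eta> X. finite {E \<in> elliptic_curves. \<omega> E \<in> rank_ge 22}"
proof -
  define p where "p H = measure_pmf.prob (matrix_pmf \<eta> X H) (rank_ge 22)" for H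
  define s :: real where "s = 41 / 48"
  have "- ((real 22 - 1) / 24) + 1 / 48 = - s" by (simp add: s_def)
  then have "\<forall>\<^sub>F H in at_top. p H \<le> H powr (- s)" using pb unfolding p_def by (simp only:)
  then obtain h where h: "\<And>H. H \<ge> h \<Longrightarrow> p H \<le> H powr (- s)"
    unfolding eventually_at_top_linorder by blast
  have fin: "finite (curve_block j)" for j
    using finite_curves_upto_dyadic[of "Suc j"] by (simp add: curve_block_def)
  have sub: "curve_block j \<subseteq> elliptic_curves" for j by (auto simp: curve_block_def curves_upto_def)
  have "summable (\<lambda>j. (\<Sum>E\<in>curve_block j. p (height E)) / 1)"
  proof (rule summable_comparison_test_ev)
    show "summable (\<lambda>j. (18 + 18 * real j) * 2 powr (- (real j * (1 / 48))))"
      by (rule summable_poly_geometric) simp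
    have "\<forall>\<^sub>F j in sequentially. h \<le> 2 powr real j" by real_asymp
    then show "\<forall>\<^sub>F j in sequentially. norm ((\<Sum>E\<in>curve_block j. p (height E)) / 1) \<le>
        (18 + 18 * real j) * 2 powr (- (real j * (1 / 48)))"
    proof eventually_elim
      case (elim j)
      have "norm ((\<Sum>E\<in>curve_block j. p (height E)) / 1) = (\<Sum>E\<in>curve_block j. p (height E))"
        by (simp add: sum_nonneg p_def)
      also have "\<dots> \<le> 18 * 2 powr (real j * (5 / 6 - s))"
        using elim h by (intro curve_block_sum_le[of s h]) (auto simp: s_def powr_realpow)
      also have "real j * (5 / 6 - s) = - (real j * (1 / 48))" by (simp add: s_def)
      also have "18 * 2 powr (- (real j * (1 / 48))) \<le> (18 + 18 * real j) * 2 powr (- (real j * (1 / 48)))"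
        by (intro mult_right_mono) auto
      finally show ?case .
    qed
  qed
  then have "AE \<omega> in random_model \<eta> X. \<forall>\<^sub>F j in sequentially.
      real (card {E \<in> curve_block j. \<omega> E \<in> rank_ge 22}) < 1"
    unfolding random_model_PiM p_def by (intro AE_eventually_count_less fin sub) auto
  then show ?thesis
  proof eventually_elim
    case (elim \<omega>)
    then obtain j0 where j0: "\<And>j. j \<ge> j0 \<Longrightarrow> real (card {E \<in> curve_block j. \<omega> E \<in> rank_ge 22}) < 1"
      by (auto simp: eventually_sequentially)
    have none: "\<omega> E \<notin> rank_ge 22" if "j \<ge> j0" "E \<in> curve_block j" for j E
    proof -
      have "card {E \<in> curve_block j. \<omega> E \<in> rank_ge 22} = 0" using j0[OF that(1)] by simp
      then have "{E \<in> curve_block j. \<omega> E \<in> rank_ge 22} = {}" using fin[of j] by simp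
      then show ?thesis using that(2) by blast
    qed
    have "{E \<in> elliptic_curves. \<omega> E \<in> rank_ge 22} \<subseteq> curves_upto (2 ^ j0)"
    proof
      fix E assume E: "E \<in> {E \<in> elliptic_curves. \<omega> E \<in> rank_ge 22}"
      show "E \<in> curves_upto (2 ^ j0)"
      proof (rule ccontr)
        assume neg: "E \<notin> curves_upto (2 ^ j0)"
        have notin: "E \<notin> curves_upto (2 ^ (j0 + i))" for i
        proof (induction i)
          case (Suc i)
          then show ?case using none[of "j0 + i" E] E by (auto simp: curve_block_def)
        qed (use neg in simp)
        obtain i where i: "height E < 2 ^ i" using real_arch_pow[of 2 "height E"] by auto
        also have "(2::real) ^ i \<le> 2 ^ (j0 + i)" by (rule power_increasing) auto
        finally have "E \<in> curves_upto (2 ^ (j0 + i))" using E by (simp add: curves_upto_def)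
        then show False using notin by blast
      qed
    qed
    then show ?case using finite_curves_upto_dyadic finite_subset by blast
  qed
qed

text \<open>The bound \<open>g\<close> is fixed before \<eta> and X: how slow is slow enough depends
  on the counting constants alone.\<close>

theorem theorem7p3p3:
  shows "\<exists>g :: real \<Rightarrow> real. filterlim g at_top at_top \<and>
    (\<forall>\<eta> X :: real \<Rightarrow> real.
      mono_on {0<..} \<eta> \<longrightarrow> mono_on {0<..} X \<longrightarrow>
      filterlim \<eta> at_top at_top \<longrightarrow> filterlim X at_top at_top \<longrightarrow>
      (\<forall>\<^sub>F H in at_top. \<eta> H \<le> g H) \<longrightarrow>
      eq_pow_o1 (\<lambda>H. X H powr \<eta> H) (1 / 12) \<longrightarrow>
      (AE \<omega> in random_model \<eta> X.
        finite {E \<in> elliptic_curves. \<not> rk' \<omega> E \<le> 21} \<and>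
        (\<forall>r :: nat. 1 \<le> r \<and> r \<le> 20 \<longrightarrow>
          eq_pow_o1 (\<lambda>H. real (card {E \<in> curves_upto H. rk' \<omega> E \<ge> r})) ((21 - real r) / 24)) \<and>
        le_pow_o1 (\<lambda>H. real (card {E \<in> curves_upto H. rk' \<omega> E \<ge> 21})) 0))"
proof -
  obtain K :: "nat \<Rightarrow> real" where monoK: "mono K" and K: "\<And>n. real n \<le> K n"
    and KP: "\<forall>n X r. K n \<le> X \<longrightarrow> 1 \<le> r \<longrightarrow> r < n \<longrightarrow>
        measure_pmf.prob (pmf_of_set (alt_matrices n X)) (rank_ge r) \<le> K n * X powr (1 - real n * (real r - 1) / 2) \<and>
        (even (n - r) \<longrightarrow> X powr (- (real n * (real r - 1) / 2)) / K n \<le>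
          measure_pmf.prob (pmf_of_set (alt_matrices n X)) (rank_ge r))"
    using rank_prob_bounds by blast
  obtain g where g: "filterlim g at_top at_top"
    and gK: "\<forall>\<^sub>F H in at_top. \<forall>n. real n < g H + 2 \<longrightarrow> K n \<le> sqrt (ln H)"
    using slow_function_exists[OF monoK K] by blast
  have rk: "rk' \<omega> E \<ge> r \<longleftrightarrow> \<omega> E \<in> rank_ge r" for \<omega> E r
    by (simp add: rk'_def rank_ge_def)
  show ?thesis
  proof (intro exI[of _ g] conjI g allI impI)
    fix \<eta> X :: "real \<Rightarrow> real"
    assume "filterlim \<eta> at_top at_top" "filterlim X at_top at_top"
      "\<forall>\<^sub>F H in at_top. \<eta> H \<le> g H" "eq_pow_o1 (\<lambda>H. X H powr \<eta> H) (1 / 12)"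
    note pb = rank_prob_power_bounds[OF K KP gK this(1,3,2,4)]
    have lob: "\<forall>\<^sub>F H in at_top. H powr (- ((real r - 1) / 24) - \<epsilon>) \<le> measure_pmf.prob (matrix_pmf \<eta> X H) (rank_ge r)"
      if "1 \<le> r" "r \<le> 22" "\<epsilon> > 0" for r \<epsilon>
      using pb[OF that] by eventually_elim simp
    have upb: "\<forall>\<^sub>F H in at_top. measure_pmf.prob (matrix_pmf \<eta> X H) (rank_ge r) \<le> H powr (- ((real r - 1) / 24) + \<epsilon>)"
      if "1 \<le> r" "r \<le> 22" "\<epsilon> > 0" for r \<epsilon>
      using pb[OF that] by eventually_elim simp
    \<comment> \<open>Almost sure statements can be combined for countably many exponents, so
      \<epsilon> runs through a sequence. All its terms are at most 1/48, as the lower bound for the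
      counts requires.\<close>
    define \<epsilon> where "\<epsilon> i = 1 / (48 * (real i + 1))" for i :: nat
    have \<epsilon>: "\<epsilon> i > 0" "\<epsilon> i \<le> 1 / 48" for i by (auto simp: \<epsilon>_def field_simps)
    have \<epsilon>_small: "\<exists>i. \<epsilon> i < e" if "e > 0" for e
    proof -
      obtain i where "1 / e < real i" using reals_Archimedean2 by blast
      then have "1 < e * real i" using that by (simp add: field_simps)
      also have "\<dots> \<le> e * (48 * (real i + 1))" using that by (intro mult_left_mono) auto
      finally have "\<epsilon> i < e" by (simp add: \<epsilon>_def field_simps)
      then show ?thesis ..
    qed
    let ?N = "\<lambda>\<omega> r H. real (card {E \<in> curves_upto H. \<omega> E \<in> rank_ge r})"
    have U: "AE \<omega> in random_model \<eta> X. \<forall>r\<in>{1..21}. \<forall>i.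
        \<forall>\<^sub>F j in sequentially. ?N \<omega> r (2 ^ j) < 2 powr (real j * ((21 - real r) / 24 + \<epsilon> i))"
      unfolding AE_ball_countable[OF countable_finite[OF finite_atLeastAtMost]] AE_all_countable
      using upb \<epsilon>(1) by (intro ballI allI AE_count_upper) auto
    \<comment> \<open>The constants of the lower bound have to be fixed before the sample point,
      hence their choice as a function of \<open>r\<close> and \<open>i\<close>.\<close>
    define good where "good r i c \<longleftrightarrow> c > 0 \<and> (AE \<omega> in random_model \<eta> X. \<forall>\<^sub>F j in sequentially.
        c * 2 powr (real j * ((21 - real r) / 24 - \<epsilon> i)) < ?N \<omega> r (2 ^ j))" for r i and c :: real
    define c where "c r i = (SOME c. good r i c)" for r i
    have good: "good r i (c r i)" if r: "r \<in> {1..20}" for r i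
    proof -
      have "\<exists>c>0. AE \<omega> in random_model \<eta> X. \<forall>\<^sub>F j in sequentially.
          c * 2 powr (real j * ((21 - real r) / 24 - \<epsilon> i)) < ?N \<omega> r (2 ^ j)"
        using r lob \<epsilon> by (intro AE_count_lower) auto
      then have "\<exists>c. good r i c" unfolding good_def .
      then show ?thesis unfolding c_def by (rule someI_ex)
    qed
    have c: "c r i > 0" if "r \<in> {1..20}" for r i
      using good[OF that] unfolding good_def by (rule conjunct1)
    have cAE: "AE \<omega> in random_model \<eta> X. \<forall>\<^sub>F j in sequentially.
        c r i * 2 powr (real j * ((21 - real r) / 24 - \<epsilon> i)) < ?N \<omega> r (2 ^ j)" if "r \<in> {1..20}" for r i
      using good[OF that] unfolding good_def by (rule conjunct2)
    have L: "AE \<omega> in random_model \<eta> X. \<forall>r\<in>{1..20}. \<forall>i.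
        \<forall>\<^sub>F j in sequentially. c r i * 2 powr (real j * ((21 - real r) / 24 - \<epsilon> i)) < ?N \<omega> r (2 ^ j)"
      unfolding AE_ball_countable[OF countable_finite[OF finite_atLeastAtMost]] AE_all_countable
      by (intro ballI allI cAE)
    have F: "AE \<omega> in random_model \<eta> X. finite {E \<in> elliptic_curves. \<omega> E \<in> rank_ge 22}"
      by (intro AE_finite_exceptions upb) auto
    from U L F show "AE \<omega> in random_model \<eta> X.
        finite {E \<in> elliptic_curves. \<not> rk' \<omega> E \<le> 21} \<and>
        (\<forall>r :: nat. 1 \<le> r \<and> r \<le> 20 \<longrightarrow>
          eq_pow_o1 (\<lambda>H. real (card {E \<in> curves_upto H. rk' \<omega> E \<ge> r})) ((21 - real r) / 24)) \<and>
        le_pow_o1 (\<lambda>H. real (card {E \<in> curves_upto H. rk' \<omega> E \<ge> 21})) 0"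
    proof eventually_elim
      case (elim \<omega>)
      have fin: "finite (curves_upto H)" for H
        using finite_subset[OF curves_upto_mono[of H "max 1 H"] curves_upto_le(1)[of "max 1 H"]] by simp
      have mono: "?N \<omega> r H \<le> ?N \<omega> r H'" if "H \<le> H'" for r H H'
      proof -
        have "{E \<in> curves_upto H. \<omega> E \<in> rank_ge r} \<subseteq> {E \<in> curves_upto H'. \<omega> E \<in> rank_ge r}"
          using curves_upto_mono[OF that] by auto
        then have "card {E \<in> curves_upto H. \<omega> E \<in> rank_ge r} \<le> card {E \<in> curves_upto H'. \<omega> E \<in> rank_ge r}"
          using fin[of H'] by (intro card_mono) auto
        then show ?thesis by simp
      qed
      have up: "\<forall>\<^sub>F H in at_top. ?N \<omega> r H \<le> H powr ((21 - real r) / 24 + e)" if r: "1 \<le> r" "r \<le> 21" and e: "e > 0" for r e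
      proof -
        obtain i where i: "\<epsilon> i < e / 2" using \<epsilon>_small[of "e / 2"] e by auto
        have ev: "\<forall>\<^sub>F j in sequentially. ?N \<omega> r (2 ^ j) \<le> 2 powr (real j * ((21 - real r) / 24 + \<epsilon> i))"
        proof (rule eventually_mono)
          show "\<forall>\<^sub>F j in sequentially. ?N \<omega> r (2 ^ j) < 2 powr (real j * ((21 - real r) / 24 + \<epsilon> i))"
            using elim(1) r by (simp only: atLeastAtMost_iff Ball_def)
        qed (rule less_imp_le)
        have b: "(21 - real r) / 24 + \<epsilon> i \<ge> 0" using r \<epsilon>(1)[of i] by (simp add: add_nonneg_nonneg less_imp_le)
        have "\<forall>\<^sub>F H in at_top. ?N \<omega> r H \<le> H powr ((21 - real r) / 24 + \<epsilon> i + e / 2)"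
        proof (rule dyadic_upper_bound[OF _ b ev])
          show "?N \<omega> r H \<le> ?N \<omega> r H'" if "H \<le> H'" for H H' by (rule mono[OF that])
        qed (use e in simp)
        then show ?thesis using eventually_ge_at_top[of 1]
        proof eventually_elim
          case (elim H)
          note elim(1)
          also have "H powr ((21 - real r) / 24 + \<epsilon> i + e / 2) \<le> H powr ((21 - real r) / 24 + e)"
            using elim(2) i by (intro powr_mono) auto
          finally show ?case .
        qed
      qed
      have lo: "\<forall>\<^sub>F H in at_top. H powr ((21 - real r) / 24 - e) \<le> ?N \<omega> r H" if r: "1 \<le> r" "r \<le> 20" and e: "e > 0" for r e
      proof -
        obtain i where i: "\<epsilon> i < e / 2" using \<epsilon>_small[of "e / 2"] e by auto
        have ev: "\<forall>\<^sub>F j in sequentially. c r i * 2 powr (real j * ((21 - real r) / 24 - \<epsilon> i)) \<le> ?N \<omega> r (2 ^ j)"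
        proof (rule eventually_mono)
          show "\<forall>\<^sub>F j in sequentially. c r i * 2 powr (real j * ((21 - real r) / 24 - \<epsilon> i)) < ?N \<omega> r (2 ^ j)"
            using elim(2) r by (simp only: atLeastAtMost_iff Ball_def)
        qed (rule less_imp_le)
        have b: "(21 - real r) / 24 - \<epsilon> i \<ge> 0" using r \<epsilon>(2)[of i] by simp
        have ci: "c r i > 0" using c r by simp
        have "\<forall>\<^sub>F H in at_top. H powr ((21 - real r) / 24 - \<epsilon> i - e / 2) \<le> ?N \<omega> r H"
        proof (rule dyadic_lower_bound[OF _ b ci ev])
          show "?N \<omega> r H \<le> ?N \<omega> r H'" if "H \<le> H'" for H H' by (rule mono[OF that])
        qed (use e in simp)
        then show ?thesis using eventually_ge_at_top[of 1]
        proof eventually_elim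
          case (elim H)
          have "H powr ((21 - real r) / 24 - e) \<le> H powr ((21 - real r) / 24 - \<epsilon> i - e / 2)"
            using elim(2) i by (intro powr_mono) auto
          also note elim(1)
          finally show ?case .
        qed
      qed
      have "{E \<in> elliptic_curves. \<not> rk' \<omega> E \<le> 21} = {E \<in> elliptic_curves. \<omega> E \<in> rank_ge 22}"
        unfolding rk[symmetric] by auto
      then have "finite {E \<in> elliptic_curves. \<not> rk' \<omega> E \<le> 21}" using elim(3) by simp
      moreover have "eq_pow_o1 (?N \<omega> r) ((21 - real r) / 24)" if "1 \<le> r" "r \<le> 20" for r
        using that by (intro eq_pow_o1I lo up) auto
      moreover have "le_pow_o1 (?N \<omega> 21) 0"
        using up[of 21] by (intro le_pow_o1I) auto
      ultimately show ?case unfolding rk by blast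
    qed
  qed
qed

end
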